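(* Let $T>0$, $d\ge1$, let $\mathcal A$ be an algebra with mean value, and let $\Phi_\tau(x)$ be a flow on $\mathbb{R}^d$ satisfying the flow assumptions (i)–(iv) of the context. Let $u^\varepsilon(t,x)$ be a sequence that is uniformly bounded (with respect to $\varepsilon$) in $L^2((0,T)\times\mathbb{R}^d)$. Then there exist a subsequence (still denoted $u^\varepsilon$) and a limit $u_0(t,X,s,y)\in L^2((0,T)\times\mathbb{R}^d\times\Delta(\mathcal A)\times\mathbb{T}^d)$ such that $u^\varepsilon$ weakly $\Sigma$-converges along $\Phi_\tau$ to $u_0$.
   Context: $\varepsilon$ runs over a sequence of positive numbers tending to $0$; $\mathbb{T}^d=\mathbb{R}^d/\mathbb{Z}^d$. Algebra with mean value. A closed subalgebra $\mathcal A$ of the complex-valued bounded uniformly continuous functions $\mathrm{BUC}(\mathbb{R})$, closed under complex conjugation, containing constants, translation invariant, and such that every $f\in\mathcal A$ has a mean value $M(f)$: $f(\cdot/\varepsilon)\rightharpoonup M(f)$ weakly-* in $L^\infty(\mathbb{R})$ as $\varepsilon\to0$. (No separability of $\mathcal A$ is assumed.) Gelfand transform. $\Delta(\mathcal A)$ is the set of unital multiplicative linear functionals $s:\mathcal A\to\mathbb{C}$ with the weak-* topology (compact Hausdorff). $\widehat f(s)=s(f)$ is an isometric isomorphism $\mathcal A\to C(\Delta(\mathcal A))$, and $\beta$ is the Radon probability measure on $\Delta(\mathcal A)$ with $M(f)=\int\widehat f\,d\beta$; $L^2$ spaces over $\Delta(\mathcal A)$ are with respect to $\beta$. For functions of further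 variables the transform is taken in the variable $\tau$ only. $\mathcal A\odot C(\mathbb{T}^d)$ is the closure in $\mathrm{BUC}(\mathbb{R}\times\mathbb{T}^d)$ of the linear span of products $f(\tau)g(y)$, $f\in\mathcal A$, $g\in C(\mathbb{T}^d)$. Flow assumptions. (i) $(\tau,x)\mapsto\Phi_\tau(x)$ is continuously differentiable from $\mathbb{R}\times\mathbb{R}^d$ to $\mathbb{R}^d$; (ii) it is a one-parameter group: $\Phi_t(\Phi_s(x))=\Phi_{t+s}(x)$ and $\Phi_0(x)=x$; (iii) the matrix $J(\tau,x)=\left(\partial\Phi^i_{-\tau}(x)/\partial x_j\right)_{i,j}$ satisfies $\sup_{x\in K}\sup_{\tau\in\mathbb{R}}|J(\tau,x)|<\infty$ for each compact $K\subset\mathbb{R}^d$; (iv) $\det J(\tau,x)=1$ for all $\tau,x$. Weak $\Sigma$-convergence along $\Phi_\tau$. $u^\varepsilon\in L^2((0,T)\times\mathbb{R}^d)$ converges to $u_0\in L^2((0,T)\times\mathbb{R}^d\times\Delta(\mathcal A)\times\mathbb{T}^d)$ if for all $\psi(t,X,\tau,y)\in L^2((0,T)\times\mathbb{R}^d;\mathcal A\odot C(\mathbb{T}^d))$ $$\lim_{\varepsilon\to0}\iint u^\varepsilon(t,x)\,\psi\left(t,\Phi_{-t/\varepsilon}(x),\tfrac t\varepsilon,\tfrac x\varepsilon\right)dx\,dt=\iiiint u_0(t,X,s,y)\,\widehat\psi(t,X,s,y)\,dy\,d\beta(s)\,dX\,dt .$$ *)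

theory Defs
  imports "HOL-Analysis.Analysis"
begin

text \<open>
  The scale parameter runs over a fixed sequence \<open>\<epsilon> n\<close> of positive numbers tending to 0, and
  every limit as \<open>\<epsilon> \<rightarrow> 0\<close> is taken along that sequence. In particular the mean value below is only
  required to exist along \<open>\<epsilon>\<close>; a function that has a mean value for the full limit
  \<open>\<epsilon> \<rightarrow> 0+\<close> has the same mean value along every such sequence.
  Weak-* convergence in \<open>L\<^sup>\<infinity>(\<real>)\<close> is tested against \<open>L\<^sup>1(\<real>)\<close>.
\<close>

definition has_mean_value :: "(nat \<Rightarrow> real) \<Rightarrow> (real \<Rightarrow> complex) \<Rightarrow> complex \<Rightarrow> bool" where
  "has_mean_value \<epsilon> f m \<longleftrightarrow>
     (\<forall>\<phi> :: real \<Rightarrow> complex. integrable lebesgue \<phi> \<longrightarrow>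
        (\<lambda>n. LINT x|lebesgue. f (x / \<epsilon> n) * \<phi> x) \<longlonglongrightarrow> (LINT x|lebesgue. m * \<phi> x))"

definition mean_value :: "(nat \<Rightarrow> real) \<Rightarrow> (real \<Rightarrow> complex) \<Rightarrow> complex" where
  "mean_value \<epsilon> f = (THE m. has_mean_value \<epsilon> f m)"

definition BUC :: "('a::metric_space \<Rightarrow> complex) set" where
  "BUC = {f. bounded (range f) \<and> uniformly_continuous_on UNIV f}"

definition algebra_with_mean_value :: "(nat \<Rightarrow> real) \<Rightarrow> (real \<Rightarrow> complex) set \<Rightarrow> bool" where
  "algebra_with_mean_value \<epsilon> A \<longleftrightarrow>
     A \<subseteq> BUC \<and>
     (\<forall>f\<in>A. \<forall>g\<in>A. (\<lambda>x. f x + g x) \<in> A \<and> (\<lambda>x. f x * g x) \<in> A) \<and>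
     (\<forall>c. \<forall>f\<in>A. (\<lambda>x. c * f x) \<in> A) \<and>
     (\<forall>F f. (\<forall>n. F n \<in> A) \<and> uniform_limit UNIV F f sequentially \<longrightarrow> f \<in> A) \<and>
     (\<forall>f\<in>A. (\<lambda>x. cnj (f x)) \<in> A) \<and>
     (\<forall>c. (\<lambda>x. c) \<in> A) \<and>
     (\<forall>f\<in>A. \<forall>a. (\<lambda>x. f (x + a)) \<in> A) \<and>
     (\<forall>f\<in>A. \<exists>m. has_mean_value \<epsilon> f m)"

text \<open>
  A functional on \<open>A\<close> is represented by its extension by \<open>undefined\<close> outside \<open>A\<close>, so that distinct
  elements of the spectrum are distinct functionals on \<open>A\<close>, and the weak-* topology is the
  subspace topology of the product topology of \<open>\<complex>\<^sup>A\<close>.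
\<close>

definition spectrum :: "(real \<Rightarrow> complex) set \<Rightarrow> ((real \<Rightarrow> complex) \<Rightarrow> complex) set" where
  "spectrum A = {s \<in> extensional A.
     (\<forall>f\<in>A. \<forall>g\<in>A. s (\<lambda>x. f x + g x) = s f + s g) \<and>
     (\<forall>c. \<forall>f\<in>A. s (\<lambda>x. c * f x) = c * s f) \<and>
     (\<forall>f\<in>A. \<forall>g\<in>A. s (\<lambda>x. f x * g x) = s f * s g) \<and>
     s (\<lambda>x. 1) = 1}"

definition spectrum_topology ::
    "(real \<Rightarrow> complex) set \<Rightarrow> ((real \<Rightarrow> complex) \<Rightarrow> complex) topology" where
  "spectrum_topology A = subtopology (product_topology (\<lambda>_. euclidean) A) (spectrum A)"

definition gelfand :: "(real \<Rightarrow> complex) \<Rightarrow> ((real \<Rightarrow> complex) \<Rightarrow> complex) \<Rightarrow> complex" where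
  "gelfand f s = s f"

definition radon_prob_on :: "'a topology \<Rightarrow> 'a measure \<Rightarrow> bool" where
  "radon_prob_on X \<mu> \<longleftrightarrow>
     space \<mu> = topspace X \<and>
     sets \<mu> = sigma_sets (topspace X) {U. openin X U} \<and>
     emeasure \<mu> (space \<mu>) = 1 \<and>
     (\<forall>B\<in>sets \<mu>. emeasure \<mu> B = (SUP K\<in>{K. compactin X K \<and> K \<subseteq> B}. emeasure \<mu> K))"

definition mean_value_measure ::
    "(nat \<Rightarrow> real) \<Rightarrow> (real \<Rightarrow> complex) set \<Rightarrow> ((real \<Rightarrow> complex) \<Rightarrow> complex) measure \<Rightarrow> bool" where
  "mean_value_measure \<epsilon> A \<beta> \<longleftrightarrow>
     radon_prob_on (spectrum_topology A) \<beta> \<and>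
     (\<forall>f\<in>A. mean_value \<epsilon> f = (LINT s|\<beta>. gelfand f s))"

text \<open>
  Functions on the torus \<open>\<real>\<^sup>d/\<int>\<^sup>d\<close> are identified with \<open>\<int>\<^sup>d\<close>-periodic functions on \<open>\<real>\<^sup>d\<close>, and the torus as
  a measure space with the fundamental domain \<open>[0,1)\<^sup>d\<close>.
\<close>

definition torus_continuous :: "(real ^ 'd \<Rightarrow> complex) set" where
  "torus_continuous =
     {g. continuous_on UNIV g \<and> (\<forall>y k. (\<forall>i. k $ i \<in> \<int>) \<longrightarrow> g (y + k) = g y)}"

definition torus_measure :: "(real ^ 'd) measure" where
  "torus_measure = lebesgue_on {y. \<forall>i. 0 \<le> y $ i \<and> y $ i < 1}"

text \<open>
  The set of products \<open>f(\<tau>) g(y)\<close> is stable under complex scalars, hence its real span is its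
  complex span. The closure is with respect to the supremum norm; it consists of uniformly
  continuous functions because \<open>BUC\<close> is closed in the bounded continuous functions.
\<close>

definition product_algebra ::
    "(real \<Rightarrow> complex) set \<Rightarrow> ((real \<times> (real ^ 'd)) \<Rightarrow>\<^sub>C complex) set" where
  "product_algebra A =
     closure (span {h. \<exists>f\<in>A. \<exists>g\<in>torus_continuous.
                        \<forall>\<tau> y. apply_bcontfun h (\<tau>, y) = f \<tau> * g y})"

definition square_integrable :: "'a measure \<Rightarrow> ('a \<Rightarrow> complex) \<Rightarrow> bool" where
  "square_integrable M f \<longleftrightarrow> f \<in> borel_measurable M \<and> integrable M (\<lambda>x. (cmod (f x))\<^sup>2)"

text \<open>
  The Bochner space \<open>L\<^sup>2(M; B)\<close> for a closed subspace \<open>B\<close> of a Banach space that need not be separable,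
  so that strong measurability is not the same as Borel measurability.
\<close>

definition strongly_measurable ::
    "'a measure \<Rightarrow> 'b::real_normed_vector set \<Rightarrow> ('a \<Rightarrow> 'b) \<Rightarrow> bool" where
  "strongly_measurable M B f \<longleftrightarrow>
     (\<exists>s :: nat \<Rightarrow> 'a \<Rightarrow> 'b.
        (\<forall>i. simple_function M (s i) \<and> s i \<in> space M \<rightarrow> B) \<and>
        (AE x in M. (\<lambda>i. s i x) \<longlonglongrightarrow> f x))"

definition bochner_L2 ::
    "'a measure \<Rightarrow> 'b::real_normed_vector set \<Rightarrow> ('a \<Rightarrow> 'b) set" where
  "bochner_L2 M B =
     {f \<in> space M \<rightarrow> B. strongly_measurable M B f \<and> integrable M (\<lambda>x. (norm (f x))\<^sup>2)}"

definition time_space :: "real \<Rightarrow> (real \<times> (real ^ 'd)) measure" where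
  "time_space T = lebesgue_on ({0<..<T} \<times> UNIV)"

text \<open>
  The product is completed so that functions altered on null sets of \<open>(0,T) \<times> \<real>\<^sup>d\<close> remain measurable.
\<close>

definition limit_space ::
    "real \<Rightarrow> ((real \<Rightarrow> complex) \<Rightarrow> complex) measure \<Rightarrow>
     ((real \<times> (real ^ 'd)) \<times> (((real \<Rightarrow> complex) \<Rightarrow> complex) \<times> (real ^ 'd))) measure" where
  "limit_space T \<beta> = completion (time_space T \<Otimes>\<^sub>M (\<beta> \<Otimes>\<^sub>M torus_measure))"

definition flow_jacobian :: "(real \<Rightarrow> real ^ 'd \<Rightarrow> real ^ 'd) \<Rightarrow> real \<Rightarrow> real ^ 'd \<Rightarrow> real ^ 'd ^ 'd" where
  "flow_jacobian \<Phi> \<tau> x = jacobian (\<Phi> (- \<tau>)) (at x)"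

definition admissible_flow :: "(real \<Rightarrow> real ^ 'd \<Rightarrow> real ^ 'd) \<Rightarrow> bool" where
  "admissible_flow \<Phi> \<longleftrightarrow>
     (\<exists>D :: real \<times> (real ^ 'd) \<Rightarrow> (real \<times> (real ^ 'd)) \<Rightarrow>\<^sub>L (real ^ 'd).
        (\<forall>p. ((\<lambda>(\<tau>, x). \<Phi> \<tau> x) has_derivative blinfun_apply (D p)) (at p)) \<and>
        continuous_on UNIV D) \<and>
     (\<forall>t s x. \<Phi> t (\<Phi> s x) = \<Phi> (t + s) x) \<and>
     (\<forall>x. \<Phi> 0 x = x) \<and>
     (\<forall>K. compact K \<longrightarrow> (\<exists>C. \<forall>x\<in>K. \<forall>\<tau>. norm (flow_jacobian \<Phi> \<tau> x) \<le> C)) \<and>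
     (\<forall>\<tau> x. det (flow_jacobian \<Phi> \<tau> x) = 1)"

text \<open>
  In the right-hand side \<open>gelfand (\<lambda>\<tau>. \<psi> (t, X) (\<tau>, y)) s\<close> is the Gelfand transform of the test function in the
  variable \<open>\<tau>\<close> only.
\<close>

definition weakly_Sigma_converges ::
    "real \<Rightarrow> (real \<Rightarrow> complex) set \<Rightarrow> ((real \<Rightarrow> complex) \<Rightarrow> complex) measure \<Rightarrow>
     (real \<Rightarrow> real ^ 'd \<Rightarrow> real ^ 'd) \<Rightarrow> (nat \<Rightarrow> real) \<Rightarrow>
     (nat \<Rightarrow> real \<times> (real ^ 'd) \<Rightarrow> complex) \<Rightarrow>
     ((real \<times> (real ^ 'd)) \<times> (((real \<Rightarrow> complex) \<Rightarrow> complex) \<times> (real ^ 'd)) \<Rightarrow> complex) \<Rightarrow> bool" where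
  "weakly_Sigma_converges T A \<beta> \<Phi> \<epsilon> u u0 \<longleftrightarrow>
     (\<forall>\<psi> \<in> bochner_L2 (time_space T) (product_algebra A).
        (\<lambda>n. LINT (t, x)|time_space T.
               u n (t, x) *
               apply_bcontfun (\<psi> (t, \<Phi> (- (t / \<epsilon> n)) x)) (t / \<epsilon> n, (1 / \<epsilon> n) *\<^sub>R x))
        \<longlonglongrightarrow>
        (LINT ((t, X), (s, y))|limit_space T \<beta>.
               u0 ((t, X), (s, y)) * gelfand (\<lambda>\<tau>. apply_bcontfun (\<psi> (t, X)) (\<tau>, y)) s))"

end

theory Submission
  imports Defs "HOL-Library.Diagonal_Subsequence" "HOL-Probability.Probability_Measure"
begin

text \<open>
Write \<open>w\<^sub>n(\<psi>)(t,x) = \<psi>(t, \<Phi>\<^bsub>-t/\<epsilon>\<^esub>(x), t/\<epsilon>, x/\<epsilon>)\<close> for \<open>\<epsilon> = \<epsilon> n\<close>. The functionals \<open>\<psi> \<mapsto> \<integral> u\<^sub>n w\<^sub>n(\<psi>)\<close> are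
bounded by \<open>\<parallel>u\<^sub>n\<parallel> \<parallel>w\<^sub>n(\<psi>)\<parallel>\<close>, so everything rests on the identity
\<open>lim \<parallel>w\<^sub>n(\<psi>)\<parallel>\<^sup>2 = \<parallel>\<psi>^\<parallel>\<^sup>2\<close>, the right-hand norm being that of \<open>L\<^sup>2\<close> over the limit space and \<open>\<psi>^\<close> the Gelfand
transform. It shows that every limit functional is bounded in the Hilbert norm of \<open>\<psi>^\<close>.

The identity is proved for finite sums of products \<open>\<phi>(t,X) f(\<tau>) g(y)\<close> with \<open>\<phi>\<close> Lipschitz of compact support.
Such sums form a *-algebra, so squared norms reduce to mean values of single products
(\<open>oscillating_term_mean\<close>). After the volume-preserving substitution \<open>X = \<Phi>\<^bsub>-t/\<epsilon>\<^esub>(x)\<close>, the factor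
\<open>\<phi>(t, \<Phi>\<^bsub>-t/\<epsilon>\<^esub>(x))\<close> is Lipschitz in \<open>x\<close> uniformly in \<open>t\<close> and \<open>\<epsilon>\<close>: on the support of \<open>\<phi>\<close> the gradient of the flow is
the inverse of a bounded matrix of determinant one (\<open>flow_gradient_bound\<close>, \<open>lipschitz_composition_bound\<close>).
Averaging over translations of length \<open>O(\<epsilon>)\<close> therefore replaces \<open>g(x/\<epsilon>)\<close> by its mean with an error \<open>O(\<epsilon>)\<close>
(\<open>oscillating_integral_bound\<close>), and what remains is \<open>f(t/\<epsilon>)\<close> against an integrable function of \<open>t\<close>, which
converges by the definition of the mean value. On the limit side, characters are contractive and commute with
complex conjugation, so the Gelfand transform respects the *-algebra.

The algebra need not be separable, so a subsequence cannot be found by diagonalising over a dense sequence of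
test functions. Instead \<open>weakly_convergent_subsequence_of_functionals\<close> maximises the Riesz functional
\<open>\<psi> \<mapsto> 2 lim inf Re (\<integral> u\<^sub>n w\<^sub>n(\<psi>)) - \<parallel>\<psi>^\<parallel>\<^sup>2\<close> over test functions and subsequences together. Along a subsequence that
no refinement improves, near-maximisers are Cauchy by the parallelogram law, and the conjugate of their limit is
\<open>u\<^sub>0\<close>; any failure of convergence at some \<open>\<psi>\<close> would yield a refinement with a larger maximum.

Finally the sums of products are dense in the Bochner space (\<open>bochner_L2_test_approximable\<close>), and both
\<open>w\<^sub>n\<close> and the Gelfand transform are contractions from the Bochner space, so the convergence extends to all
admissible \<open>\<psi>\<close>.
\<close>

section \<open>Square-integrable functions\<close>

lemma norm_add_square_le: "(norm (a + b))\<^sup>2 \<le> 2 * (norm a)\<^sup>2 + 2 * (norm b)\<^sup>2"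
  for a b :: "'a :: real_normed_vector"
proof -
  have "(norm (a + b))\<^sup>2 \<le> (norm a + norm b)\<^sup>2"
    by (simp add: norm_triangle_ineq power_mono)
  also have "\<dots> \<le> 2 * (norm a)\<^sup>2 + 2 * (norm b)\<^sup>2"
    using sum_squares_bound[of "norm a" "norm b"] by (simp add: power2_sum)
  finally show ?thesis .
qed

lemma square_integrable_mult:
  assumes "square_integrable M f" "square_integrable M g"
  shows "integrable M (\<lambda>x. f x * g x)"
proof (rule Bochner_Integration.integrable_bound)
  show "integrable M (\<lambda>x. (cmod (f x))\<^sup>2 + (cmod (g x))\<^sup>2)"
    using assms by (auto simp: square_integrable_def)
  show "(\<lambda>x. f x * g x) \<in> borel_measurable M"
    using assms by (auto simp: square_integrable_def)
  have "cmod (f x) * cmod (g x) \<le> (cmod (f x))\<^sup>2 + (cmod (g x))\<^sup>2" for x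
    using sum_squares_bound[of "cmod (f x)" "cmod (g x)"] mult_nonneg_nonneg[OF norm_ge_zero[of "f x"] norm_ge_zero[of "g x"]]
    by (simp only: mult.assoc)
  then show "AE x in M. norm (f x * g x) \<le> norm ((cmod (f x))\<^sup>2 + (cmod (g x))\<^sup>2)"
    by (simp add: norm_mult)
qed

lemma square_integrable_add:
  assumes "square_integrable M f" "square_integrable M g"
  shows "square_integrable M (\<lambda>x. f x + g x)"
  unfolding square_integrable_def
proof
  show m: "(\<lambda>x. f x + g x) \<in> borel_measurable M"
    using assms by (auto simp: square_integrable_def)
  show "integrable M (\<lambda>x. (cmod (f x + g x))\<^sup>2)"
  proof (rule Bochner_Integration.integrable_bound)
    show "integrable M (\<lambda>x. 2 * (cmod (f x))\<^sup>2 + 2 * (cmod (g x))\<^sup>2)"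
      using assms by (auto simp: square_integrable_def)
    show "(\<lambda>x. (cmod (f x + g x))\<^sup>2) \<in> borel_measurable M" using m by measurable
    show "AE x in M. norm ((cmod (f x + g x))\<^sup>2) \<le> norm (2 * (cmod (f x))\<^sup>2 + 2 * (cmod (g x))\<^sup>2)"
      using norm_add_square_le[of "f _" "g _"] by simp
  qed
qed

lemma square_integrable_cmult:
  assumes "square_integrable M f"
  shows "square_integrable M (\<lambda>x. c * f x)"
  using assms by (auto simp: square_integrable_def norm_mult power_mult_distrib)

lemma square_integrable_diff:
  assumes "square_integrable M f" "square_integrable M g"
  shows "square_integrable M (\<lambda>x. f x - g x)"
  using square_integrable_add[OF assms(1) square_integrable_cmult[OF assms(2), of "-1"]] by simp

text \<open>
The factor 2 is the sharp constant. It is needed when a functional is compared with the square of a norm that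
enters with coefficient one.
\<close>

lemma two_norm_integral_mult_le:
  assumes "square_integrable M f" "square_integrable M g" "\<eta> > 0"
  shows "2 * cmod (LINT x|M. f x * g x)
          \<le> \<eta> * (LINT x|M. (cmod (f x))\<^sup>2) + (LINT x|M. (cmod (g x))\<^sup>2) / \<eta>"
proof -
  have i: "integrable M (\<lambda>x. (cmod (f x))\<^sup>2)" "integrable M (\<lambda>x. (cmod (g x))\<^sup>2)"
    using assms by (auto simp: square_integrable_def)
  have pw: "2 * cmod (f x * g x) \<le> \<eta> * (cmod (f x))\<^sup>2 + (cmod (g x))\<^sup>2 / \<eta>" for x
  proof -
    have "2 * (sqrt \<eta> * cmod (f x)) * (cmod (g x) / sqrt \<eta>) \<le> (sqrt \<eta> * cmod (f x))\<^sup>2 + (cmod (g x) / sqrt \<eta>)\<^sup>2"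
      by (rule sum_squares_bound)
    then have "2 * (cmod (f x) * cmod (g x)) \<le> \<eta> * (cmod (f x))\<^sup>2 + (cmod (g x))\<^sup>2 / \<eta>"
      using \<open>\<eta> > 0\<close> by (simp add: power_mult_distrib power_divide)
    then show ?thesis unfolding norm_mult .
  qed
  have "2 * cmod (LINT x|M. f x * g x) \<le> 2 * (LINT x|M. cmod (f x * g x))"
    using integral_norm_bound[of M "\<lambda>x. f x * g x"] by simp
  also have "\<dots> = (LINT x|M. 2 * cmod (f x * g x))" by simp
  also have "\<dots> \<le> (LINT x|M. \<eta> * (cmod (f x))\<^sup>2 + (cmod (g x))\<^sup>2 / \<eta>)"
    using i square_integrable_mult[OF assms(1,2)] pw by (intro integral_mono) auto
  also have "\<dots> = \<eta> * (LINT x|M. (cmod (f x))\<^sup>2) + (LINT x|M. (cmod (g x))\<^sup>2) / \<eta>"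
    using i by simp
  finally show ?thesis .
qed

lemma norm_integral_mult_le:
  assumes "square_integrable M f" "square_integrable M g" "\<eta> > 0"
  shows "cmod (LINT x|M. f x * g x)
          \<le> \<eta> * (LINT x|M. (cmod (f x))\<^sup>2) + (LINT x|M. (cmod (g x))\<^sup>2) / \<eta>"
  using two_norm_integral_mult_le[OF assms] norm_ge_zero[of "LINT x|M. f x * g x"] by linarith

text \<open>
With \<open>d\<^sub>k\<close> the \<open>k\<close>-th increment, \<open>\<integral> 2^k \<bar>d\<^sub>k\<bar>\<^sup>2\<close> is still summable, so \<open>\<Sum> 2^k \<bar>d\<^sub>k\<bar>\<^sup>2\<close> is finite almost everywhere.
There \<open>\<bar>d\<^sub>k\<bar> \<le> 2^-k + 2^k \<bar>d\<^sub>k\<bar>\<^sup>2\<close> makes the increments absolutely summable.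
\<close>

lemma AE_tendsto_fast_Cauchy:
  fixes v :: "nat \<Rightarrow> 'a \<Rightarrow> complex"
  assumes sq: "\<And>k. square_integrable M (v k)"
    and fast: "\<And>k. (LINT x|M. (cmod (v (Suc k) x - v k x))\<^sup>2) \<le> C * (1/4) ^ k"
  shows "AE x in M. convergent (\<lambda>k. v k x)"
proof -
  define d where "d k x = v (Suc k) x - v k x" for k x
  have dsq: "square_integrable M (d k)" for k
    unfolding d_def by (intro square_integrable_diff sq)
  have [measurable]: "d k \<in> borel_measurable M" for k
    using dsq by (simp add: square_integrable_def)
  have dint: "integrable M (\<lambda>x. 2 ^ k * (cmod (d k x))\<^sup>2)" for k
    using dsq by (simp add: square_integrable_def)
  have C: "C \<ge> 0"
  proof -
    have "0 \<le> (LINT x|M. (cmod (v (Suc 0) x - v 0 x))\<^sup>2)" by simp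
    also have "\<dots> \<le> C" using fast[of 0] by simp
    finally show ?thesis .
  qed
  have "(\<integral>\<^sup>+x. (\<Sum>k. ennreal (2 ^ k * (cmod (d k x))\<^sup>2)) \<partial>M) = (\<Sum>k. \<integral>\<^sup>+x. ennreal (2 ^ k * (cmod (d k x))\<^sup>2) \<partial>M)"
    by (intro nn_integral_suminf) auto
  also have "\<dots> \<le> (\<Sum>k. ennreal (C * (1/2) ^ k))"
  proof (intro suminf_le)
    show "(\<integral>\<^sup>+x. ennreal (2 ^ k * (cmod (d k x))\<^sup>2) \<partial>M) \<le> ennreal (C * (1/2) ^ k)" for k
    proof -
      have "(\<integral>\<^sup>+x. ennreal (2 ^ k * (cmod (d k x))\<^sup>2) \<partial>M) = ennreal (LINT x|M. 2 ^ k * (cmod (d k x))\<^sup>2)"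
        using dint by (intro nn_integral_eq_integral) auto
      also have "(LINT x|M. 2 ^ k * (cmod (d k x))\<^sup>2) \<le> 2 ^ k * (C * (1/4) ^ k)"
        using fast[of k] by (simp add: d_def)
      also have "2 ^ k * (C * (1/4) ^ k) = C * (1/2) ^ k"
        by (simp add: field_simps flip: power_mult_distrib)
      finally show ?thesis by (simp add: ennreal_leI)
    qed
  qed auto
  also have "\<dots> = ennreal (\<Sum>k. C * (1/2) ^ k)"
    using C by (intro suminf_ennreal2) (auto intro!: summable_mult summable_geometric)
  also have "\<dots> < \<infinity>" by simp
  finally have "AE x in M. (\<Sum>k. ennreal (2 ^ k * (cmod (d k x))\<^sup>2)) \<noteq> \<infinity>"
    by (intro nn_integral_noteq_infinite) auto
  then show ?thesis
  proof eventually_elim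
    case (elim x)
    then have s: "summable (\<lambda>k. 2 ^ k * (cmod (d k x))\<^sup>2)"
      by (intro summable_suminf_not_top) auto
    have "summable (\<lambda>k. (1/2) ^ k + 2 ^ k * (cmod (d k x))\<^sup>2)"
      by (intro summable_add s summable_geometric) auto
    moreover have "norm (cmod (d k x)) \<le> (1/2) ^ k + 2 ^ k * (cmod (d k x))\<^sup>2" for k
    proof -
      define a where "a = (2::real) ^ k"
      have "a > 0" by (simp add: a_def)
      have "a * cmod (d k x) \<le> 1 + (a * cmod (d k x))\<^sup>2"
        using sum_squares_bound[of 1 "a * cmod (d k x)"] mult_nonneg_nonneg[OF less_imp_le[OF \<open>a > 0\<close>] norm_ge_zero[of "d k x"]]
        by simp
      then have "cmod (d k x) \<le> 1/a + a * (cmod (d k x))\<^sup>2"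
        using \<open>a > 0\<close> by (simp add: field_simps power2_eq_square)
      then show ?thesis by (simp add: a_def power_one_over)
    qed
    ultimately have "summable (\<lambda>k. cmod (d k x))"
      by (rule summable_comparison_test'[where N = 0])
    then have "summable (\<lambda>k. d k x)"
      by (rule summable_norm_cancel)
    then have "convergent (\<lambda>n. \<Sum>k<n. d k x)"
      by (simp add: summable_iff_convergent)
    then have "convergent (\<lambda>n. (\<Sum>k<n. d k x) + v 0 x)"
      by (intro convergent_add convergent_const)
    moreover have "(\<Sum>k<n. d k x) + v 0 x = v n x" for n
    proof (induction n)
      case (Suc n)
      then have "(\<Sum>k<n. d k x) = v n x - v 0 x" by (simp add: algebra_simps)
      then show ?case by (simp add: d_def)
    qed simp
    ultimately show ?case by simp
  qed
qed

text \<open>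
Riesz-Fischer for sequences with a prescribed rate: Fatou's lemma carries the Cauchy bound over to the
pointwise limit.
\<close>

lemma L2_complete_fast:
  fixes v :: "nat \<Rightarrow> 'a \<Rightarrow> complex"
  assumes sq: "\<And>k. square_integrable M (v k)"
    and fast: "\<And>k j. k \<le> j \<Longrightarrow> (LINT x|M. (cmod (v j x - v k x))\<^sup>2) \<le> C * (1/4) ^ k"
  obtains w where "square_integrable M w" "\<And>k. (LINT x|M. (cmod (w x - v k x))\<^sup>2) \<le> C * (1/4) ^ k"
proof -
  define w where "w x = lim (\<lambda>k. v k x)" for x
  have [measurable]: "v k \<in> borel_measurable M" for k
    using sq by (simp add: square_integrable_def)
  have [measurable]: "w \<in> borel_measurable M"
    unfolding w_def by measurable
  have lim: "AE x in M. (\<lambda>k. v k x) \<longlonglongrightarrow> w x"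
    using AE_tendsto_fast_Cauchy[OF sq fast[of _ "Suc _"]]
    by (auto simp: w_def convergent_LIMSEQ_iff)
  have C: "C \<ge> 0"
    using fast[of 0 0] by simp
  have le: "(\<integral>\<^sup>+x. ennreal ((cmod (w x - v k x))\<^sup>2) \<partial>M) \<le> ennreal (C * (1/4) ^ k)" for k
  proof -
    have "(\<integral>\<^sup>+x. ennreal ((cmod (w x - v k x))\<^sup>2) \<partial>M) = (\<integral>\<^sup>+x. liminf (\<lambda>j. ennreal ((cmod (v j x - v k x))\<^sup>2)) \<partial>M)"
    proof (rule nn_integral_cong_AE)
      show "AE x in M. ennreal ((cmod (w x - v k x))\<^sup>2) = liminf (\<lambda>j. ennreal ((cmod (v j x - v k x))\<^sup>2))"
        using lim
      proof eventually_elim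
        case (elim x)
        have "(\<lambda>j. ennreal ((cmod (v j x - v k x))\<^sup>2)) \<longlonglongrightarrow> ennreal ((cmod (w x - v k x))\<^sup>2)"
          by (intro tendsto_intros elim)
        from lim_imp_Liminf[OF _ this] show ?case by simp
      qed
    qed
    also have "\<dots> \<le> liminf (\<lambda>j. \<integral>\<^sup>+x. ennreal ((cmod (v j x - v k x))\<^sup>2) \<partial>M)"
      by (intro nn_integral_liminf) auto
    also have "\<dots> \<le> ennreal (C * (1/4) ^ k)"
    proof (rule Liminf_le)
      show "\<forall>\<^sub>F j in sequentially. (\<integral>\<^sup>+x. ennreal ((cmod (v j x - v k x))\<^sup>2) \<partial>M) \<le> ennreal (C * (1/4) ^ k)"
        using eventually_ge_at_top[of k]
      proof eventually_elim
        case (elim j)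
        have "(\<integral>\<^sup>+x. ennreal ((cmod (v j x - v k x))\<^sup>2) \<partial>M) = ennreal (LINT x|M. (cmod (v j x - v k x))\<^sup>2)"
          using square_integrable_diff[OF sq sq, of j k]
          by (intro nn_integral_eq_integral) (auto simp: square_integrable_def)
        then show ?case using fast[OF elim] by (simp add: ennreal_leI)
      qed
    qed simp
    finally show ?thesis .
  qed
  have int: "integrable M (\<lambda>x. (cmod (w x - v k x))\<^sup>2)" for k
    by (rule integrableI_bounded) (use le[of k] in \<open>auto simp: top_unique less_top intro: le_less_trans\<close>)
  have "square_integrable M (\<lambda>x. w x - v 0 x)"
    using int[of 0] by (simp add: square_integrable_def)
  from square_integrable_add[OF this sq[of 0]] have "square_integrable M w" by simp
  moreover have "(LINT x|M. (cmod (w x - v k x))\<^sup>2) \<le> C * (1/4) ^ k" for k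
  proof -
    have "ennreal (LINT x|M. (cmod (w x - v k x))\<^sup>2) \<le> ennreal (C * (1/4) ^ k)"
      using le[of k] int[of k] by (subst nn_integral_eq_integral[symmetric]) auto
    then show ?thesis using C by simp
  qed
  ultimately show ?thesis by (rule that)
qed

section \<open>Subsequences along which functionals converge weakly\<close>

text \<open>
Refine step by step so that after step \<open>n\<close> no further refinement gains more than \<open>1/(n+1)\<close>. The diagonal sequence
is, up to its first terms, a refinement of every step, so it cannot be improved at all.
\<close>

lemma exists_maximal_subsequence:
  fixes J :: "(nat \<Rightarrow> nat) \<Rightarrow> real"
  assumes bd: "\<And>s. strict_mono s \<Longrightarrow> J s \<le> K"
    and mono: "\<And>s r. strict_mono s \<Longrightarrow> strict_mono r \<Longrightarrow> J s \<le> J (s \<circ> r)"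
    and tail: "\<And>s k. strict_mono s \<Longrightarrow> J (s \<circ> (+) k) \<le> J s"
  obtains s where "strict_mono s" "\<And>r. strict_mono r \<Longrightarrow> J (s \<circ> r) = J s"
proof -
  define P where "P n s \<longleftrightarrow> strict_mono s \<and> (\<forall>r. strict_mono r \<longrightarrow> J (s \<circ> r) \<le> J s + inverse (real (Suc n)))" for n s
  interpret subseqs P
  proof
    fix n and s :: "nat \<Rightarrow> nat" assume s: "strict_mono s"
    define B where "B = {J (s \<circ> r) | r. strict_mono r}"
    have bdd: "bdd_above B"
      unfolding B_def using bd s by (auto intro!: bdd_aboveI[of _ K] strict_mono_o)
    have ne: "B \<noteq> {}" using strict_mono_id by (auto simp: B_def)
    have "Sup B - inverse (real (Suc n)) < Sup B" by simp
    then obtain r where r: "strict_mono r" "Sup B - inverse (real (Suc n)) < J (s \<circ> r)"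
      unfolding less_cSup_iff[OF ne bdd] by (auto simp: B_def)
    have "J (s \<circ> r \<circ> r') \<le> J (s \<circ> r) + inverse (real (Suc n))" if "strict_mono r'" for r'
    proof -
      have "J (s \<circ> (r \<circ> r')) \<in> B"
        unfolding B_def using strict_mono_o[OF r(1) that] by blast
      from cSup_upper[OF this bdd] show ?thesis using r(2) by (simp add: o_assoc)
    qed
    then show "\<exists>r'. strict_mono r' \<and> P n (s \<circ> r')"
      using r(1) s by (auto simp: P_def intro!: exI[of _ r] strict_mono_o)
  qed
  have stable: "P n (s \<circ> r)" if r: "strict_mono r" and "P n s" for r s :: "nat \<Rightarrow> nat" and n
  proof -
    have s: "strict_mono s" "\<And>r. strict_mono r \<Longrightarrow> J (s \<circ> r) \<le> J s + inverse (real (Suc n))"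
      using that by (auto simp: P_def)
    have "J (s \<circ> r \<circ> r') \<le> J (s \<circ> r) + inverse (real (Suc n))" if "strict_mono r'" for r'
      using s(2)[OF strict_mono_o[OF r that]] mono[OF s(1) r] by (simp add: o_assoc)
    then show ?thesis using strict_mono_o[OF s(1) r] by (simp add: P_def)
  qed
  have d: "strict_mono diagseq" by (rule subseq_diagseq)
  have "J (diagseq \<circ> r) \<le> J diagseq + inverse (real (Suc n))" if r: "strict_mono r" for r n
  proof -
    have ge: "r (m + Suc n) \<ge> Suc n" for m
      using strict_mono_imp_increasing[OF r, of "m + Suc n"] by simp
    define r' where "r' m = r (m + Suc n) - Suc n" for m
    have r': "strict_mono r'"
      unfolding strict_mono_Suc_iff r'_def using ge strict_monoD[OF r] by (auto intro!: diff_less_mono)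
    have eq: "diagseq \<circ> r \<circ> (+) (Suc n) = diagseq \<circ> (+) (Suc n) \<circ> r'"
    proof
      fix m
      have "Suc n + r' m = r (Suc n + m)"
        using ge[of m] by (simp add: r'_def add.commute)
      then show "(diagseq \<circ> r \<circ> (+) (Suc n)) m = (diagseq \<circ> (+) (Suc n) \<circ> r') m" by simp
    qed
    have sh: "strict_mono ((+) (Suc n) :: nat \<Rightarrow> nat)" by (auto simp: strict_mono_def)
    have "J (diagseq \<circ> r) \<le> J (diagseq \<circ> r \<circ> (+) (Suc n))"
      by (intro mono strict_mono_o d r sh)
    also have "\<dots> = J (diagseq \<circ> (+) (Suc n) \<circ> r')" by (simp only: eq)
    also have "\<dots> \<le> J (diagseq \<circ> (+) (Suc n)) + inverse (real (Suc n))"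
      using diagseq_holds[OF stable, of n] r' by (auto simp: P_def)
    also have "\<dots> \<le> J diagseq + inverse (real (Suc n))"
      using tail[OF d] by simp
    finally show ?thesis .
  qed
  then have le: "J (diagseq \<circ> r) \<le> J diagseq" if "strict_mono r" for r
  proof (rule_tac LIMSEQ_le_const[of "\<lambda>n. J diagseq + inverse (real (Suc n))"])
    show "(\<lambda>n. J diagseq + inverse (real (Suc n))) \<longlonglongrightarrow> J diagseq"
      using tendsto_add[OF tendsto_const LIMSEQ_inverse_real_of_nat] by simp
  qed (use that in blast)
  show thesis
    by (rule that[OF d]) (use le mono[OF d] in force)
qed

text \<open>
A weak compactness theorem for functionals on a space \<open>V\<close> that need not be separable, mapped by \<open>e\<close> into \<open>L\<^sup>2(M)\<close>.
The bound says that the functionals are asymptotically bounded by the \<open>L\<^sup>2\<close> norm; it is written in the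
additive form \<open>2 Re L \<le> K + \<parallel>e\<parallel>\<^sup>2\<close> that the variational argument uses.

For a subsequence \<open>s\<close> let \<open>J s\<close> be the supremum over \<open>\<psi>\<close> of \<open>2 lim inf Re (L (s n) \<psi>) - \<parallel>e \<psi>\<parallel>\<^sup>2\<close>. Refinements only
increase \<open>J\<close>, so there is an \<open>s\<close> for which \<open>J\<close> is maximal. Its near-maximisers converge in \<open>L\<^sup>2\<close> to some \<open>w\<close>, and
\<open>w\<close> represents the limit of the functionals, as in the proof of the Riesz representation theorem.
\<close>

lemma weakly_convergent_subsequence_of_functionals:
  fixes L :: "nat \<Rightarrow> 'v \<Rightarrow> complex" and e :: "'v \<Rightarrow> 'a \<Rightarrow> complex"
  assumes ne: "V \<noteq> {}"
    and sq: "\<And>\<psi>. \<psi> \<in> V \<Longrightarrow> square_integrable M (e \<psi>)"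
    and comb: "\<And>\<psi> \<xi> c. \<psi> \<in> V \<Longrightarrow> \<xi> \<in> V \<Longrightarrow> \<exists>\<omega>\<in>V. (\<forall>n. L n \<omega> = L n \<psi> + c * L n \<xi>) \<and>
                  (\<forall>x\<in>space M. e \<omega> x = e \<psi> x + c * e \<xi> x)"
    and bound: "\<And>\<psi>. \<psi> \<in> V \<Longrightarrow> \<forall>\<^sub>F n in sequentially. 2 * Re (L n \<psi>) \<le> K + (LINT x|M. (cmod (e \<psi> x))\<^sup>2)"
  obtains r u0 where "strict_mono r" "square_integrable M u0"
    "\<And>\<psi>. \<psi> \<in> V \<Longrightarrow> (\<lambda>n. L (r n) \<psi>) \<longlonglongrightarrow> (LINT x|M. u0 x * e \<psi> x)"
proof -
  define E where "E \<psi> = (LINT x|M. (cmod (e \<psi> x))\<^sup>2)" for \<psi>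
  \<comment> \<open>Membership of \<open>c\<close> in \<open>G r\<close> says, up to the endpoint, that
    \<open>c\<close> is at most \<open>2 lim inf Re (L \<psi>) - \<parallel>e
    \<psi>\<parallel>\<^sup>2\<close> for some \<open>\<psi>\<close>.\<close>
  define G where "G r = {c. \<exists>\<psi>\<in>V. \<forall>\<^sub>F n in sequentially. c \<le> 2 * Re (L (r n) \<psi>) - E \<psi>}" for r
  define J where "J r = Sup (G r)" for r
  obtain \<psi>0 where \<psi>0: "\<psi>0 \<in> V" using ne by blast
  obtain \<zeta> where \<zeta>: "\<zeta> \<in> V" "\<And>n. L n \<zeta> = 0" "\<And>x. x \<in> space M \<Longrightarrow> e \<zeta> x = 0"
    using comb[OF \<psi>0 \<psi>0, of "-1"] by auto
  have E\<zeta>: "E \<zeta> = 0"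
    unfolding E_def by (subst Bochner_Integration.integral_cong[OF refl, of _ _ "\<lambda>_. 0"]) (auto simp: \<zeta>)
  have G0: "0 \<in> G r" for r
    unfolding G_def using \<zeta> E\<zeta> by (auto intro!: bexI[of _ \<zeta>])
  have Gle: "c \<le> K" if r: "strict_mono r" and c: "c \<in> G r" for r c
  proof -
    obtain \<psi> where \<psi>: "\<psi> \<in> V" "\<forall>\<^sub>F n in sequentially. c \<le> 2 * Re (L (r n) \<psi>) - E \<psi>"
      using c by (auto simp: G_def)
    have "\<forall>\<^sub>F n in sequentially. 2 * Re (L (r n) \<psi>) \<le> K + E \<psi>"
      using eventually_subseq[OF r bound[OF \<psi>(1)]] by (simp add: E_def)
    with \<psi>(2) have "\<forall>\<^sub>F n in sequentially. c \<le> K" by eventually_elim auto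
    then show ?thesis by simp
  qed
  have bdd: "bdd_above (G r)" if "strict_mono r" for r
    using Gle[OF that] by (auto intro!: bdd_aboveI[of _ K])
  have GJ: "c \<le> J r" if "strict_mono r" "c \<in> G r" for r c
    unfolding J_def using bdd that by (auto intro!: cSup_upper)
  obtain s where s: "strict_mono s" and smax: "\<And>r. strict_mono r \<Longrightarrow> J (s \<circ> r) = J s"
  proof (rule exists_maximal_subsequence[of J K])
    show "J s \<le> K" if "strict_mono s" for s
      unfolding J_def using Gle[OF that] G0 by (auto intro!: cSup_least)
    show "J s \<le> J (s \<circ> r)" if "strict_mono s" "strict_mono r" for s r
      unfolding J_def
    proof (rule cSup_subset_mono)
      show "G s \<subseteq> G (s \<circ> r)"
        unfolding G_def using eventually_subseq[OF that(2)] by fastforce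
    qed (use G0 bdd[OF strict_mono_o[OF that]] in auto)
    show "J (s \<circ> (+) k) \<le> J s" if "strict_mono s" for s k
      unfolding J_def
    proof (rule cSup_subset_mono)
      show "G (s \<circ> (+) k) \<subseteq> G s"
        unfolding G_def
        using eventually_sequentially_seg[of "\<lambda>n. _ \<le> 2 * Re (L (s n) _) - E _" k]
        by (auto simp: add.commute)
    qed (use G0 bdd[OF that] in auto)
  qed blast
  have near: "\<exists>\<psi>\<in>V. \<forall>\<^sub>F n in sequentially. J s - d \<le> 2 * Re (L (s n) \<psi>) - E \<psi>" if "d > 0" for d
  proof -
    have "G s \<noteq> {}" using G0 by auto
    from less_cSupE[of "J s - d", OF _ this] that obtain c where "c \<in> G s" "J s - d < c"
      unfolding J_def by auto
    then show ?thesis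
      unfolding G_def by (force elim!: eventually_mono)
  qed
  have "\<forall>k. \<exists>\<psi>. \<psi> \<in> V \<and> (\<forall>\<^sub>F n in sequentially. J s - (1/4)^k \<le> 2 * Re (L (s n) \<psi>) - E \<psi>)"
    using near[of "(1/4)^_"] by (auto simp: Bex_def)
  then obtain p where pV: "\<And>k. p k \<in> V"
    and p: "\<And>k. \<forall>\<^sub>F n in sequentially. J s - (1/4)^k \<le> 2 * Re (L (s n) (p k)) - E (p k)"
    by metis
  have int: "integrable M (\<lambda>x. (cmod (e \<psi> x))\<^sup>2)" if "\<psi> \<in> V" for \<psi>
    using sq[OF that] by (simp add: square_integrable_def)
  \<comment> \<open>The midpoint of two near-maximisers cannot exceed the supremum, which by the parallelogram
    law forces them to be close.\<close>
  have cauchy: "(LINT x|M. (cmod (e (p j) x - e (p k) x))\<^sup>2) \<le> 4 * (1/4) ^ k" if "k \<le> j" for j k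
  proof -
    obtain a where a: "a \<in> V" "\<And>n. L n a = L n (p j) + L n (p k)"
        "\<And>x. x \<in> space M \<Longrightarrow> e a x = e (p j) x + e (p k) x"
      using comb[OF pV[of j] pV[of k], of 1] by auto
    obtain m where m: "m \<in> V" "\<And>n. L n m = (L n (p j) + L n (p k)) / 2"
        "\<And>x. x \<in> space M \<Longrightarrow> e m x = (e (p j) x + e (p k) x) / 2"
      using comb[OF \<zeta>(1) a(1), of "1/2"] a \<zeta> by auto
    let ?D = "LINT x|M. (cmod (e (p j) x - e (p k) x))\<^sup>2"
    have par: "(cmod ((y + z) / 2))\<^sup>2 = (cmod y)\<^sup>2 / 2 + (cmod z)\<^sup>2 / 2 - (cmod (y - z))\<^sup>2 / 4" for y z
      unfolding cmod_power2 by (simp add: power2_eq_square field_simps)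
    have "E m = (LINT x|M. (cmod (e (p j) x))\<^sup>2 / 2 + (cmod (e (p k) x))\<^sup>2 / 2 - (cmod (e (p j) x - e (p k) x))\<^sup>2 / 4)"
      unfolding E_def by (intro Bochner_Integration.integral_cong refl) (simp only: m(3) par)
    also have "\<dots> = E (p j) / 2 + E (p k) / 2 - ?D / 4"
      unfolding E_def using int[OF pV] square_integrable_diff[OF sq[OF pV] sq[OF pV], of j k]
      by (simp add: square_integrable_def)
    finally have Em: "E m = E (p j) / 2 + E (p k) / 2 - ?D / 4" .
    have "J s - ((1/4)^j + (1/4)^k) / 2 + ?D / 4 \<in> G s"
      unfolding G_def
    proof (safe intro!: bexI[OF _ m(1)])
      show "\<forall>\<^sub>F n in sequentially. J s - ((1/4)^j + (1/4)^k) / 2 + ?D / 4 \<le> 2 * Re (L (s n) m) - E m"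
        using p[of j] p[of k]
      proof eventually_elim
        case (elim n)
        have "Re (L (s n) m) = (Re (L (s n) (p j)) + Re (L (s n) (p k))) / 2"
          by (simp add: m(2))
        with elim Em show ?case by argo
      qed
    qed
    from GJ[OF s this] have "?D \<le> 2 * ((1/4)^j + (1/4)^k)" by simp
    also have "\<dots> \<le> 2 * ((1/4)^k + (1/4)^k)"
      using that by (intro mult_left_mono add_right_mono power_decreasing) auto
    finally show ?thesis by simp
  qed
  obtain w where w: "square_integrable M w" "\<And>k. (LINT x|M. (cmod (w x - e (p k) x))\<^sup>2) \<le> 4 * (1/4) ^ k"
    using L2_complete_fast[of M "\<lambda>k. e (p k)" 4] sq[OF pV] cauchy by blast
  have sqc: "square_integrable M (\<lambda>x. cnj (f x))" if "square_integrable M f" for f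
    using that measurable_compose[OF _ borel_measurable_continuous_onI[of cnj], of f M]
    by (auto simp: square_integrable_def intro!: continuous_intros)
  define B where "B f \<psi> = Re (LINT x|M. cnj (f x) * e \<psi> x)" for f \<psi>
  have Blim: "(\<lambda>k. B (e (p k)) \<psi>) \<longlonglongrightarrow> B w \<psi>" if \<psi>: "\<psi> \<in> V" for \<psi>
  proof -
    have le: "\<bar>B (e (p k)) \<psi> - B w \<psi>\<bar> \<le> 2 ^ k * (4 * (1/4) ^ k) + E \<psi> / 2 ^ k" for k
    proof -
      have "B (e (p k)) \<psi> - B w \<psi> = - Re (LINT x|M. cnj (w x - e (p k) x) * e \<psi> x)"
        unfolding B_def by (simp add: left_diff_distrib square_integrable_mult sqc sq pV w \<psi>)
      then have "\<bar>B (e (p k)) \<psi> - B w \<psi>\<bar> \<le> cmod (LINT x|M. cnj (w x - e (p k) x) * e \<psi> x)"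
        using abs_Re_le_cmod by simp
      also have "\<dots> \<le> 2 ^ k * (LINT x|M. (cmod (cnj (w x - e (p k) x)))\<^sup>2) + E \<psi> / 2 ^ k"
        unfolding E_def
        by (intro norm_integral_mult_le sqc square_integrable_diff sq pV w \<psi>) auto
      also have "\<dots> \<le> 2 ^ k * (4 * (1/4) ^ k) + E \<psi> / 2 ^ k"
        using w(2)[of k] by (simp only: complex_mod_cnj) simp
      finally show ?thesis .
    qed
    have "(\<lambda>k. 2 ^ k * (4 * (1/4) ^ k) + E \<psi> / 2 ^ k) = (\<lambda>k. 4 * (1/2) ^ k + E \<psi> * (1/2) ^ k)"
      by (intro ext) (simp add: power_divide field_simps flip: power_mult_distrib)
    moreover have "(\<lambda>k. 4 * (1/2) ^ k + E \<psi> * (1/2::real) ^ k) \<longlonglongrightarrow> 4 * 0 + E \<psi> * 0"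
      by (intro tendsto_intros) auto
    ultimately have "(\<lambda>k. 2 ^ k * (4 * (1/4) ^ k) + E \<psi> / 2 ^ k) \<longlonglongrightarrow> 0" by simp
    then have "(\<lambda>k. B (e (p k)) \<psi> - B w \<psi>) \<longlonglongrightarrow> 0"
      by (rule Lim_null_comparison[rotated]) (use le in auto)
    then show ?thesis by (simp add: LIM_zero_iff)
  qed
  have upper: "\<forall>\<^sub>F n in sequentially. Re (L (s n) \<psi>) \<le> B w \<psi> + d" if \<psi>: "\<psi> \<in> V" and d: "d > 0" for \<psi> d
  proof (rule ccontr)
    assume "\<not> ?thesis"
    then have "\<exists>\<^sub>F n in sequentially. \<not> Re (L (s n) \<psi>) \<le> B w \<psi> + d"
      by (simp add: frequently_def)
    then have "infinite {n. \<not> Re (L (s n) \<psi>) \<le> B w \<psi> + d}"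
      by (simp add: frequently_cofinite cofinite_eq_sequentially flip: cofinite_eq_sequentially)
    from infinite_enumerate[OF this] obtain r :: "nat \<Rightarrow> nat"
      where r: "strict_mono r" and rn: "\<And>n. \<not> Re (L (s (r n)) \<psi>) \<le> B w \<psi> + d"
      by blast
    \<comment> \<open>So small that the first-order gain \<open>2 t d\<close> outweighs the second-order loss
      \<open>t\<^sup>2 \<parallel>e \<psi>\<parallel>\<^sup>2 \<le> t d\<close>.\<close>
    define t where "t = d / (E \<psi> + 1)"
    have E0: "E \<psi> \<ge> 0" by (simp add: E_def)
    have t: "t > 0" "t * E \<psi> \<le> d"
      using d E0 by (auto simp: t_def field_simps)
    \<comment> \<open>Along the refinement \<open>s \<circ> r\<close>, perturbing the \<open>k\<close>-th
      near-maximiser by \<open>t \<psi>\<close> gives this value of the functional;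
      \<open>J\<close> has not increased on the refinement.\<close>
    have "J s \<ge> J s - (1/4)^k + 2 * t * (B w \<psi> + d - B (e (p k)) \<psi>) - t * d" for k
    proof -
      obtain a where a: "a \<in> V" "\<And>n. L n a = L n (p k) + t * L n \<psi>"
        "\<And>x. x \<in> space M \<Longrightarrow> e a x = e (p k) x + t * e \<psi> x"
        using comb[OF pV[of k] \<psi>, of "complex_of_real t"] by auto
      have ex: "(cmod (y + complex_of_real t * z))\<^sup>2 = (cmod y)\<^sup>2 + 2 * t * Re (cnj y * z) + t\<^sup>2 * (cmod z)\<^sup>2" for y z
        unfolding cmod_power2 by (simp add: power2_eq_square algebra_simps)
      define R where "R x = Re (cnj (e (p k) x) * e \<psi> x)" for x
      have R: "integrable M R" "(LINT x|M. R x) = B (e (p k)) \<psi>"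
        using square_integrable_mult[OF sqc[OF sq[OF pV[of k]]] sq[OF \<psi>]]
        unfolding R_def B_def by (rule integrable_Re, rule integral_Re)
      have "E a = (LINT x|M. (cmod (e (p k) x))\<^sup>2 + 2 * t * R x + t\<^sup>2 * (cmod (e \<psi> x))\<^sup>2)"
        unfolding E_def R_def by (intro Bochner_Integration.integral_cong refl) (simp only: a(3) ex)
      also have "\<dots> = E (p k) + 2 * t * B (e (p k)) \<psi> + t\<^sup>2 * E \<psi>"
        unfolding E_def using int[OF pV] int[OF \<psi>] R by simp
      finally have Ea: "E a \<le> E (p k) + 2 * t * B (e (p k)) \<psi> + t * d"
        using mult_left_mono[OF t(2) less_imp_le[OF t(1)]] by (simp add: power2_eq_square mult.assoc)
      have "J s - (1/4)^k + 2 * t * (B w \<psi> + d - B (e (p k)) \<psi>) - t * d \<in> G (s \<circ> r)"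
        unfolding G_def
      proof (safe intro!: bexI[OF _ a(1)])
        show "\<forall>\<^sub>F n in sequentially. J s - (1/4)^k + 2 * t * (B w \<psi> + d - B (e (p k)) \<psi>) - t * d
                \<le> 2 * Re (L ((s \<circ> r) n) a) - E a"
          using eventually_subseq[OF r p[of k]]
        proof eventually_elim
          case (elim n)
          have "t * (B w \<psi> + d) \<le> t * Re (L (s (r n)) \<psi>)"
            using rn[of n] t by (intro mult_left_mono) auto
          then have "2 * t * (B w \<psi> + d - B (e (p k)) \<psi>) \<le> 2 * (t * Re (L (s (r n)) \<psi>)) - 2 * t * B (e (p k)) \<psi>"
            by (simp add: algebra_simps)
          with elim Ea show ?case by (simp add: a(2))
        qed
      qed
      from GJ[OF strict_mono_o[OF s r] this] show ?thesis using smax[OF r] by simp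
    qed
    moreover have "(\<lambda>k. J s - (1/4)^k + 2 * t * (B w \<psi> + d - B (e (p k)) \<psi>) - t * d)
        \<longlonglongrightarrow> J s - 0 + 2 * t * (B w \<psi> + d - B w \<psi>) - t * d"
      by (intro tendsto_intros Blim[OF \<psi>]) auto
    ultimately have "J s - 0 + 2 * t * (B w \<psi> + d - B w \<psi>) - t * d \<le> J s"
      by (intro LIMSEQ_le_const2) auto
    then show False using mult_pos_pos[OF d t(1)] by (simp add: algebra_simps)
  qed
  have Relim: "(\<lambda>n. Re (L (s n) \<psi>)) \<longlonglongrightarrow> B w \<psi>" if \<psi>: "\<psi> \<in> V" for \<psi>
  proof -
    obtain a where a: "a \<in> V" "\<And>n. L n a = - L n \<psi>" "\<And>x. x \<in> space M \<Longrightarrow> e a x = - e \<psi> x"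
      using comb[OF \<zeta>(1) \<psi>, of "-1"] \<zeta> by auto
    have "(LINT x|M. cnj (w x) * e a x) = (LINT x|M. - (cnj (w x) * e \<psi> x))"
      by (intro Bochner_Integration.integral_cong refl) (simp add: a)
    then have Ba: "B w a = - B w \<psi>" unfolding B_def by simp
    show ?thesis
    proof (rule tendstoI)
      fix d :: real assume "d > 0"
      then have "d/2 > 0" by simp
      from upper[OF \<psi> this] upper[OF a(1) this]
      show "\<forall>\<^sub>F n in sequentially. dist (Re (L (s n) \<psi>)) (B w \<psi>) < d"
        by eventually_elim (use \<open>d > 0\<close> in \<open>auto simp: a(2) Ba dist_real_def abs_if\<close>)
    qed
  qed
  have "(\<lambda>n. L (s n) \<psi>) \<longlonglongrightarrow> (LINT x|M. cnj (w x) * e \<psi> x)" if \<psi>: "\<psi> \<in> V" for \<psi>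
  proof -
    obtain a where a: "a \<in> V" "\<And>n. L n a = \<i> * L n \<psi>" "\<And>x. x \<in> space M \<Longrightarrow> e a x = \<i> * e \<psi> x"
      using comb[OF \<zeta>(1) \<psi>, of "\<i>"] \<zeta> by auto
    have "(LINT x|M. cnj (w x) * e a x) = (LINT x|M. \<i> * (cnj (w x) * e \<psi> x))"
      by (intro Bochner_Integration.integral_cong refl) (simp add: a)
    then have Ba: "B w a = - Im (LINT x|M. cnj (w x) * e \<psi> x)"
      unfolding B_def by (simp del: times_complex.sel)
    have "(\<lambda>n. - Re (L (s n) a)) \<longlonglongrightarrow> Im (LINT x|M. cnj (w x) * e \<psi> x)"
      using tendsto_minus[OF Relim[OF a(1)]] by (simp add: Ba)
    then have Imlim: "(\<lambda>n. Im (L (s n) \<psi>)) \<longlonglongrightarrow> Im (LINT x|M. cnj (w x) * e \<psi> x)"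
      by (simp add: a(2))
    show ?thesis
      using Relim[OF \<psi>] Imlim unfolding B_def tendsto_complex_iff by blast
  qed
  with s sqc[OF w(1)] show thesis by (rule that)
qed

section \<open>Maps of determinant one preserve volume\<close>

text \<open>
The change-of-variables theorem is formulated over a well-ordered index type. This copy of a finite type is
ordered by an enumeration; passing to it permutes coordinates, which affects neither volumes nor determinants.
\<close>

typedef 'a wellordered_index = "UNIV :: 'a set" by auto

instance wellordered_index :: (finite) finite
proof
  have "(UNIV :: 'a wellordered_index set) = range Abs_wellordered_index"
    by (auto intro: range_eqI[of _ _ "Rep_wellordered_index _"] simp: Rep_wellordered_index_inverse)
  then show "finite (UNIV :: 'a wellordered_index set)" by (metis finite finite_imageI)
qed

instantiation wellordered_index :: (finite) linorder
begin
definition "x \<le> y \<longleftrightarrow> to_nat (Rep_wellordered_index x) \<le> to_nat (Rep_wellordered_index y)"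
definition "x < y \<longleftrightarrow> to_nat (Rep_wellordered_index x) < to_nat (Rep_wellordered_index y)"
instance
  by intro_classes
    (auto simp: less_eq_wellordered_index_def less_wellordered_index_def Rep_wellordered_index_inject)
end

instance wellordered_index :: (finite) wellorder
proof -
  have "wf {(x :: 'a wellordered_index, y). x < y}"
    by (auto simp: trancl_def tranclp_less intro!: finite_acyclic_wf acyclicI)
  then show "OFCLASS('a wellordered_index, wellorder_class)"
    by (rule wf_wellorderI) intro_classes
qed

lemma bij_Rep_wellordered_index: "bij Rep_wellordered_index"
  by (metis Abs_wellordered_index_inverse Rep_wellordered_index_inverse UNIV_I bijI')

text \<open>
Conjugation with \<open>\<pi>\<close> matches the permutations of the two index types and preserves signs.
\<close>

lemma det_reindex:
  fixes A :: "real^'n^'n" and \<pi> :: "'m::finite \<Rightarrow> 'n"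
  assumes \<pi>: "bij \<pi>"
  shows "det (\<chi> i j. A $ \<pi> i $ \<pi> j) = det A"
proof -
  have perm: "map_permutation UNIV \<rho> p = \<rho> \<circ> p \<circ> inv \<rho>" if "bij \<rho>" for \<rho> :: "'x \<Rightarrow> 'y" and p
    using that by (auto simp: map_permutation_def restrict_id_def bij_is_surj fun_eq_iff)
  have inv: "bij (inv \<pi>)" "inv (inv \<pi>) = \<pi>"
    using \<pi> by (auto simp: bij_imp_bij_inv inv_inv_eq)
  have fg: "\<pi> (inv \<pi> i) = i" "inv \<pi> (\<pi> k) = k" for i k
    using \<pi> by (auto simp: bij_is_surj surj_f_inv_f bij_is_inj)
  show ?thesis
    unfolding det_def
  proof (rule sum.reindex_bij_witness[of _ "map_permutation UNIV (inv \<pi>)" "map_permutation UNIV \<pi>"], goal_cases)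
    case (1 p) then show ?case by (auto simp: perm \<pi> inv fg fun_eq_iff)
  next
    case (2 p) then show ?case using map_permutation_permutes[of \<pi> UNIV UNIV p] \<pi> by (simp add: bij_betw_def)
  next
    case (3 p) then show ?case by (auto simp: perm \<pi> inv fg fun_eq_iff)
  next
    case (4 p) then show ?case using map_permutation_permutes[of "inv \<pi>" UNIV UNIV p] inv by (simp add: bij_betw_def)
  next
    case (5 p)
    have "(\<Prod>i\<in>UNIV. A $ i $ map_permutation UNIV \<pi> p i) = (\<Prod>k\<in>UNIV. A $ \<pi> k $ map_permutation UNIV \<pi> p (\<pi> k))"
      using prod.reindex_bij_betw[of \<pi> UNIV UNIV "\<lambda>i. A $ i $ map_permutation UNIV \<pi> p i"] \<pi> by simp
    moreover have "sign (map_permutation UNIV \<pi> p) = sign p"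
      using 5 \<pi> by (intro sign_map_permutation) (auto simp: bij_is_inj)
    ultimately show ?case by (simp add: perm \<pi> fg)
  qed
qed

text \<open>
The preimage of a box under \<open>P\<close> is its image under \<open>Q\<close>, whose volume is the integral of \<open>\<bar>det A\<bar> = 1\<close>.
\<close>

lemma distr_lborel_det_1_wellorder:
  fixes P Q :: "real^'n::{finite,wellorder} \<Rightarrow> real^'n::_"
  assumes PQ: "\<And>x. P (Q x) = x" "\<And>x. Q (P x) = x"
    and cont: "continuous_on UNIV P"
    and deriv: "\<And>x. (Q has_derivative (\<lambda>h. A x *v h)) (at x)"
    and det: "\<And>x. det (A x) = 1"
  shows "distr lborel lborel P = lborel"
proof -
  have [measurable]: "P \<in> borel_measurable borel"
    using cont by (rule borel_measurable_continuous_onI)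
  have "lborel = distr lborel lborel P"
  proof (rule lborel_eqI)
    fix l u :: "real^'n::_"
    assume lu: "\<And>b. b \<in> Basis \<Longrightarrow> l \<bullet> b \<le> u \<bullet> b"
    have pre: "P -` box l u = Q ` box l u"
      by (auto simp: PQ intro!: image_eqI[where f = Q, OF PQ(2)[symmetric]])
    have mat: "matrix (\<lambda>h. A x *v h) = A x" for x
      by simp
    have "((\<lambda>x. \<bar>det (matrix (\<lambda>h. A x *v h))\<bar>) has_integral measure lebesgue (box l u)) (box l u)"
      unfolding mat det using has_integral_measure_lborel[of "box l u"] emeasure_lborel_box_finite[of l u]
      by (simp add: less_top)
    moreover have "inj_on Q (box l u)" by (metis PQ(1) inj_onI)
    ultimately have Q: "Q ` box l u \<in> lmeasurable" "measure lebesgue (Q ` box l u) = measure lebesgue (box l u)"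
      using has_measure_differentiable_image[of "box l u" Q "\<lambda>x h. A x *v h" "measure lebesgue (box l u)"]
        has_derivative_at_withinI[OF deriv] by auto
    have "emeasure (distr lborel lborel P) (box l u) = emeasure lborel (Q ` box l u)"
      by (simp add: emeasure_distr pre)
    also have "\<dots> = emeasure lebesgue (Q ` box l u)"
      using measurable_sets[of P borel borel "box l u"] by (simp add: pre)
    also have "\<dots> = ennreal (measure lebesgue (box l u))"
      using Q by (metis emeasure_eq_measure2)
    also have "\<dots> = emeasure lborel (box l u)"
      using emeasure_lborel_box_finite[of l u] by (simp add: emeasure_eq_ennreal_measure less_top)
    finally show "emeasure (distr lborel lborel P) (box l u) = (\<Prod>b\<in>Basis. (u - l) \<bullet> b)"
      using lu by (simp add: emeasure_lborel_box_eq)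
  qed simp
  then show ?thesis by simp
qed

lemma prod_Basis_vec: "(\<Prod>b\<in>Basis. (x :: real^'n) \<bullet> b) = (\<Prod>i\<in>UNIV. x $ i)"
  by (simp add: Basis_vec_def cart_eq_inner_axis axis_eq_axis prod.UNION_disjoint)

lemma distr_lborel_reindex:
  fixes \<pi> :: "'m::finite \<Rightarrow> 'n::finite"
  assumes \<pi>: "bij \<pi>"
  shows "distr lborel lborel (\<lambda>x::real^'n. \<chi> i. x $ \<pi> i) = lborel"
proof -
  let ?R = "\<lambda>x::real^'n. \<chi> i. x $ \<pi> i"
  have fg: "\<pi> (inv \<pi> i) = i" "inv \<pi> (\<pi> k) = k" for i k
    using \<pi> by (auto simp: bij_is_surj surj_f_inv_f bij_is_inj)
  have "continuous_on UNIV ?R" by (intro continuous_intros)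
  then have [measurable]: "?R \<in> borel_measurable borel" by (rule borel_measurable_continuous_onI)
  have "lborel = distr lborel lborel ?R"
  proof (rule lborel_eqI)
    fix l u :: "real^'m"
    assume lu: "\<And>b. b \<in> Basis \<Longrightarrow> l \<bullet> b \<le> u \<bullet> b"
    then have lu': "l $ i \<le> u $ i" for i
      using lu[of "axis i 1"] by (simp add: axis_in_Basis_iff inner_axis)
    let ?S = "\<lambda>x::real^'m. \<chi> i. x $ inv \<pi> i"
    have pre: "?R -` box l u = box (?S l) (?S u)"
      by (auto simp: mem_box_cart fg) (metis fg(1) fg(2))+
    have "emeasure lborel (box (?S l) (?S u)) = (\<Prod>b\<in>Basis. (?S u - ?S l) \<bullet> b)"
      using lu' by (auto simp: emeasure_lborel_box_eq Basis_vec_def inner_axis)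
    also have "(\<Prod>b\<in>Basis. (?S u - ?S l) \<bullet> b) = (\<Prod>i\<in>UNIV. u $ inv \<pi> i - l $ inv \<pi> i)"
      by (simp add: prod_Basis_vec)
    also have "\<dots> = (\<Prod>k\<in>UNIV. u $ k - l $ k)"
      using prod.reindex_bij_betw[of "inv \<pi>" UNIV UNIV "\<lambda>k. u $ k - l $ k"] \<pi> by (simp add: bij_imp_bij_inv)
    also have "\<dots> = (\<Prod>b\<in>Basis. (u - l) \<bullet> b)"
      by (simp add: prod_Basis_vec)
    finally show "emeasure (distr lborel lborel ?R) (box l u) = (\<Prod>b\<in>Basis. (u - l) \<bullet> b)"
      by (simp add: emeasure_distr pre)
  qed simp
  then show ?thesis by simp
qed

lemma distr_lborel_det_1:
  fixes P Q :: "real^'n \<Rightarrow> real^'n"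
  assumes PQ: "\<And>x. P (Q x) = x" "\<And>x. Q (P x) = x"
    and cont: "continuous_on UNIV P"
    and deriv: "\<And>x. (Q has_derivative (\<lambda>h. A x *v h)) (at x)"
    and det: "\<And>x. det (A x) = 1"
  shows "distr lborel lborel P = lborel"
proof -
  define \<pi> where "\<pi> = (Rep_wellordered_index :: 'n wellordered_index \<Rightarrow> 'n)"
  have \<pi>: "bij \<pi>" unfolding \<pi>_def by (rule bij_Rep_wellordered_index)
  have fg: "\<pi> (inv \<pi> i) = i" "inv \<pi> (\<pi> k) = k" for i k
    using \<pi> by (auto simp: bij_is_surj surj_f_inv_f bij_is_inj)
  define R where "R = (\<lambda>x::real^'n. \<chi> i. x $ \<pi> i)"
  define S where "S = (\<lambda>x::real^'n wellordered_index. \<chi> i. x $ inv \<pi> i)"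
  have RS: "R (S y) = y" "S (R x) = x" for x y
    by (auto simp: R_def S_def vec_eq_iff fg)
  have lin: "linear R" "linear S"
    by (auto intro!: linearI simp: R_def S_def vec_eq_iff)
  have cR: "continuous_on UNIV R" "continuous_on UNIV S"
    using lin by (simp_all add: linear_continuous_on linear_conv_bounded_linear)
  have [measurable]: "R \<in> borel_measurable borel" "S \<in> borel_measurable borel" "P \<in> borel_measurable borel"
    using cR cont by (auto intro: borel_measurable_continuous_onI)
  have dR: "distr lborel lborel R = lborel"
    unfolding R_def by (rule distr_lborel_reindex[OF \<pi>])
  have dS: "distr lborel lborel S = lborel"
    unfolding S_def by (rule distr_lborel_reindex[OF bij_imp_bij_inv[OF \<pi>]])
  have "distr lborel lborel (R \<circ> P \<circ> S) = lborel"
  proof (rule distr_lborel_det_1_wellorder[where Q = "R \<circ> Q \<circ> S" and A = "\<lambda>y. \<chi> i j. A (S y) $ \<pi> i $ \<pi> j"])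
    show "continuous_on UNIV (R \<circ> P \<circ> S)"
      by (intro continuous_on_compose) (auto intro: continuous_on_subset cR cont)
    fix y
    show "(R \<circ> P \<circ> S) ((R \<circ> Q \<circ> S) y) = y" "(R \<circ> Q \<circ> S) ((R \<circ> P \<circ> S) y) = y"
      by (simp_all add: RS PQ)
    show "det (\<chi> i j. A (S y) $ \<pi> i $ \<pi> j) = 1"
      using det_reindex[OF \<pi>, of "A (S y)"] det by simp
    have "(R \<circ> Q \<circ> S has_derivative R \<circ> (\<lambda>h. A (S y) *v h) \<circ> S) (at y)"
      by (intro diff_chain_at deriv linear_imp_has_derivative lin)
    moreover have "(\<Sum>k\<in>UNIV. A (S y) $ i $ \<pi> k * h $ k) = (\<Sum>j\<in>UNIV. A (S y) $ i $ j * S h $ j)" for i h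
      using sum.reindex_bij_betw[of \<pi> UNIV UNIV "\<lambda>j. A (S y) $ i $ j * S h $ j"] \<pi>
      by (simp add: fg S_def)
    then have "(R \<circ> (\<lambda>h. A (S y) *v h) \<circ> S) = (\<lambda>h. (\<chi> i j. A (S y) $ \<pi> i $ \<pi> j) *v h)"
      by (simp add: R_def vec_eq_iff matrix_vector_mult_def fun_eq_iff)
    ultimately show "(R \<circ> Q \<circ> S has_derivative (\<lambda>h. (\<chi> i j. A (S y) $ \<pi> i $ \<pi> j) *v h)) (at y)"
      by (simp only:)
  qed
  then have "distr (distr (distr lborel lborel R) lborel (R \<circ> P \<circ> S)) lborel S = lborel"
    by (simp add: dR dS)
  also have "distr (distr (distr lborel lborel R) lborel (R \<circ> P \<circ> S)) lborel S = distr lborel lborel (S \<circ> (R \<circ> P \<circ> S) \<circ> R)"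
    by (simp add: distr_distr comp_assoc)
  also have "S \<circ> (R \<circ> P \<circ> S) \<circ> R = P"
    by (auto simp: fun_eq_iff RS)
  finally show ?thesis .
qed

section \<open>Bounds for the flow\<close>

text \<open>
On the compact set of pairs \<open>(A, v)\<close> with \<open>\<bar>A\<bar> \<le> C\<close>, \<open>det A = 1\<close>, \<open>\<bar>v\<bar> = 1\<close> the continuous function \<open>\<bar>A v\<bar>\<close> has no zero,
hence a positive minimum. So the inverses of these matrices are uniformly bounded.
\<close>

lemma det_1_lower_bound:
  obtains M where "M > 0" "\<And>(A :: real^'n^'n) v. det A = 1 \<Longrightarrow> norm A \<le> C \<Longrightarrow> norm v \<le> M * norm (A *v v)"
proof -
  define K where "K = {(A :: real^'n^'n, v :: real^'n). norm A \<le> C \<and> det A = 1 \<and> norm v = 1}"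
  have contdet: "continuous_on UNIV (\<lambda>A :: real^'n^'n. det A)"
    unfolding det_def by (intro continuous_intros)
  have contmv: "continuous_on UNIV (\<lambda>p :: (real^'n^'n) \<times> (real^'n). norm (fst p *v snd p))"
    unfolding matrix_vector_mult_def by (intro continuous_intros)
  have "closed ({p. norm (fst p) \<le> C} \<inter> {p :: (real^'n^'n) \<times> (real^'n). det (fst p) = 1} \<inter> {p. norm (snd p) = 1})"
    by (intro closed_Int closed_Collect_le closed_Collect_eq continuous_intros
        continuous_on_compose2[OF contdet]) auto
  moreover have "K = {p. norm (fst p) \<le> C} \<inter> {p. det (fst p) = 1} \<inter> {p. norm (snd p) = 1}"
    by (auto simp: K_def)
  moreover have "bounded K"
  proof (rule bounded_subset[OF bounded_Times[OF bounded_cball bounded_cball]])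
    show "K \<subseteq> cball 0 C \<times> cball 0 1" by (auto simp: K_def)
  qed
  ultimately have K: "compact K" by (simp add: compact_eq_bounded_closed)
  show thesis
  proof (cases "K = {}")
    case True
    show thesis
    proof (rule that[of 1])
      fix A :: "real^'n^'n" and v :: "real^'n" assume A: "det A = 1" "norm A \<le> C"
      have "(A, axis (undefined::'n) 1) \<in> K" using A by (simp add: K_def)
      with True show "norm v \<le> 1 * norm (A *v v)" by simp
    qed simp
  next
    case False
    have "continuous_on K (\<lambda>p. norm (fst p *v snd p))"
      by (rule continuous_on_subset[OF contmv]) auto
    from continuous_attains_inf[OF K False this] obtain B w
      where B: "(B, w) \<in> K" and min: "\<And>A v. (A, v) \<in> K \<Longrightarrow> norm (B *v w) \<le> norm (A *v v)"
      by fastforce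
    have "invertible B" using B by (simp add: K_def invertible_det_nz)
    then have "B *v w \<noteq> 0" using B matrix_left_invertible_ker[of B] invertible_left_inverse[of B]
      by (auto simp: K_def)
    then have m: "norm (B *v w) > 0" by simp
    show thesis
    proof (rule that[of "1 / norm (B *v w)"])
      fix A :: "real^'n^'n" and v :: "real^'n" assume A: "det A = 1" "norm A \<le> C"
      show "norm v \<le> 1 / norm (B *v w) * norm (A *v v)"
      proof (cases "v = 0")
        case False
        then have "(A, v /\<^sub>R norm v) \<in> K" using A by (simp add: K_def)
        from min[OF this] have "norm (B *v w) \<le> norm (A *v v) / norm v"
          by (simp add: matrix_vector_mult_scaleR divide_inverse_commute)
        with False m show ?thesis by (simp add: field_simps)
      qed simp
    qed (use m in simp)
  qed
qed

lemma admissible_flow_derivative: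
  fixes \<Phi> :: "real \<Rightarrow> real ^ 'd \<Rightarrow> real ^ 'd"
  assumes "admissible_flow \<Phi>"
  obtains D where "\<And>p. ((\<lambda>(\<tau>, x). \<Phi> \<tau> x) has_derivative blinfun_apply (D p)) (at p)"
proof -
  from assms have "\<exists>D :: real \<times> (real ^ 'd) \<Rightarrow> (real \<times> (real ^ 'd)) \<Rightarrow>\<^sub>L (real ^ 'd).
        (\<forall>p. ((\<lambda>(\<tau>, x). \<Phi> \<tau> x) has_derivative blinfun_apply (D p)) (at p)) \<and> continuous_on UNIV D"
    unfolding admissible_flow_def by (rule conjunct1)
  then show thesis
  proof (elim exE conjE)
    fix D assume D: "\<forall>p. ((\<lambda>(\<tau>, x). \<Phi> \<tau> x) has_derivative blinfun_apply (D p)) (at p)"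
    show thesis by (rule that) (rule D[rule_format])
  qed
qed

lemma flow_has_derivative:
  fixes \<Phi> :: "real \<Rightarrow> real ^ 'd \<Rightarrow> real ^ 'd"
  assumes "admissible_flow \<Phi>"
  shows "(\<Phi> t has_derivative (\<lambda>h. flow_jacobian \<Phi> (- t) x *v h)) (at x)"
proof -
  obtain D where D: "\<And>p. ((\<lambda>(\<tau>, x). \<Phi> \<tau> x) has_derivative blinfun_apply (D p)) (at p)"
    using admissible_flow_derivative[OF assms] by blast
  have "((\<lambda>x. (t, x)) has_derivative (\<lambda>h. (0, h))) (at x)"
    by (auto intro!: derivative_eq_intros)
  from diff_chain_at[OF this D] have "\<Phi> t differentiable (at x)"
    by (auto simp: o_def differentiable_def)
  then show ?thesis
    unfolding flow_jacobian_def by (simp add: jacobian_works)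
qed

lemma continuous_on_flow:
  fixes \<Phi> :: "real \<Rightarrow> real ^ 'd \<Rightarrow> real ^ 'd"
  assumes "admissible_flow \<Phi>"
  shows "continuous_on UNIV (\<lambda>(t, x). \<Phi> t x)"
proof -
  obtain D where D: "\<And>p. ((\<lambda>(\<tau>, x). \<Phi> \<tau> x) has_derivative blinfun_apply (D p)) (at p)"
    using admissible_flow_derivative[OF assms] by blast
  show ?thesis
    using has_derivative_continuous[OF D] by (auto simp: continuous_on_eq_continuous_at)
qed

lemma flow_inverse:
  fixes \<Phi> :: "real \<Rightarrow> real ^ 'd \<Rightarrow> real ^ 'd"
  assumes "admissible_flow \<Phi>"
  shows "\<Phi> t (\<Phi> (- t) x) = x" "\<Phi> (- t) (\<Phi> t x) = x"
  using assms unfolding admissible_flow_def by (metis add.right_inverse, metis add.left_inverse)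

lemma distr_lborel_flow:
  fixes \<Phi> :: "real \<Rightarrow> real ^ 'd \<Rightarrow> real ^ 'd"
  assumes "admissible_flow \<Phi>"
  shows "distr lborel lborel (\<Phi> t) = lborel"
proof (rule distr_lborel_det_1[where Q = "\<Phi> (- t)"])
  show "continuous_on UNIV (\<Phi> t)"
    using flow_has_derivative[OF assms, of t] has_derivative_continuous
    by (fastforce simp: continuous_on_eq_continuous_at)
  show "(\<Phi> (- t) has_derivative (\<lambda>h. flow_jacobian \<Phi> t x *v h)) (at x)" for x
    using flow_has_derivative[OF assms, of "- t"] by simp
  show "det (flow_jacobian \<Phi> t x) = 1" for x
    using assms by (simp add: admissible_flow_def)
qed (simp_all add: flow_inverse[OF assms])

text \<open>
The flow assumptions bound Jacobians whose base point lies in \<open>K\<close>, whereas here the image \<open>\<Phi> t x\<close> lies in \<open>K\<close>. The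
derivative at such an \<open>x\<close> is the inverse of the Jacobian of the reverse map at \<open>\<Phi> t x\<close>, which is based in \<open>K\<close>.
\<close>

lemma flow_gradient_bound:
  fixes \<Phi> :: "real \<Rightarrow> real ^ 'd \<Rightarrow> real ^ 'd"
  assumes "admissible_flow \<Phi>" "compact K"
  obtains M where "M > 0" "\<And>t x h. \<Phi> t x \<in> K \<Longrightarrow> norm (flow_jacobian \<Phi> (- t) x *v h) \<le> M * norm h"
proof -
  obtain C where C: "\<And>x \<tau>. x \<in> K \<Longrightarrow> norm (flow_jacobian \<Phi> \<tau> x) \<le> C"
    using assms unfolding admissible_flow_def by meson
  obtain M where M: "M > 0" "\<And>(A :: real^'d^'d) v. det A = 1 \<Longrightarrow> norm A \<le> C \<Longrightarrow> norm v \<le> M * norm (A *v v)"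
    using det_1_lower_bound[of C] by blast
  show thesis
  proof (rule that[OF M(1)])
    fix t x h assume K: "\<Phi> t x \<in> K"
    let ?A = "flow_jacobian \<Phi> t (\<Phi> t x)" and ?B = "flow_jacobian \<Phi> (- t) x"
    have "(\<Phi> (- t) \<circ> \<Phi> t has_derivative (\<lambda>h. ?A *v h) \<circ> (\<lambda>h. ?B *v h)) (at x)"
      using flow_has_derivative[OF assms(1), of "- t"] flow_has_derivative[OF assms(1), of t]
      by (intro diff_chain_at) simp_all
    moreover have "\<Phi> (- t) \<circ> \<Phi> t = id"
      by (auto simp: flow_inverse[OF assms(1)])
    ultimately have "(\<lambda>h. ?A *v h) \<circ> (\<lambda>h. ?B *v h) = id"
      using has_derivative_unique[OF _ has_derivative_id[unfolded id_def[symmetric]]] by metis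
    then have "?A *v (?B *v h) = h" by (metis comp_apply id_apply)
    moreover have "norm (?B *v h) \<le> M * norm (?A *v (?B *v h))"
      using assms(1) C[OF K] by (intro M(2)) (auto simp: admissible_flow_def)
    ultimately show "norm (?B *v h) \<le> M * norm h" by simp
  qed
qed

text \<open>
Mean value inequality along the part of the segment from \<open>x\<close> to \<open>y\<close> on which \<open>P\<close> stays in \<open>K\<close>.
\<close>

lemma bounded_on_segment_interval:
  fixes P :: "'a::real_normed_vector \<Rightarrow> 'b::real_normed_vector" and f :: "'b \<Rightarrow> real"
  assumes P: "\<And>z. (P has_derivative P' z) (at z)"
    and grad: "\<And>z h. P z \<in> K \<Longrightarrow> norm (P' z h) \<le> M * norm h"
    and f: "L-lipschitz_on UNIV f"
    and b: "0 \<le> b" "b \<le> 1" and K: "\<And>\<theta>. 0 \<le> \<theta> \<Longrightarrow> \<theta> \<le> b \<Longrightarrow> P (x + \<theta> *\<^sub>R (y - x)) \<in> K" and M: "M \<ge> 0"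
  shows "\<bar>f (P x) - f (P (x + b *\<^sub>R (y - x)))\<bar> \<le> L * (M * norm (x - y))"
proof -
  have "norm (P (x + 0 *\<^sub>R (y - x)) - P (x + b *\<^sub>R (y - x))) \<le> (M * norm (x - y)) * norm (0 - b)"
  proof (rule differentiable_bound[where S = "{0..b}" and f' = "\<lambda>\<theta> h. P' (x + \<theta> *\<^sub>R (y - x)) (h *\<^sub>R (y - x))"])
    fix \<theta> assume \<theta>: "\<theta> \<in> {0..b}"
    have "((\<lambda>\<theta>. x + \<theta> *\<^sub>R (y - x)) has_derivative (\<lambda>h. h *\<^sub>R (y - x))) (at \<theta> within {0..b})"
      by (auto intro!: derivative_eq_intros)
    from diff_chain_within[OF this has_derivative_at_withinI[OF P]]
    show "((\<lambda>\<theta>. P (x + \<theta> *\<^sub>R (y - x))) has_derivative (\<lambda>h. P' (x + \<theta> *\<^sub>R (y - x)) (h *\<^sub>R (y - x)))) (at \<theta> within {0..b})"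
      by (simp add: o_def)
    show "onorm (\<lambda>h. P' (x + \<theta> *\<^sub>R (y - x)) (h *\<^sub>R (y - x))) \<le> M * norm (x - y)"
    proof (rule onorm_le)
      fix h :: real
      show "norm (P' (x + \<theta> *\<^sub>R (y - x)) (h *\<^sub>R (y - x))) \<le> M * norm (x - y) * norm h"
        using grad[OF K, of \<theta> "h *\<^sub>R (y - x)"] \<theta> by (simp add: norm_minus_commute mult_ac)
    qed
  qed (use b in auto)
  also have "\<dots> \<le> M * norm (x - y)"
    using b M mult_left_le[of b "M * norm (x - y)"] by simp
  finally have "norm (P x - P (x + b *\<^sub>R (y - x))) \<le> M * norm (x - y)" by simp
  moreover have "\<bar>f (P x) - f (P (x + b *\<^sub>R (y - x)))\<bar> \<le> L * norm (P x - P (x + b *\<^sub>R (y - x)))"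
    using lipschitz_onD[OF f, of "P x"] by (simp add: dist_norm)
  ultimately show ?thesis
    using lipschitz_on_nonneg[OF f] by (meson mult_left_mono order_trans)
qed

text \<open>
The gradient of \<open>P\<close> is controlled only while \<open>P\<close> stays in \<open>K\<close>. At the first exit from \<open>K\<close> along the segment \<open>f \<circ> P\<close>
vanishes by continuity, and up to that point the mean value inequality applies.
\<close>

lemma bounded_by_distance_to_exit:
  fixes P :: "'a::real_normed_vector \<Rightarrow> 'b::real_normed_vector" and f :: "'b \<Rightarrow> real"
  assumes P: "\<And>z. (P has_derivative P' z) (at z)"
    and grad: "\<And>z h. P z \<in> K \<Longrightarrow> norm (P' z h) \<le> M * norm h"
    and f: "L-lipschitz_on UNIV f" and K: "closed K" and M: "M \<ge> 0"
    and supp: "\<And>p. p \<notin> K \<Longrightarrow> f p = 0"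
    and \<theta>: "0 \<le> \<theta>" "\<theta> \<le> 1" "P (x + \<theta> *\<^sub>R (y - x)) \<notin> K"
  shows "\<bar>f (P x)\<bar> \<le> L * (M * norm (x - y))"
proof (cases "P x \<in> K")
  case False
  then show ?thesis using supp lipschitz_on_nonneg[OF f] M by simp
next
  case True
  define g where "g \<theta> = P (x + \<theta> *\<^sub>R (y - x))" for \<theta>
  have contP: "continuous_on UNIV P"
    using has_derivative_continuous[OF P] by (simp add: continuous_on_eq_continuous_at)
  have contg: "continuous_on UNIV g"
    unfolding g_def by (intro continuous_on_compose2[OF contP] continuous_intros) auto
  have contf: "continuous_on UNIV (\<lambda>\<theta>. f (g \<theta>))"
    by (intro continuous_on_compose2[OF lipschitz_on_continuous_on[OF f] contg]) auto
  define Z where "Z = {\<theta>. 0 \<le> \<theta> \<and> g \<theta> \<notin> K}"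
  have Z: "\<theta> \<in> Z" "Z \<noteq> {}" "bdd_below Z"
    using \<theta> by (auto simp: Z_def g_def intro!: bdd_belowI[of _ 0])
  define b where "b = Inf Z"
  have b: "0 \<le> b" "b \<le> 1"
    unfolding b_def using Z \<theta> by (auto intro!: cInf_greatest simp: Z_def) (metis Z(1,3) cInf_lower order_trans Z_def)
  have "b \<in> closure Z" unfolding b_def by (rule closure_contains_Inf[OF Z(2,3)])
  then have fb: "f (g b) = 0"
    by (rule continuous_constant_on_closure[where S = Z, rotated -1])
      (use contf supp in \<open>auto intro: continuous_on_subset simp: Z_def\<close>)
  have below: "g \<theta> \<in> K" if "0 \<le> \<theta>" "\<theta> < b" for \<theta>
    using that cInf_lower[OF _ Z(3), of \<theta>] by (force simp: b_def Z_def)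
  have "g b \<in> K"
  proof (cases "b = 0")
    case True then show ?thesis using \<open>P x \<in> K\<close> by (simp add: g_def)
  next
    case False
    have "closed (g -` K)" using closed_vimage[OF K contg] .
    moreover have "b \<in> closure {0..<b}" using b False by simp
    moreover have "{0..<b} \<subseteq> g -` K" using below by auto
    ultimately show ?thesis by (metis closure_minimal subsetD vimage_eq)
  qed
  then have "P (x + \<theta> *\<^sub>R (y - x)) \<in> K" if "0 \<le> \<theta>" "\<theta> \<le> b" for \<theta>
    using below[OF that(1)] that(2) unfolding g_def by (cases "\<theta> = b") auto
  from bounded_on_segment_interval[OF P grad f b this M] show ?thesis
    using fb by (simp add: g_def)
qed

text \<open>
Although \<open>P\<close> may have an arbitrarily large gradient outside \<open>P -` K\<close>, the composition with a function supported in \<open>K\<close>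
is globally Lipschitz. The factor 2 covers segments that leave \<open>K\<close>: there both end values are bounded by the
distance to an exit point.
\<close>

lemma lipschitz_composition_bound:
  fixes P :: "'a::real_normed_vector \<Rightarrow> 'b::real_normed_vector" and f :: "'b \<Rightarrow> real"
  assumes P: "\<And>z. (P has_derivative P' z) (at z)"
    and grad: "\<And>z h. P z \<in> K \<Longrightarrow> norm (P' z h) \<le> M * norm h"
    and f: "L-lipschitz_on UNIV f" and K: "closed K" and M: "M \<ge> 0"
    and supp: "\<And>p. p \<notin> K \<Longrightarrow> f p = 0"
  shows "\<bar>f (P x) - f (P y)\<bar> \<le> 2 * L * M * norm (x - y)"
proof -
  have LM: "0 \<le> L * (M * norm (x - y))" using lipschitz_on_nonneg[OF f] M by simp
  show ?thesis
  proof (cases "\<exists>\<theta>. 0 \<le> \<theta> \<and> \<theta> \<le> 1 \<and> P (x + \<theta> *\<^sub>R (y - x)) \<notin> K")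
    case True
    then obtain \<theta> where \<theta>: "0 \<le> \<theta>" "\<theta> \<le> 1" "P (x + \<theta> *\<^sub>R (y - x)) \<notin> K" by blast
    have "x + \<theta> *\<^sub>R (y - x) = y + (1 - \<theta>) *\<^sub>R (x - y)" by (simp add: algebra_simps)
    then have \<theta>': "0 \<le> 1 - \<theta>" "1 - \<theta> \<le> 1" "P (y + (1 - \<theta>) *\<^sub>R (x - y)) \<notin> K" using \<theta> by auto
    have "\<bar>f (P x)\<bar> \<le> L * (M * norm (x - y))"
      by (rule bounded_by_distance_to_exit[OF P grad f K M supp \<theta>])
    moreover have "\<bar>f (P y)\<bar> \<le> L * (M * norm (y - x))"
      by (rule bounded_by_distance_to_exit[OF P grad f K M supp \<theta>'])
    ultimately show ?thesis by (simp add: norm_minus_commute)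
  next
    case False
    then have "\<bar>f (P x) - f (P (x + 1 *\<^sub>R (y - x)))\<bar> \<le> L * (M * norm (x - y))"
      by (intro bounded_on_segment_interval[OF P grad f _ _ _ M]) auto
    then show ?thesis using LM by simp
  qed
qed

section \<open>Integrals with a periodic oscillating factor\<close>

definition unit_cell :: "(real ^ 'd) set" where
  "unit_cell = {y. \<forall>i. 0 \<le> y $ i \<and> y $ i < 1}"

definition integer_vectors :: "(real ^ 'd) set" where
  "integer_vectors = {k. \<forall>i. k $ i \<in> \<int>}"

text \<open>
The Borel counterpart of the torus measure, for use in products with \<open>lborel\<close>.
\<close>

definition cell_measure :: "(real ^ 'd) measure" where
  "cell_measure = restrict_space lborel unit_cell"

lemma unit_cell_borel [measurable]: "unit_cell \<in> sets borel"
proof -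
  have eq: "unit_cell = (\<Inter>i. {y::real^'a. 0 \<le> y $ i} \<inter> {y. y $ i < 1})"
    by (auto simp: unit_cell_def)
  have "{y::real^'a. 0 \<le> y $ i} \<inter> {y. y $ i < 1} \<in> sets borel" for i
    by (intro sets.Int borel_closed borel_open closed_Collect_le open_Collect_less continuous_intros)
  then show ?thesis
    unfolding eq by (intro sets.finite_INT) auto
qed

lemma emeasure_unit_cell: "emeasure lborel (unit_cell :: (real ^ 'd) set) = 1"
proof (rule antisym)
  have c: "emeasure lborel (cbox 0 (1 :: real^'d)) = 1" "emeasure lborel (box 0 (1 :: real^'d)) = 1"
    by (auto simp: emeasure_lborel_cbox_eq emeasure_lborel_box_eq Basis_vec_def inner_axis prod.UNION_disjoint
        intro!: prod.neutral)
  have "emeasure lborel (unit_cell :: (real ^ 'd) set) \<le> emeasure lborel (cbox 0 (1 :: real^'d))"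
    by (intro emeasure_mono) (auto simp: unit_cell_def mem_box_cart less_imp_le)
  then show "emeasure lborel (unit_cell :: (real ^ 'd) set) \<le> 1" using c by simp
  have "emeasure lborel (box 0 (1 :: real^'d)) \<le> emeasure lborel (unit_cell :: (real ^ 'd) set)"
    by (intro emeasure_mono) (auto simp: unit_cell_def mem_box_cart less_imp_le)
  then show "1 \<le> emeasure lborel (unit_cell :: (real ^ 'd) set)" using c by simp
qed

lemma space_cell_measure [simp]: "space cell_measure = unit_cell"
  by (simp add: cell_measure_def space_restrict_space)

lemma prob_space_cell_measure: "prob_space (cell_measure :: (real ^ 'd) measure)"
  by standard (simp add: cell_measure_def emeasure_restrict_space emeasure_unit_cell space_restrict_space)

lemma countable_integer_vectors: "countable (integer_vectors :: (real ^ 'd) set)"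
proof (rule countable_subset)
  show "integer_vectors \<subseteq> range (\<lambda>m :: int ^ 'd. \<chi> i. real_of_int (m $ i))"
  proof
    fix k :: "real ^ 'd" assume "k \<in> integer_vectors"
    then have "k = (\<chi> i. real_of_int ((\<chi> i. \<lfloor>k $ i\<rfloor>) $ i))"
      by (auto simp: integer_vectors_def vec_eq_iff Ints_def)
    then show "k \<in> range (\<lambda>m :: int ^ 'd. \<chi> i. real_of_int (m $ i))" by (rule range_eqI)
  qed
qed simp

text \<open>
The only lattice vector that moves \<open>w\<close> into the cell is its vector of integer parts.
\<close>

lemma integer_translates_partition:
  "(\<integral>\<^sup>+k. indicator unit_cell (w - k) \<partial>count_space (integer_vectors :: (real ^ 'd) set)) = 1"
proof -
  define k0 :: "real ^ 'd" where "k0 = (\<chi> i. real_of_int \<lfloor>w $ i\<rfloor>)"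
  have k0: "k0 \<in> integer_vectors" by (auto simp: k0_def integer_vectors_def)
  have iff: "w - k \<in> unit_cell \<longleftrightarrow> k = k0" if kI: "k \<in> integer_vectors" for k
  proof
    assume c: "w - k \<in> unit_cell"
    show "k = k0"
    proof (subst vec_eq_iff, intro allI)
      fix i
      obtain m where m: "k $ i = real_of_int m" using kI by (auto simp: integer_vectors_def elim: Ints_cases)
      have "real_of_int m \<le> w $ i" "w $ i < real_of_int m + 1"
        using c m by (auto simp: unit_cell_def dest!: spec[of _ i])
      then have "\<lfloor>w $ i\<rfloor> = m" by (rule floor_unique)
      then show "k $ i = k0 $ i" by (simp add: m k0_def)
    qed
  next
    assume "k = k0" then show "w - k \<in> unit_cell"
      by (auto simp: k0_def unit_cell_def) linarith
  qed
  have "(\<integral>\<^sup>+k. indicator unit_cell (w - k) \<partial>count_space (integer_vectors :: (real ^ 'd) set))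
      = (\<integral>\<^sup>+k. indicator {k0} k \<partial>count_space (integer_vectors :: (real ^ 'd) set))"
    by (intro nn_integral_cong) (auto simp: iff indicator_def)
  also have "\<dots> = 1" using k0 by (simp add: emeasure_count_space)
  finally show ?thesis .
qed

lemma integer_translates_partition':
  "(\<integral>\<^sup>+k. indicator unit_cell (w + k) \<partial>count_space (integer_vectors :: (real ^ 'd) set)) = 1"
proof -
  have "bij_betw uminus (integer_vectors :: (real ^ 'd) set) integer_vectors"
    by (rule bij_betwI[of _ _ _ uminus]) (auto simp: integer_vectors_def)
  from nn_integral_bij_count_space[OF this, of "\<lambda>k. indicator unit_cell (w - k)"]
  show ?thesis using integer_translates_partition[of w] by simp
qed

lemma nn_integral_lborel_translate:
  fixes c :: "'a :: euclidean_space"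
  assumes "f \<in> borel_measurable borel"
  shows "(\<integral>\<^sup>+x. f (x + c) \<partial>lborel) = (\<integral>\<^sup>+x. f x \<partial>lborel)"
  using assms nn_integral_distr[of "(+) c" lborel borel f] by (simp add: lborel_distr_plus add.commute)

lemma integral_lborel_translate:
  fixes c :: "'a :: euclidean_space" and f :: "'a \<Rightarrow> 'b :: {banach, second_countable_topology}"
  assumes "f \<in> borel_measurable borel"
  shows "(LINT x|lborel. f (x + c)) = (LINT x|lborel. f x)"
  using assms integral_distr[of "(+) c" lborel borel f] by (simp add: lborel_distr_plus add.commute)

text \<open>
Unfolding: insert the partition of unity by integer translates of the cell, exchange sum and integral, shift
each summand by its lattice vector using periodicity, and sum up again.
\<close>

lemma nn_integral_periodic_translate:
  fixes f :: "real ^ 'd \<Rightarrow> ennreal"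
  assumes [measurable]: "f \<in> borel_measurable borel"
    and per: "\<And>y k. k \<in> integer_vectors \<Longrightarrow> f (y + k) = f y"
  shows "(\<integral>\<^sup>+y. f (y + z) * indicator unit_cell y \<partial>lborel) = (\<integral>\<^sup>+y. f y * indicator unit_cell y \<partial>lborel)"
proof -
  let ?I = "count_space (integer_vectors :: (real ^ 'd) set)"
  let ?c = "indicator unit_cell :: real ^ 'd \<Rightarrow> ennreal"
  have [measurable]: "?c \<in> borel_measurable borel" by measurable
  have "(\<integral>\<^sup>+y. f (y + z) * ?c y \<partial>lborel) = (\<integral>\<^sup>+y. f y * ?c (y - z) \<partial>lborel)"
    using nn_integral_lborel_translate[of "\<lambda>y. f y * ?c (y - z)" z] by simp
  also have "\<dots> = (\<integral>\<^sup>+y. (\<integral>\<^sup>+k. f y * ?c (y - z) * ?c (y - k) \<partial>?I) \<partial>lborel)"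
    by (subst nn_integral_cmult) (auto simp: integer_translates_partition)
  also have "\<dots> = (\<integral>\<^sup>+k. (\<integral>\<^sup>+y. f y * ?c (y - z) * ?c (y - k) \<partial>lborel) \<partial>?I)"
    by (intro nn_integral_count_space_nn_integral countable_integer_vectors) measurable
  also have "\<dots> = (\<integral>\<^sup>+k. (\<integral>\<^sup>+y. f y * ?c y * ?c (y - z + k) \<partial>lborel) \<partial>?I)"
  proof (rule nn_integral_cong)
    fix k assume "k \<in> space ?I"
    then have k: "k \<in> integer_vectors" by simp
    have "(\<integral>\<^sup>+y. f y * ?c (y - z) * ?c (y - k) \<partial>lborel) = (\<integral>\<^sup>+y. f (y + k) * ?c (y + k - z) * ?c (y + k - k) \<partial>lborel)"
      by (rule nn_integral_lborel_translate[symmetric]) measurable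
    also have "\<dots> = (\<integral>\<^sup>+y. f y * ?c y * ?c (y - z + k) \<partial>lborel)"
      by (intro nn_integral_cong) (simp add: per[OF k] mult_ac algebra_simps)
    finally show "(\<integral>\<^sup>+y. f y * ?c (y - z) * ?c (y - k) \<partial>lborel) = (\<integral>\<^sup>+y. f y * ?c y * ?c (y - z + k) \<partial>lborel)" .
  qed
  also have "\<dots> = (\<integral>\<^sup>+y. (\<integral>\<^sup>+k. f y * ?c y * ?c (y - z + k) \<partial>?I) \<partial>lborel)"
    by (intro nn_integral_count_space_nn_integral[symmetric] countable_integer_vectors) measurable
  also have "\<dots> = (\<integral>\<^sup>+y. f y * ?c y \<partial>lborel)"
    by (subst nn_integral_cmult) (auto simp: integer_translates_partition')
  finally show ?thesis .
qed

lemma torus_continuous_borel [measurable_dest]: "g \<in> torus_continuous \<Longrightarrow> g \<in> borel_measurable borel"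
  by (auto simp: torus_continuous_def intro: borel_measurable_continuous_onI)

lemma integral_torus_measure:
  fixes g :: "real ^ 'd \<Rightarrow> complex"
  assumes [measurable]: "g \<in> borel_measurable borel"
  shows "(LINT y|torus_measure. g y) = (LINT y|cell_measure. g y)"
proof -
  have "(LINT y|torus_measure. g y) = (LINT y|lebesgue. indicator unit_cell y *\<^sub>R g y)"
    unfolding torus_measure_def unit_cell_def[symmetric] by (subst integral_restrict_space) auto
  also have "\<dots> = (LINT y|lborel. indicator unit_cell y *\<^sub>R g y)"
    by (rule integral_completion) measurable
  also have "\<dots> = (LINT y|cell_measure. g y)"
    unfolding cell_measure_def by (subst integral_restrict_space) auto
  finally show ?thesis .
qed

lemma torus_continuous_bounded:
  fixes g :: "real ^ 'd \<Rightarrow> complex"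
  assumes g: "g \<in> torus_continuous"
  obtains B where "B \<ge> 0" "\<And>y. cmod (g y) \<le> B"
proof -
  have "compact (g ` cbox 0 1)"
    using g by (intro compact_continuous_image) (auto simp: torus_continuous_def intro: continuous_on_subset)
  from compact_imp_bounded[OF this] obtain B where B: "\<And>y. y \<in> cbox 0 1 \<Longrightarrow> cmod (g y) \<le> B"
    unfolding bounded_iff by auto
  have le: "cmod (g y) \<le> B" for y
  proof -
    define k :: "real ^ 'd" where "k = (\<chi> i. - real_of_int \<lfloor>y $ i\<rfloor>)"
    have "y + k \<in> cbox 0 1" by (auto simp: mem_box_cart k_def) linarith
    moreover have "g (y + k) = g y" using g by (auto simp: torus_continuous_def k_def)
    ultimately show ?thesis using B by metis
  qed
  moreover have "B \<ge> 0" using le[of 0] norm_ge_zero order_trans by blast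
  ultimately show ?thesis using that by blast
qed

lemma integral_cell_translate_real:
  fixes h :: "real ^ 'd \<Rightarrow> real"
  assumes [measurable]: "h \<in> borel_measurable borel" and "\<And>y. h y \<ge> 0"
    and per: "\<And>y k. k \<in> integer_vectors \<Longrightarrow> h (y + k) = h y"
  shows "(LINT y|cell_measure. h (y + z)) = (LINT y|cell_measure. h y)"
proof -
  have "(\<integral>\<^sup>+y. ennreal (h (y + z)) \<partial>cell_measure) = (\<integral>\<^sup>+y. ennreal (h y) \<partial>cell_measure)"
    unfolding cell_measure_def
    using nn_integral_periodic_translate[of "\<lambda>y. ennreal (h y)" z] per
    by (simp add: nn_integral_restrict_space)
  moreover have "(\<lambda>y. h (y + z)) \<in> borel_measurable cell_measure" "h \<in> borel_measurable cell_measure"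
    unfolding cell_measure_def by (intro measurable_restrict_space1; measurable)+
  ultimately show ?thesis
    using assms(2) by (simp add: integral_eq_nn_integral)
qed

lemma integrable_cell_measure_bounded:
  fixes h :: "real ^ 'd \<Rightarrow> 'b :: {banach, second_countable_topology}"
  assumes [measurable]: "h \<in> borel_measurable borel" and "\<And>y. norm (h y) \<le> B"
  shows "integrable cell_measure h"
proof -
  interpret prob_space "cell_measure :: (real ^ 'd) measure" by (rule prob_space_cell_measure)
  show ?thesis
    by (rule integrable_const_bound[of _ B]) (use assms in \<open>auto simp: cell_measure_def intro: measurable_restrict_space1\<close>)
qed

lemma integral_cell_translate:
  fixes g :: "real ^ 'd \<Rightarrow> complex"
  assumes g: "g \<in> torus_continuous"
  shows "(LINT y|cell_measure. g (y + z)) = (LINT y|cell_measure. g y)"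
proof -
  interpret prob_space "cell_measure :: (real ^ 'd) measure" by (rule prob_space_cell_measure)
  obtain B where B: "\<And>y. cmod (g y) \<le> B" using torus_continuous_bounded[OF g] by blast
  have [measurable]: "g \<in> borel_measurable borel" using g by (rule torus_continuous_borel)
  have per: "g (y + k) = g y" if "k \<in> integer_vectors" for y k
    using g that by (auto simp: torus_continuous_def integer_vectors_def)
  have bd: "\<bar>Re (g y)\<bar> \<le> B" "\<bar>Im (g y)\<bar> \<le> B" for y
    using B[of y] abs_Re_le_cmod[of "g y"] abs_Im_le_cmod[of "g y"] by linarith+
  have real: "(LINT y|cell_measure. h (y + z)) = (LINT y|cell_measure. h y)"
    if [measurable]: "h \<in> borel_measurable borel" and bd: "\<And>y. \<bar>h y\<bar> \<le> B"
      and per: "\<And>y k. k \<in> integer_vectors \<Longrightarrow> h (y + k) = h y" for h :: "real ^ 'd \<Rightarrow> real"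
  proof -
    have i: "integrable cell_measure h" "integrable cell_measure (\<lambda>y. h (y + z))"
      using bd by (intro integrable_cell_measure_bounded[of _ B]; measurable; simp)+
    \<comment> \<open>Shifting by the bound reduces the claim to nonnegative functions.\<close>
    have "0 \<le> h y + B" for y using bd[of y] by linarith
    then have "(LINT y|cell_measure. h (y + z) + B) = (LINT y|cell_measure. h y + B)"
      using per by (intro integral_cell_translate_real[of "\<lambda>y. h y + B"]) auto
    then show ?thesis using i by (simp add: prob_space)
  qed
  have i: "integrable cell_measure g" "integrable cell_measure (\<lambda>y. g (y + z))"
    using B by (intro integrable_cell_measure_bounded[of _ B]; measurable; simp)+
  show ?thesis
    using real[of "\<lambda>y. Re (g y)"] real[of "\<lambda>y. Im (g y)"] bd per integral_Re[OF i(1)] integral_Re[OF i(2)] integral_Im[OF i(1)] integral_Im[OF i(2)]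
    by (intro complex_eqI) auto
qed

text \<open>
Translating \<open>x\<close> by \<open>\<epsilon> y\<close> leaves the integral unchanged and turns \<open>g(x/\<epsilon>)\<close> into \<open>g(x/\<epsilon> + y)\<close>, whose average over \<open>y\<close> in
the cell is the mean of \<open>g\<close> for every \<open>x\<close>. The price is replacing \<open>F(x + \<epsilon> y)\<close> by \<open>F(x)\<close>, which costs at most
\<open>L \<epsilon> \<bar>y\<bar>\<close> and only on \<open>E\<close> and its translate.
\<close>

lemma oscillating_integral_bound:
  fixes F :: "real ^ 'd \<Rightarrow> real" and g :: "real ^ 'd \<Rightarrow> complex"
  assumes g: "g \<in> torus_continuous" and B: "\<And>y. cmod (g y) \<le> B"
    and F: "integrable lborel F" and lip: "\<And>x y. \<bar>F x - F y\<bar> \<le> L * norm (x - y)" and L: "L \<ge> 0"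
    and E: "E \<in> sets lborel" "emeasure lborel E < \<infinity>" and supp: "\<And>x. x \<notin> E \<Longrightarrow> F x = 0" and \<epsilon>: "\<epsilon> > 0"
  shows "cmod ((LINT x|lborel. F x *\<^sub>R g ((1 / \<epsilon>) *\<^sub>R x)) - (LINT x|lborel. F x) *\<^sub>R (LINT y|torus_measure. g y))
          \<le> 2 * B * L * \<epsilon> * real CARD('d) * measure lborel E"
proof -
  define Q where "Q = (cell_measure :: (real ^ 'd) measure)"
  interpret Q: prob_space Q unfolding Q_def by (rule prob_space_cell_measure)
  interpret pair_sigma_finite lborel Q ..
  have [measurable]: "g \<in> borel_measurable borel" using g by (rule torus_continuous_borel)
  have B0: "B \<ge> 0" using B[of 0] norm_ge_zero order_trans by blast
  have Fm [measurable]: "F \<in> borel_measurable borel" using F by auto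
  have sets_Q: "f \<in> borel_measurable Q" if "f \<in> borel_measurable borel" for f :: "real ^ 'd \<Rightarrow> complex"
    using that unfolding Q_def cell_measure_def by (simp add: measurable_restrict_space1)
  have le: "cmod (a *\<^sub>R g z) \<le> \<bar>B * a\<bar>" for a z
    using mult_right_mono[OF B[of z], of "\<bar>a\<bar>"] B0 by (simp add: abs_mult mult.commute)
  define I where "I = (LINT x|lborel. F x *\<^sub>R g ((1 / \<epsilon>) *\<^sub>R x))"
  define H where "H x y = F x *\<^sub>R g ((1 / \<epsilon>) *\<^sub>R x + y)" for x y
  have Hint: "integrable lborel (\<lambda>x. H x y)" for y
    unfolding H_def
    by (intro Bochner_Integration.integrable_bound[OF integrable_mult_right[OF F, of B]] AE_I2)
      (simp_all only: le real_norm_def, measurable)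
  have inner: "cmod (I - (LINT x|lborel. H x y)) \<le> 2 * B * L * \<epsilon> * real CARD('d) * measure lborel E"
    if y: "y \<in> unit_cell" for y
  proof -
    let ?sh = "\<lambda>x. F (x + \<epsilon> *\<^sub>R y) *\<^sub>R g ((1 / \<epsilon>) *\<^sub>R x + y)"
    have I: "I = (LINT x|lborel. ?sh x)"
    proof -
      have "(1 / \<epsilon>) *\<^sub>R (x + \<epsilon> *\<^sub>R y) = (1 / \<epsilon>) *\<^sub>R x + y" for x using \<epsilon> by (simp add: algebra_simps)
      then show ?thesis
        unfolding I_def using integral_lborel_translate[of "\<lambda>x. F x *\<^sub>R g ((1 / \<epsilon>) *\<^sub>R x)" "\<epsilon> *\<^sub>R y"] by simp
    qed
    have Fsh: "integrable lborel (\<lambda>x. F (x + \<epsilon> *\<^sub>R y))"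
      using integrable_distr_eq[of "(+) (\<epsilon> *\<^sub>R y)" lborel borel F] F by (simp add: lborel_distr_plus add.commute)
    have shint: "integrable lborel ?sh"
      by (intro Bochner_Integration.integrable_bound[OF integrable_mult_right[OF Fsh, of B]] AE_I2)
        (simp_all only: le real_norm_def, measurable)
    have ny: "norm y \<le> real CARD('d)"
    proof -
      have "norm y \<le> (\<Sum>i\<in>UNIV. \<bar>y $ i\<bar>)" by (rule norm_le_l1_cart)
      also have "\<dots> \<le> (\<Sum>i\<in>(UNIV::'d set). 1)" using y by (intro sum_mono) (auto simp: unit_cell_def less_imp_le)
      finally show ?thesis by simp
    qed
    let ?E' = "(\<lambda>x. x + \<epsilon> *\<^sub>R y) -` E"
    have E': "?E' \<in> sets lborel" "emeasure lborel ?E' = emeasure lborel E"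
    proof -
      show "?E' \<in> sets lborel" using E measurable_sets[of "\<lambda>x. x + \<epsilon> *\<^sub>R y" borel borel E] by simp
      show "emeasure lborel ?E' = emeasure lborel E"
        using nn_integral_lborel_translate[of "indicator E" "\<epsilon> *\<^sub>R y"] E \<open>?E' \<in> sets lborel\<close>
        by (simp add: nn_integral_indicator[symmetric] indicator_def vimage_def del: nn_integral_indicator)
    qed
    let ?b = "\<lambda>x. B * (L * (\<epsilon> * real CARD('d))) * (indicator E x + indicator ?E' x)"
    have bint: "integrable lborel ?b"
      using E E' by (intro integrable_mult_right Bochner_Integration.integrable_add) (auto simp: integrable_indicator_iff)
    have "cmod (I - (LINT x|lborel. H x y)) = cmod (LINT x|lborel. ?sh x - H x y)"
      unfolding I using shint Hint[of y] by simp
    also have "\<dots> \<le> (LINT x|lborel. cmod (?sh x - H x y))" by (rule integral_norm_bound)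
    also have "\<dots> \<le> (LINT x|lborel. ?b x)"
    proof (rule integral_mono)
      fix x
      have "\<bar>F (x + \<epsilon> *\<^sub>R y) - F x\<bar> \<le> L * (\<epsilon> * real CARD('d))"
      proof -
        have "\<bar>F (x + \<epsilon> *\<^sub>R y) - F x\<bar> \<le> L * (\<epsilon> * norm y)" using lip[of "x + \<epsilon> *\<^sub>R y" x] \<epsilon> by simp
        also have "\<dots> \<le> L * (\<epsilon> * real CARD('d))" using ny L \<epsilon> by (intro mult_left_mono) auto
        finally show ?thesis .
      qed
      moreover have "F (x + \<epsilon> *\<^sub>R y) - F x = 0" if "x \<notin> E" "x \<notin> ?E'" using supp that by auto
      ultimately have *: "\<bar>F (x + \<epsilon> *\<^sub>R y) - F x\<bar> \<le> L * (\<epsilon> * real CARD('d)) * (indicator E x + indicator ?E' x)"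
        using L \<epsilon> by (auto simp: indicator_def)
      have "cmod (?sh x - H x y) = \<bar>F (x + \<epsilon> *\<^sub>R y) - F x\<bar> * cmod (g ((1 / \<epsilon>) *\<^sub>R x + y))"
        unfolding H_def by (simp flip: scaleR_left_diff_distrib)
      also have "\<dots> \<le> (L * (\<epsilon> * real CARD('d)) * (indicator E x + indicator ?E' x)) * B"
        using * B by (intro mult_mono) auto
      finally show "cmod (?sh x - H x y) \<le> ?b x" by (simp add: mult_ac)
    qed (use bint shint Hint[of y] in auto)
    also have "\<dots> = B * (L * (\<epsilon> * real CARD('d))) * (measure lborel E + measure lborel ?E')"
      using E E' by (simp add: integrable_indicator_iff)
    also have "measure lborel ?E' = measure lborel E" using E' by (simp add: measure_def)
    finally show ?thesis by (simp add: mult_ac)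
  qed
  have Hm: "(\<lambda>(x, y). H x y) \<in> borel_measurable (lborel \<Otimes>\<^sub>M Q)"
  proof -
    have id: "(\<lambda>y. y) \<in> measurable Q borel"
      unfolding Q_def cell_measure_def by (simp add: measurable_restrict_space1)
    have [measurable]: "snd \<in> measurable ((lborel :: (real ^ 'd) measure) \<Otimes>\<^sub>M Q) borel"
      using measurable_compose[OF measurable_snd id, of "lborel :: (real ^ 'd) measure"] by simp
    have [measurable]: "fst \<in> measurable ((lborel :: (real ^ 'd) measure) \<Otimes>\<^sub>M Q) borel"
      using measurable_compose[OF measurable_fst, of "\<lambda>x. x" lborel borel Q] by simp
    show ?thesis unfolding H_def case_prod_beta by measurable
  qed
  have Qint: "integrable Q (\<lambda>y. H x y)" for x
    unfolding H_def Q_def using B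
    by (intro integrable_scaleR_right integrable_cell_measure_bounded[of _ B]) auto
  have Hprod: "integrable (lborel \<Otimes>\<^sub>M Q) (\<lambda>(x, y). H x y)"
  proof (rule Fubini_integrable[OF Hm])
    show "AE x in lborel. integrable Q (\<lambda>y. case (x, y) of (x, y) \<Rightarrow> H x y)" using Qint by simp
    have M: "(\<lambda>x. LINT y|Q. norm (H x y)) \<in> borel_measurable lborel"
      using Hm by measurable
    show "integrable lborel (\<lambda>x. LINT y|Q. norm (case (x, y) of (x, y) \<Rightarrow> H x y))"
    proof (rule Bochner_Integration.integrable_bound[OF integrable_mult_right[OF F, of B]])
      have "\<bar>LINT y|Q. norm (H x y)\<bar> \<le> \<bar>B * F x\<bar>" for x
      proof -
        have "(LINT y|Q. norm (H x y)) \<le> (LINT y|Q. \<bar>B * F x\<bar>)"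
          by (intro integral_mono integrable_norm Qint Q.integrable_const) (simp only: H_def le)
        then show ?thesis using Q.prob_space by simp
      qed
      then show "AE x in lborel. norm (LINT y|Q. norm (case (x, y) of (x, y) \<Rightarrow> H x y)) \<le> norm (B * F x)" by simp
    qed (use M in simp)
  qed
  have "(LINT y|Q. (LINT x|lborel. H x y)) = (LINT x|lborel. (LINT y|Q. H x y))"
    using Fubini_integral[OF Hprod] by simp
  also have "\<dots> = (LINT x|lborel. F x *\<^sub>R (LINT y|Q. g y))"
  proof -
    have "(LINT y|Q. g ((1 / \<epsilon>) *\<^sub>R x + y)) = (LINT y|Q. g y)" for x
      using integral_cell_translate[OF g, of "(1 / \<epsilon>) *\<^sub>R x"] by (simp add: Q_def add.commute)
    then show ?thesis by (simp add: H_def)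
  qed
  also have "\<dots> = (LINT x|lborel. F x) *\<^sub>R (LINT y|torus_measure. g y)"
    using F by (simp add: integral_torus_measure Q_def)
  finally have avg: "(LINT y|Q. (LINT x|lborel. H x y)) = (LINT x|lborel. F x) *\<^sub>R (LINT y|torus_measure. g y)" .
  have Iint: "integrable Q (\<lambda>y. LINT x|lborel. H x y)"
    using integrable_snd[OF Hprod] by simp
  have "I - (LINT x|lborel. F x) *\<^sub>R (LINT y|torus_measure. g y) = (LINT y|Q. I - (LINT x|lborel. H x y))"
    using Iint Q.prob_space by (simp add: avg)
  also have "cmod \<dots> \<le> (LINT y|Q. cmod (I - (LINT x|lborel. H x y)))" by (rule integral_norm_bound)
  also have "\<dots> \<le> (LINT y|Q. 2 * B * L * \<epsilon> * real CARD('d) * measure lborel E)"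
    using inner
    by (intro integral_mono integrable_norm Bochner_Integration.integrable_diff Q.integrable_const Iint) (auto simp: Q_def)
  also have "\<dots> = 2 * B * L * \<epsilon> * real CARD('d) * measure lborel E"
    using Q.prob_space by simp
  finally show ?thesis by (simp add: I_def)
qed

section \<open>Characters of an algebra with mean value\<close>

lemma algebra_closed:
  assumes "algebra_with_mean_value \<epsilon> A"
  shows algebra_add: "f \<in> A \<Longrightarrow> g \<in> A \<Longrightarrow> (\<lambda>x. f x + g x) \<in> A"
    and algebra_mult: "f \<in> A \<Longrightarrow> g \<in> A \<Longrightarrow> (\<lambda>x. f x * g x) \<in> A"
    and algebra_scale: "f \<in> A \<Longrightarrow> (\<lambda>x. c * f x) \<in> A"
    and algebra_cnj: "f \<in> A \<Longrightarrow> (\<lambda>x. cnj (f x)) \<in> A"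
    and algebra_const: "(\<lambda>x. c) \<in> A"
    and algebra_BUC: "f \<in> A \<Longrightarrow> f \<in> BUC"
    and algebra_mean: "f \<in> A \<Longrightarrow> \<exists>m. has_mean_value \<epsilon> f m"
  using assms unfolding algebra_with_mean_value_def by (simp_all add: subset_iff)

lemma algebra_uniform_limit:
  assumes "algebra_with_mean_value \<epsilon> A" "\<And>n. F n \<in> A" "uniform_limit UNIV F h sequentially"
  shows "h \<in> A"
  using assms(1) unfolding algebra_with_mean_value_def using assms(2,3) by blast

lemma BUC_bounded:
  assumes "f \<in> BUC"
  obtains c where "c \<ge> 0" "\<And>x. cmod (f x) \<le> c"
proof -
  have "bounded (range f)" using assms by (simp add: BUC_def)
  then obtain c where c: "\<And>x. cmod (f x) \<le> c" unfolding bounded_iff by auto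
  moreover have "c \<ge> 0" using c[of undefined] norm_ge_zero order_trans by blast
  ultimately show thesis using that by blast
qed

lemma BUC_continuous: "f \<in> BUC \<Longrightarrow> continuous_on UNIV f"
  by (simp add: BUC_def uniformly_continuous_imp_continuous)

lemma spectrumD:
  assumes "s \<in> spectrum A"
  shows spectrum_add: "f \<in> A \<Longrightarrow> g \<in> A \<Longrightarrow> s (\<lambda>x. f x + g x) = s f + s g"
    and spectrum_scale: "f \<in> A \<Longrightarrow> s (\<lambda>x. c * f x) = c * s f"
    and spectrum_mult: "f \<in> A \<Longrightarrow> g \<in> A \<Longrightarrow> s (\<lambda>x. f x * g x) = s f * s g"
    and spectrum_one: "s (\<lambda>x. 1) = 1"
  using assms by (simp_all add: spectrum_def)

lemma spectrum_const:
  assumes A: "algebra_with_mean_value \<epsilon> A" and s: "s \<in> spectrum A"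
  shows "s (\<lambda>x. c) = c"
  using spectrum_scale[OF s algebra_const[OF A, of 1], of c] spectrum_one[OF s] by simp

lemma algebra_diff:
  assumes A: "algebra_with_mean_value \<epsilon> A" "f \<in> A" "g \<in> A"
  shows "(\<lambda>x. f x - g x) \<in> A"
  using algebra_add[OF A(1,2) algebra_scale[OF A(1,3), of "-1"]] by simp

lemma spectrum_diff:
  assumes A: "algebra_with_mean_value \<epsilon> A" and s: "s \<in> spectrum A" and fg: "f \<in> A" "g \<in> A"
  shows "s (\<lambda>x. f x - g x) = s f - s g"
  using spectrum_add[OF s fg(1) algebra_scale[OF A fg(2), of "-1"]] spectrum_scale[OF s fg(2), of "-1"] by simp

text \<open>
If \<open>\<bar>s f\<bar>\<close> exceeded \<open>sup \<bar>f\<bar>\<close>, then \<open>1 - f / s f\<close> would be inverted in the algebra by the uniformly convergent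
Neumann series, but \<open>s\<close> vanishes on it.
\<close>

lemma spectrum_contractive:
  assumes A: "algebra_with_mean_value \<epsilon> A" and s: "s \<in> spectrum A" and f: "f \<in> A"
    and le: "\<And>x. cmod (f x) \<le> c"
  shows "cmod (s f) \<le> c"
proof (rule ccontr)
  assume "\<not> cmod (s f) \<le> c"
  then have gt: "c < cmod (s f)" by simp
  have c: "c \<ge> 0" using le[of undefined] norm_ge_zero order_trans by blast
  define l where "l = s f"
  have l: "l \<noteq> 0" "cmod l > 0" using gt c by (auto simp: l_def)
  define q where "q = c / cmod l"
  have q: "0 \<le> q" "q < 1" using gt c l by (auto simp: q_def l_def)
  define h where "h x = f x / l" for x
  have hA: "h \<in> A" using algebra_scale[OF A f, of "1/l"] by (simp add: h_def[abs_def])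
  have hq: "cmod (h x) \<le> q" for x
    using le[of x] l by (simp add: h_def q_def norm_divide divide_right_mono)
  have pw: "(\<lambda>x. h x ^ k) \<in> A" for k
    by (induction k) (auto intro: algebra_const[OF A] algebra_mult[OF A hA])
  have sums: "(\<lambda>x. \<Sum>k<n. h x ^ k) \<in> A" for n
    by (induction n) (auto intro: algebra_const[OF A] algebra_add[OF A _ pw])
  have unif: "uniform_limit UNIV (\<lambda>n x. \<Sum>k<n. h x ^ k) (\<lambda>x. \<Sum>k. h x ^ k) sequentially"
  proof (rule Weierstrass_m_test)
    show "norm (h x ^ n) \<le> q ^ n" for n x using hq[of x] by (simp add: norm_power power_mono)
    show "summable (\<lambda>n. q ^ n)" using q by (simp add: summable_geometric)
  qed
  define g where "g x = (\<Sum>k. h x ^ k)" for x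
  have gA: "g \<in> A" unfolding g_def[abs_def] by (rule algebra_uniform_limit[OF A sums unif])
  have gx: "(1 - h x) * g x = 1" for x
  proof -
    have "cmod (h x) < 1" using hq[of x] q by simp
    then have "g x = 1 / (1 - h x)" unfolding g_def by (rule suminf_geometric)
    moreover have "h x \<noteq> 1" using \<open>cmod (h x) < 1\<close> by auto
    ultimately show ?thesis by simp
  qed
  have dA: "(\<lambda>x. 1 - h x) \<in> A" by (rule algebra_diff[OF A algebra_const[OF A] hA])
  have "s (\<lambda>x. 1 - h x) = 1 - s h"
    using spectrum_diff[OF A s algebra_const[OF A] hA, of 1] spectrum_one[OF s] by simp
  also have "s h = 1" using spectrum_scale[OF s f, of "1/l"] l by (simp add: h_def[abs_def] l_def)
  finally have "s (\<lambda>x. (1 - h x) * g x) = 0" using spectrum_mult[OF s dA gA] by simp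
  then show False using gx spectrum_one[OF s] by simp
qed

text \<open>
Apply contractivity to \<open>f + \<i> r\<close> for real \<open>r\<close>: in \<open>(Im (s f) + r)\<^sup>2 \<le> c\<^sup>2 + r\<^sup>2\<close> the term linear in \<open>r\<close> has to vanish.
\<close>

lemma spectrum_real:
  assumes A: "algebra_with_mean_value \<epsilon> A" and s: "s \<in> spectrum A" and f: "f \<in> A"
    and re: "\<And>x. Im (f x) = 0"
  shows "Im (s f) = 0"
proof (rule ccontr)
  assume ne: "Im (s f) \<noteq> 0"
  obtain c where c: "c \<ge> 0" "\<And>x. cmod (f x) \<le> c" using BUC_bounded[OF algebra_BUC[OF A f]] by blast
  have bound: "2 * r * Im (s f) \<le> c\<^sup>2" for r :: real
  proof -
    have "cmod (f x + \<i> * r) \<le> sqrt (c\<^sup>2 + r\<^sup>2)" for x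
    proof -
      have "(Re (f x))\<^sup>2 = (cmod (f x))\<^sup>2" by (simp add: cmod_power2 re)
      also have "\<dots> \<le> c\<^sup>2" using c(2)[of x] by (simp add: power_mono)
      finally show ?thesis by (simp add: cmod_def re)
    qed
    from spectrum_contractive[OF A s algebra_add[OF A f algebra_const[OF A]] this]
    have "cmod (s (\<lambda>x. f x + \<i> * r)) \<le> sqrt (c\<^sup>2 + r\<^sup>2)" .
    then have "cmod (s f + \<i> * r) \<le> sqrt (c\<^sup>2 + r\<^sup>2)"
      using spectrum_add[OF s f algebra_const[OF A]] spectrum_const[OF A s] by simp
    then have "(cmod (s f + \<i> * r))\<^sup>2 \<le> (sqrt (c\<^sup>2 + r\<^sup>2))\<^sup>2" by (rule power_mono) simp
    then have "(Re (s f))\<^sup>2 + (Im (s f) + r)\<^sup>2 \<le> c\<^sup>2 + r\<^sup>2" by (simp add: cmod_power2)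
    then have "(Re (s f))\<^sup>2 + (Im (s f))\<^sup>2 + 2 * Im (s f) * r \<le> c\<^sup>2" by (simp add: power2_sum)
    moreover have "2 * Im (s f) * r = 2 * r * Im (s f)" by simp
    ultimately show ?thesis
      using zero_le_power2[of "Re (s f)"] zero_le_power2[of "Im (s f)"] by linarith
  qed
  have "2 * ((c\<^sup>2 + 1) / Im (s f)) * Im (s f) = 2 * c\<^sup>2 + 2" using ne by simp
  with bound[of "(c\<^sup>2 + 1) / Im (s f)"] zero_le_power2[of c] show False by linarith
qed

lemma spectrum_cnj:
  assumes A: "algebra_with_mean_value \<epsilon> A" and s: "s \<in> spectrum A" and f: "f \<in> A"
  shows "s (\<lambda>x. cnj (f x)) = cnj (s f)"
proof -
  define u where "u x = complex_of_real (Re (f x))" for x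
  define v where "v x = complex_of_real (Im (f x))" for x
  have u: "u = (\<lambda>x. (1/2) * (f x + cnj (f x)))"
    by (auto simp: u_def fun_eq_iff complex_eq_iff)
  have v: "v = (\<lambda>x. (- \<i>/2) * (f x - cnj (f x)))"
    by (auto simp: v_def fun_eq_iff complex_eq_iff)
  have uA: "u \<in> A" unfolding u by (intro algebra_scale[OF A] algebra_add[OF A] algebra_cnj[OF A] f)
  have vA: "v \<in> A" unfolding v by (intro algebra_scale[OF A] algebra_diff[OF A] algebra_cnj[OF A] f)
  have ivA: "(\<lambda>x. \<i> * v x) \<in> A" by (rule algebra_scale[OF A vA])
  have "f = (\<lambda>x. u x + \<i> * v x)" by (auto simp: u_def v_def fun_eq_iff complex_eq_iff)
  then have sf: "s f = s u + \<i> * s v" using spectrum_add[OF s uA ivA] spectrum_scale[OF s vA] by simp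
  have "(\<lambda>x. cnj (f x)) = (\<lambda>x. u x - \<i> * v x)" by (auto simp: u_def v_def fun_eq_iff complex_eq_iff)
  then have "s (\<lambda>x. cnj (f x)) = s u - \<i> * s v" using spectrum_diff[OF A s uA ivA] spectrum_scale[OF s vA] by simp
  moreover have "Im (s u) = 0" "Im (s v) = 0"
    by (rule spectrum_real[OF A s uA], simp add: u_def, rule spectrum_real[OF A s vA], simp add: v_def)
  ultimately show ?thesis using sf by (simp add: complex_eq_iff)
qed

lemma topspace_spectrum_topology: "topspace (spectrum_topology A) = spectrum A"
  by (auto simp: spectrum_topology_def spectrum_def PiE_def)

lemma mean_value_measure_space:
  assumes "mean_value_measure \<epsilon> A \<beta>"
  shows "space \<beta> = spectrum A" "prob_space \<beta>"
  using assms by (auto simp: mean_value_measure_def radon_prob_on_def topspace_spectrum_topology intro: prob_spaceI)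

lemma gelfand_measurable:
  assumes \<beta>: "mean_value_measure \<epsilon> A \<beta>" and f: "f \<in> A"
  shows "(\<lambda>s. s f) \<in> borel_measurable \<beta>"
proof (rule borel_measurableI)
  fix U :: "complex set" assume U: "open U"
  have sets: "sets \<beta> = sigma_sets (topspace (spectrum_topology A)) {U. openin (spectrum_topology A) U}"
    and space: "space \<beta> = topspace (spectrum_topology A)"
    using \<beta> by (auto simp: mean_value_measure_def radon_prob_on_def)
  have "continuous_map (spectrum_topology A) euclidean (\<lambda>s. s f)"
    unfolding spectrum_topology_def
    by (intro continuous_map_from_subtopology continuous_map_product_projection[where X = "\<lambda>_. euclidean"] f)
  from openin_continuous_map_preimage[OF this, of U] U
  have "openin (spectrum_topology A) {s \<in> topspace (spectrum_topology A). s f \<in> U}" by simp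
  moreover have "(\<lambda>s. s f) -` U \<inter> space \<beta> = {s \<in> topspace (spectrum_topology A). s f \<in> U}"
    by (auto simp: space)
  ultimately show "(\<lambda>s. s f) -` U \<inter> space \<beta> \<in> sets \<beta>"
    unfolding sets by (auto intro: sigma_sets.Basic)
qed

text \<open>
Testing with the indicator of the unit interval shows that mean values are unique.
\<close>

lemma has_mean_value_mean_value:
  assumes "has_mean_value \<epsilon> f m"
  shows "mean_value \<epsilon> f = m"
  unfolding mean_value_def
proof (rule the_equality)
  fix m' assume m': "has_mean_value \<epsilon> f m'"
  define \<phi> :: "real \<Rightarrow> complex" where "\<phi> x = complex_of_real (indicator {0..1} x)" for x
  have int: "integrable lebesgue \<phi>" unfolding \<phi>_def by (simp add: integrable_real_indicator)
  have one: "(LINT x|lebesgue. \<phi> x) = 1" unfolding \<phi>_def by (subst integral_complex_of_real) simp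
  from LIMSEQ_unique[of _ "LINT x|lebesgue. m * \<phi> x" "LINT x|lebesgue. m' * \<phi> x"] int assms m'
  have "(LINT x|lebesgue. m * \<phi> x) = (LINT x|lebesgue. m' * \<phi> x)"
    unfolding has_mean_value_def by blast
  then show "m' = m" using one int by simp
qed (rule assms)

lemma product_algebra_slice:
  fixes h :: "(real \<times> (real ^ 'd)) \<Rightarrow>\<^sub>C complex"
  assumes A: "algebra_with_mean_value \<epsilon> A" and h: "h \<in> product_algebra A"
  shows "(\<lambda>\<tau>. apply_bcontfun h (\<tau>, y)) \<in> A"
proof -
  define S where "S = {h :: (real \<times> (real ^ 'd)) \<Rightarrow>\<^sub>C complex. (\<lambda>\<tau>. apply_bcontfun h (\<tau>, y)) \<in> A}"
  have "span {h. \<exists>f\<in>A. \<exists>g\<in>torus_continuous. \<forall>\<tau> y. apply_bcontfun h (\<tau>, y) = f \<tau> * g y} \<subseteq> S"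
  proof (rule span_minimal)
    show "subspace S"
      unfolding subspace_def S_def using algebra_add[OF A] algebra_const[OF A, of 0] algebra_scale[OF A]
      by (auto simp: plus_bcontfun.rep_eq scaleR_bcontfun.rep_eq zero_bcontfun.rep_eq scaleR_conv_of_real)
    show "{h. \<exists>f\<in>A. \<exists>g\<in>torus_continuous. \<forall>\<tau> y. apply_bcontfun h (\<tau>, y) = f \<tau> * g y} \<subseteq> S"
    proof safe
      fix h :: "(real \<times> (real ^ 'd)) \<Rightarrow>\<^sub>C complex" and f and g :: "real ^ 'd \<Rightarrow> complex"
      assume "f \<in> A" and h: "\<forall>\<tau> y. apply_bcontfun h (\<tau>, y) = f \<tau> * g y"
      from algebra_scale[OF A this(1), of "g y"] show "h \<in> S"
        unfolding S_def by (simp add: h mult.commute[of _ "g y"])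
    qed
  qed
  moreover have "closed S"
    unfolding closed_sequential_limits
  proof (intro allI impI, elim conjE)
    fix H :: "nat \<Rightarrow> (real \<times> (real ^ 'd)) \<Rightarrow>\<^sub>C complex" and l
    assume H: "\<forall>n. H n \<in> S" "H \<longlonglongrightarrow> l"
    have "uniform_limit UNIV (\<lambda>n \<tau>. apply_bcontfun (H n) (\<tau>, y)) (\<lambda>\<tau>. apply_bcontfun l (\<tau>, y)) sequentially"
      using tendsto_bcontfun_uniform_limit[OF H(2)] unfolding uniform_limit_iff
      by (auto elim!: eventually_mono)
    from algebra_uniform_limit[OF A _ this] H(1) show "l \<in> S"
      by (simp add: S_def)
  qed
  ultimately have "product_algebra A \<subseteq> S"
    unfolding product_algebra_def by (rule closure_minimal)
  with h show ?thesis by (auto simp: S_def)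
qed

section \<open>Mean values of test functions along the flow\<close>

lemma sigma_finite_lebesgue: "sigma_finite_measure (lebesgue :: 'a::euclidean_space measure)"
proof
  obtain C :: "'a set set" where "countable C" "C \<subseteq> sets lborel" "\<Union>C = space lborel" "\<forall>a\<in>C. emeasure lborel a \<noteq> \<infinity>"
    using lborel.sigma_finite_countable by blast
  then show "\<exists>C. countable C \<and> C \<subseteq> sets (lebesgue :: 'a measure) \<and> \<Union>C = space (lebesgue :: 'a measure) \<and> (\<forall>a\<in>C. emeasure lebesgue a \<noteq> \<infinity>)"
    by (intro exI[of _ C]) auto
qed

lemma time_strip_borel: "{0<..<T} \<times> UNIV \<in> sets (borel :: (real \<times> (real ^ 'd)) measure)"
  by (intro borel_open open_Times) auto

lemma time_strip_lebesgue: "{0<..<T} \<times> UNIV \<in> sets (lebesgue :: (real \<times> (real ^ 'd)) measure)"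
  by (intro sets_completionI_sets) (simp add: time_strip_borel)

lemma space_time_space [simp]: "space (time_space T :: (real \<times> (real ^ 'd)) measure) = {0<..<T} \<times> UNIV"
  by (simp add: time_space_def)

lemma sigma_finite_time_space: "sigma_finite_measure (time_space T :: (real \<times> (real ^ 'd)) measure)"
  unfolding time_space_def
  by (intro sigma_finite_measure_restrict_space sigma_finite_lebesgue time_strip_lebesgue)

lemma prob_space_torus_measure: "prob_space (torus_measure :: (real ^ 'd) measure)"
  by standard (simp add: torus_measure_def unit_cell_def[symmetric] emeasure_restrict_space emeasure_unit_cell)

lemma borel_measurable_time_space:
  assumes "f \<in> borel_measurable borel" shows "f \<in> borel_measurable (time_space T :: (real \<times> (real ^ 'd)) measure)"
  unfolding time_space_def using assms by (intro measurable_restrict_space1) (simp add: measurable_completion)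

lemma integral_time_space:
  fixes f :: "real \<times> (real ^ 'd) \<Rightarrow> 'b :: {banach, second_countable_topology}"
  assumes f: "f \<in> borel_measurable borel"
  shows "(LINT p|time_space T. f p) = (LINT p|lborel. indicator ({0<..<T} \<times> UNIV) p *\<^sub>R f p)"
    and "integrable (time_space T) f \<longleftrightarrow> integrable lborel (\<lambda>p. indicator ({0<..<T} \<times> UNIV) p *\<^sub>R f p)"
proof -
  have [measurable]: "{0<..<T} \<times> UNIV \<in> sets (borel :: (real \<times> (real ^ 'd)) measure)" by (rule time_strip_borel)
  note [measurable] = f
  have m: "(\<lambda>p. indicator ({0<..<T} \<times> UNIV) p *\<^sub>R f p) \<in> borel_measurable lborel" by measurable
  show "(LINT p|time_space T. f p) = (LINT p|lborel. indicator ({0<..<T} \<times> UNIV) p *\<^sub>R f p)"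
    unfolding time_space_def using m by (subst integral_restrict_space) (auto simp: integral_completion time_strip_lebesgue)
  show "integrable (time_space T) f \<longleftrightarrow> integrable lborel (\<lambda>p. indicator ({0<..<T} \<times> UNIV) p *\<^sub>R f p)"
    unfolding time_space_def using m by (subst integrable_restrict_space) (auto simp: integrable_completion time_strip_lebesgue)
qed

text \<open>
The substitution \<open>x \<mapsto> X = \<Phi>\<^bsub>-t/c\<^esub>(x)\<close> at each time \<open>t\<close>.
\<close>

definition flow_shift :: "(real \<Rightarrow> real ^ 'd \<Rightarrow> real ^ 'd) \<Rightarrow> real \<Rightarrow> real \<times> (real ^ 'd) \<Rightarrow> real \<times> (real ^ 'd)" where
  "flow_shift \<Phi> c p = (fst p, \<Phi> (- (fst p / c)) (snd p))"

lemma continuous_on_flow_shift: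
  fixes \<Phi> :: "real \<Rightarrow> real ^ 'd \<Rightarrow> real ^ 'd"
  assumes \<Phi>: "admissible_flow \<Phi>"
  shows "continuous_on UNIV (flow_shift \<Phi> c)"
proof -
  have "continuous_on UNIV (\<lambda>p :: real \<times> (real ^ 'd). (\<lambda>(t, x). \<Phi> t x) (- (fst p / c), snd p))"
    by (rule continuous_on_compose2[OF continuous_on_flow[OF \<Phi>]])
      (auto simp: divide_inverse intro!: continuous_intros)
  then show ?thesis
    unfolding flow_shift_def[abs_def] by (auto intro!: continuous_intros)
qed

lemma continuous_on_flow_time:
  fixes \<Phi> :: "real \<Rightarrow> real ^ 'd \<Rightarrow> real ^ 'd"
  assumes \<Phi>: "admissible_flow \<Phi>"
  shows "continuous_on UNIV (\<Phi> t)"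
proof -
  have "continuous_on UNIV (\<lambda>x :: real ^ 'd. (t, x))" by (intro continuous_intros)
  from continuous_on_compose2[OF continuous_on_flow[OF \<Phi>] this] show ?thesis by simp
qed

text \<open>
Each time slice is moved by a volume-preserving map.
\<close>

lemma distr_lborel_flow_shift:
  fixes \<Phi> :: "real \<Rightarrow> real ^ 'd \<Rightarrow> real ^ 'd"
  assumes \<Phi>: "admissible_flow \<Phi>"
  shows "distr lborel lborel (flow_shift \<Phi> c) = lborel"
proof (rule measure_eqI)
  have m [measurable]: "flow_shift \<Phi> c \<in> borel_measurable borel"
    using continuous_on_flow_shift[OF \<Phi>] by (rule borel_measurable_continuous_onI)
  have fm: "\<Phi> t \<in> borel_measurable borel" for t
    using continuous_on_flow_time[OF \<Phi>] by (rule borel_measurable_continuous_onI)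
  have bs: "sets (borel \<Otimes>\<^sub>M borel) = sets (borel :: (real \<times> (real ^ 'd)) measure)"
    by (simp only: borel_prod)
  fix B assume "B \<in> sets (distr lborel lborel (flow_shift \<Phi> c))"
  then have B: "B \<in> sets borel" by simp
  then have SB: "flow_shift \<Phi> c -` B \<in> sets borel" using measurable_sets[OF m B] by simp
  have slice: "Pair t -` C \<in> sets borel" if "C \<in> sets borel" for t and C :: "(real \<times> (real ^ 'd)) set"
    using sets_Pair1[of C borel borel t] that by (simp add: bs)
  have "emeasure (distr lborel lborel (flow_shift \<Phi> c)) B = emeasure (lborel \<Otimes>\<^sub>M lborel) (flow_shift \<Phi> c -` B)"
    using B by (simp add: emeasure_distr lborel_prod)
  also have "\<dots> = (\<integral>\<^sup>+t. emeasure lborel (Pair t -` (flow_shift \<Phi> c -` B)) \<partial>lborel)"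
    using SB by (intro lborel.emeasure_pair_measure_alt) (simp add: bs)
  also have "\<dots> = (\<integral>\<^sup>+t. emeasure lborel (Pair t -` B) \<partial>lborel)"
  proof (rule nn_integral_cong)
    fix t
    have "Pair t -` (flow_shift \<Phi> c -` B) = \<Phi> (- (t / c)) -` (Pair t -` B)"
      by (auto simp: flow_shift_def)
    moreover have "emeasure lborel (\<Phi> (- (t / c)) -` (Pair t -` B)) = emeasure (distr lborel lborel (\<Phi> (- (t / c)))) (Pair t -` B)"
      using slice[OF B] fm by (subst emeasure_distr) auto
    ultimately show "emeasure lborel (Pair t -` (flow_shift \<Phi> c -` B)) = emeasure lborel (Pair t -` B)"
      by (simp add: distr_lborel_flow[OF \<Phi>])
  qed
  also have "\<dots> = emeasure (lborel \<Otimes>\<^sub>M lborel) B"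
    using B by (intro lborel.emeasure_pair_measure_alt[symmetric]) (simp add: bs)
  finally show "emeasure (distr lborel lborel (flow_shift \<Phi> c)) B = emeasure lborel B"
    by (simp add: lborel_prod)
qed simp

text \<open>
Invariance of Lebesgue measure on Borel sets implies that preimages of null sets are null, so the substitution
is compatible with Lebesgue measurable sets as well.
\<close>

lemma flow_shift_time_space:
  fixes \<Phi> :: "real \<Rightarrow> real ^ 'd \<Rightarrow> real ^ 'd"
  assumes \<Phi>: "admissible_flow \<Phi>"
  shows flow_shift_measurable: "flow_shift \<Phi> c \<in> measurable (time_space T) (time_space T)"
    and distr_time_space: "distr (time_space T) (time_space T) (flow_shift \<Phi> c) = time_space T"
proof -
  let ?S = "flow_shift \<Phi> c" and ?U = "{0<..<T} \<times> UNIV :: (real \<times> (real ^ 'd)) set"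
  have m: "?S \<in> measurable borel borel"
    using continuous_on_flow_shift[OF \<Phi>] by (rule borel_measurable_continuous_onI)
  then have m1: "?S \<in> measurable lebesgue lborel" by (simp add: measurable_completion)
  have d1: "distr lebesgue lborel ?S = lborel"
    using m by (subst distr_completion) (auto simp: distr_lborel_flow_shift[OF \<Phi>])
  have m2: "?S \<in> measurable lebesgue lebesgue"
    by (rule completion.measurable_completion2[OF m1]) (simp add: d1)
  have d2: "distr lebesgue lebesgue ?S = lebesgue"
    using completion.completion_distr_eq[OF m1] by (simp add: d1)
  have U: "?U \<in> sets lebesgue" by (rule time_strip_lebesgue)
  have inU: "?S p \<in> ?U \<longleftrightarrow> p \<in> ?U" for p by (auto simp: flow_shift_def mem_Times_iff)
  show m3: "?S \<in> measurable (time_space T) (time_space T)"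
    unfolding time_space_def
    by (rule measurable_restrict_space3[OF m2]) (use inU in auto)
  show "distr (time_space T) (time_space T) ?S = time_space T"
  proof (rule measure_eqI)
    fix B assume "B \<in> sets (distr (time_space T) (time_space T) ?S)"
    then have B: "B \<in> sets (time_space T)" by simp
    then have B': "B \<in> sets lebesgue" "B \<subseteq> ?U"
      using U by (auto simp: time_space_def sets_restrict_space_iff)
    have sub: "?S -` B \<subseteq> ?U" using B'(2) inU by blast
    then have eq: "?S -` B \<inter> ?U = ?S -` B" by auto
    have "emeasure (distr (time_space T) (time_space T) ?S) B = emeasure (time_space T) (?S -` B \<inter> ?U)"
      using B m3 by (simp add: emeasure_distr)
    also have "\<dots> = emeasure lebesgue (?S -` B)"
      using U sub by (simp add: eq time_space_def emeasure_restrict_space)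
    also have "\<dots> = emeasure (distr lebesgue lebesgue ?S) B"
      using B' m2 by (simp add: emeasure_distr)
    also have "\<dots> = emeasure (time_space T) B"
      using U B' by (simp add: d2 time_space_def emeasure_restrict_space)
    finally show "emeasure (distr (time_space T) (time_space T) ?S) B = emeasure (time_space T) B" .
  qed simp
qed

lemma (in pair_sigma_finite)
  fixes f :: "'a \<Rightarrow> complex" and g :: "'b \<Rightarrow> complex"
  assumes f: "integrable M1 f" and g: "integrable M2 g"
  shows integrable_tensor: "integrable (M1 \<Otimes>\<^sub>M M2) (\<lambda>p. f (fst p) * g (snd p))"
    and integral_tensor: "(LINT p|(M1 \<Otimes>\<^sub>M M2). f (fst p) * g (snd p)) = (LINT x|M1. f x) * (LINT y|M2. g y)"
proof -
  have [measurable]: "f \<in> borel_measurable M1" "g \<in> borel_measurable M2" using f g by auto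
  show int: "integrable (M1 \<Otimes>\<^sub>M M2) (\<lambda>p. f (fst p) * g (snd p))"
    by (rule Fubini_integrable) (use f g in \<open>auto simp: norm_mult\<close>)
  show "(LINT p|(M1 \<Otimes>\<^sub>M M2). f (fst p) * g (snd p)) = (LINT x|M1. f x) * (LINT y|M2. g y)"
    using integral_fst'[OF int] by simp
qed

text \<open>
Lipschitz rather than smooth functions: the class contains cut-off functions built from the distance to a compact
set, and composing with the flow preserves its Lipschitz bounds.
\<close>

definition lipschitz_tests :: "((real \<times> (real ^ 'd)) \<Rightarrow> real) set" where
  "lipschitz_tests = {\<phi>. (\<exists>L. L-lipschitz_on UNIV \<phi>) \<and> (\<exists>K. compact K \<and> (\<forall>p. p \<notin> K \<longrightarrow> \<phi> p = 0))}"

lemma lipschitz_test_continuous: "\<phi> \<in> lipschitz_tests \<Longrightarrow> continuous_on UNIV \<phi>"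
  by (auto simp: lipschitz_tests_def intro: lipschitz_on_continuous_on)

lemma lipschitz_test_bounded:
  assumes "\<phi> \<in> lipschitz_tests"
  obtains C where "C \<ge> 0" "\<And>p. \<bar>\<phi> p\<bar> \<le> C"
proof -
  obtain K where K: "compact K" "\<And>p. p \<notin> K \<Longrightarrow> \<phi> p = 0" using assms by (auto simp: lipschitz_tests_def)
  have "compact (\<phi> ` K)"
    using K(1) continuous_on_subset[OF lipschitz_test_continuous[OF assms]] by (intro compact_continuous_image) auto
  from compact_imp_bounded[OF this] obtain C where C: "\<And>p. p \<in> K \<Longrightarrow> \<bar>\<phi> p\<bar> \<le> C"
    unfolding bounded_iff by auto
  have "\<bar>\<phi> p\<bar> \<le> \<bar>C\<bar>" for p using C[of p] K(2)[of p] by (cases "p \<in> K") auto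
  then show thesis by (intro that[of "\<bar>C\<bar>"]) auto
qed

lemma integrable_compact_support:
  fixes \<phi> :: "'a :: euclidean_space \<Rightarrow> real"
  assumes cont: "continuous_on UNIV \<phi>" and K: "compact K" "\<And>p. p \<notin> K \<Longrightarrow> \<phi> p = 0"
  shows "integrable lborel \<phi>"
proof -
  have "integrable lborel (\<lambda>p. indicator K p *\<^sub>R \<phi> p)"
    by (rule borel_integrable_compact[OF K(1) continuous_on_subset[OF cont]]) auto
  moreover have "(\<lambda>p. indicator K p *\<^sub>R \<phi> p) = \<phi>" using K(2) by (auto simp: indicator_def fun_eq_iff)
  ultimately show ?thesis by simp
qed

lemma lipschitz_test_mult:
  assumes "\<phi> \<in> lipschitz_tests" "\<psi> \<in> lipschitz_tests"
  shows "(\<lambda>p. \<phi> p * \<psi> p) \<in> lipschitz_tests"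
proof -
  obtain C where C: "C \<ge> 0" "\<And>p. \<bar>\<phi> p\<bar> \<le> C" using lipschitz_test_bounded[OF assms(1)] by blast
  obtain D where D: "D \<ge> 0" "\<And>p. \<bar>\<psi> p\<bar> \<le> D" using lipschitz_test_bounded[OF assms(2)] by blast
  obtain K L where K: "compact K" "\<And>p. p \<notin> K \<Longrightarrow> \<phi> p = 0" "L-lipschitz_on UNIV \<phi>"
    using assms(1) by (auto simp: lipschitz_tests_def)
  obtain M where M: "M-lipschitz_on UNIV \<psi>" using assms(2) by (auto simp: lipschitz_tests_def)
  have "(C * M + D * L)-lipschitz_on UNIV (\<lambda>p. \<phi> p * \<psi> p)"
  proof (rule lipschitz_onI)
    fix p q
    have "\<bar>\<phi> p * \<psi> p - \<phi> q * \<psi> q\<bar> = \<bar>\<phi> p * (\<psi> p - \<psi> q) + (\<phi> p - \<phi> q) * \<psi> q\<bar>" by (simp add: algebra_simps)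
    also have "\<dots> \<le> \<bar>\<phi> p\<bar> * \<bar>\<psi> p - \<psi> q\<bar> + \<bar>\<phi> p - \<phi> q\<bar> * \<bar>\<psi> q\<bar>"
      by (metis abs_mult abs_triangle_ineq)
    also have "\<dots> \<le> C * (M * dist p q) + (L * dist p q) * D"
      using C D lipschitz_onD[OF K(3), of p q] lipschitz_onD[OF M, of p q] lipschitz_on_nonneg[OF K(3)]
      by (intro add_mono mult_mono) (auto simp: dist_real_def)
    finally show "dist (\<phi> p * \<psi> p) (\<phi> q * \<psi> q) \<le> (C * M + D * L) * dist p q"
      by (simp add: dist_real_def algebra_simps)
  qed (use C D lipschitz_on_nonneg[OF K(3)] lipschitz_on_nonneg[OF M] in simp)
  with K show ?thesis unfolding lipschitz_tests_def by fastforce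
qed

text \<open>
The product \<open>\<phi>(t,X) f(\<tau>) g(y)\<close> evaluated at \<open>X = \<Phi>\<^bsub>-t/c\<^esub>(x)\<close>, \<open>\<tau> = t/c\<close>, \<open>y = x/c\<close>.
\<close>

definition oscillating_term ::
    "(real \<Rightarrow> real ^ 'd \<Rightarrow> real ^ 'd) \<Rightarrow> real \<Rightarrow> (real \<times> (real ^ 'd) \<Rightarrow> real) \<Rightarrow> (real \<Rightarrow> complex) \<Rightarrow>
     (real ^ 'd \<Rightarrow> complex) \<Rightarrow> real \<times> (real ^ 'd) \<Rightarrow> complex" where
  "oscillating_term \<Phi> c \<phi> f g p = complex_of_real (\<phi> (flow_shift \<Phi> c p)) * (f (fst p / c) * g ((1 / c) *\<^sub>R snd p))"

lemma oscillating_term_borel: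
  fixes \<Phi> :: "real \<Rightarrow> real ^ 'd \<Rightarrow> real ^ 'd"
  assumes \<Phi>: "admissible_flow \<Phi>" and \<phi>: "\<phi> \<in> lipschitz_tests" and f: "f \<in> BUC" and g: "g \<in> torus_continuous"
  shows "oscillating_term \<Phi> c \<phi> f g \<in> borel_measurable borel"
proof (rule borel_measurable_continuous_onI)
  have "continuous_on UNIV (\<lambda>p. \<phi> (flow_shift \<Phi> c p))"
    by (rule continuous_on_compose2[OF lipschitz_test_continuous[OF \<phi>] continuous_on_flow_shift[OF \<Phi>]]) simp
  moreover have "continuous_on UNIV (\<lambda>p :: real \<times> (real ^ 'd). f (fst p / c))"
    by (rule continuous_on_compose2[OF BUC_continuous[OF f]]) (auto simp: divide_inverse intro!: continuous_intros)
  moreover have "continuous_on UNIV (\<lambda>p :: real \<times> (real ^ 'd). g ((1 / c) *\<^sub>R snd p))"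
  proof (rule continuous_on_compose2[of UNIV g])
    show "continuous_on UNIV g" using g by (simp add: torus_continuous_def)
  qed (intro continuous_intros, simp)
  ultimately show "continuous_on UNIV (oscillating_term \<Phi> c \<phi> f g)"
    unfolding oscillating_term_def[abs_def] by (intro continuous_intros)
qed

lemma lipschitz_test_integrable:
  assumes "\<phi> \<in> lipschitz_tests"
  shows "integrable lborel \<phi>" "integrable (time_space T) \<phi>"
proof -
  obtain K where K: "compact K" "\<And>p. p \<notin> K \<Longrightarrow> \<phi> p = 0" using assms by (auto simp: lipschitz_tests_def)
  have \<phi>: "\<phi> \<in> borel_measurable borel"
    using lipschitz_test_continuous[OF assms] by (rule borel_measurable_continuous_onI)
  show int: "integrable lborel \<phi>"
    by (rule integrable_compact_support[OF lipschitz_test_continuous[OF assms] K])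
  have "integrable lborel (\<lambda>p. indicator ({0<..<T} \<times> UNIV) p *\<^sub>R \<phi> p)"
    using int time_strip_borel by (intro integrable_mult_indicator) auto
  then show "integrable (time_space T) \<phi>"
    using integral_time_space(2)[OF \<phi>] by simp
qed

lemma oscillating_term_integrable:
  fixes \<Phi> :: "real \<Rightarrow> real ^ 'd \<Rightarrow> real ^ 'd"
  assumes \<Phi>: "admissible_flow \<Phi>" and \<phi>: "\<phi> \<in> lipschitz_tests" and f: "f \<in> BUC" and g: "g \<in> torus_continuous"
  shows "integrable (time_space T) (oscillating_term \<Phi> c \<phi> f g)"
proof -
  obtain Bf where Bf: "\<And>x. cmod (f x) \<le> Bf" "Bf \<ge> 0" using BUC_bounded[OF f] by blast
  obtain Bg where Bg: "\<And>x. cmod (g x) \<le> Bg" "Bg \<ge> 0" using torus_continuous_bounded[OF g] by blast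
  have "integrable (distr (time_space T) (time_space T) (flow_shift \<Phi> c)) \<phi>"
    using lipschitz_test_integrable(2)[OF \<phi>] by (simp add: distr_time_space[OF \<Phi>])
  then have "integrable (time_space T) (\<lambda>p. \<phi> (flow_shift \<Phi> c p))"
    by (rule integrable_distr[OF flow_shift_measurable[OF \<Phi>]])
  from integrable_mult_right[OF this, of "Bf * Bg"]
  show ?thesis
  proof (rule Bochner_Integration.integrable_bound)
    show "oscillating_term \<Phi> c \<phi> f g \<in> borel_measurable (time_space T)"
      by (intro borel_measurable_time_space oscillating_term_borel assms)
    have "cmod (f (fst p / c)) * cmod (g ((1 / c) *\<^sub>R snd p)) \<le> Bf * Bg" for p :: "real \<times> (real ^ 'd)"
      using Bf Bg by (intro mult_mono) auto
    from mult_left_mono[OF this, of "\<bar>\<phi> (flow_shift \<Phi> c _)\<bar>"]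
    show "AE p in time_space T. norm (oscillating_term \<Phi> c \<phi> f g p) \<le> norm (Bf * Bg * \<phi> (flow_shift \<Phi> c p))"
      using Bf Bg by (intro AE_I2) (simp add: oscillating_term_def norm_mult abs_mult mult_ac)
  qed
qed

text \<open>
The constant is uniform in \<open>t\<close> and \<open>c\<close>: the Lipschitz constant of \<open>\<phi>(t, \<Phi>\<^bsub>-t/c\<^esub>(x))\<close> comes from \<open>flow_gradient_bound\<close>, and
its support has the volume of a fixed compact set because the flow preserves volume.
\<close>

lemma slice_integral_estimate:
  fixes \<Phi> :: "real \<Rightarrow> real ^ 'd \<Rightarrow> real ^ 'd"
  assumes \<Phi>: "admissible_flow \<Phi>" and \<phi>: "\<phi> \<in> lipschitz_tests" and g: "g \<in> torus_continuous"
  obtains C where "C \<ge> 0"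
    "\<And>c t. c > 0 \<Longrightarrow> cmod ((LINT x|lborel. \<phi> (flow_shift \<Phi> c (t, x)) *\<^sub>R g ((1 / c) *\<^sub>R x))
        - (LINT X|lborel. \<phi> (t, X)) *\<^sub>R (LINT y|torus_measure. g y)) \<le> C * c"
proof -
  obtain K L where K: "compact K" "\<And>p. p \<notin> K \<Longrightarrow> \<phi> p = 0" and L: "L-lipschitz_on UNIV \<phi>"
    using \<phi> by (auto simp: lipschitz_tests_def)
  have L0: "L \<ge> 0" by (rule lipschitz_on_nonneg[OF L])
  define K' where "K' = snd ` K"
  have K': "compact K'" unfolding K'_def by (intro compact_continuous_image K continuous_intros)
  obtain M where M: "M > 0" "\<And>t x h. \<Phi> t x \<in> K' \<Longrightarrow> norm (flow_jacobian \<Phi> (- t) x *v h) \<le> M * norm h"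
    using flow_gradient_bound[OF \<Phi> K'] by blast
  obtain B where B: "B \<ge> 0" "\<And>y. cmod (g y) \<le> B" using torus_continuous_bounded[OF g] by blast
  define C where "C = 2 * B * (2 * L * M) * real CARD('d) * measure lborel K'"
  show thesis
  proof (rule that[of C])
    show "C \<ge> 0" unfolding C_def using L0 M B by simp
    fix c t :: real assume c: "c > 0"
    define s where "s = - (t / c)"
    \<comment> \<open>At fixed time the claim is the oscillation estimate for the composition of
      \<open>\<psi>\<close> with the flow map \<open>\<Phi> s\<close>.\<close>
    define \<psi> where "\<psi> X = \<phi> (t, X)" for X
    have \<psi>lip: "L-lipschitz_on UNIV \<psi>"
    proof (rule lipschitz_onI)
      show "dist (\<psi> x) (\<psi> y) \<le> L * dist x y" for x y
        using lipschitz_onD[OF L, of "(t, x)" "(t, y)"] by (simp add: \<psi>_def dist_Pair_Pair)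
    qed (rule L0)
    have \<psi>supp: "\<psi> X = 0" if "X \<notin> K'" for X
      using K(2)[of "(t, X)"] that by (force simp: K'_def \<psi>_def)
    have \<psi>int: "integrable lborel \<psi>"
      by (rule integrable_compact_support[OF lipschitz_on_continuous_on[OF \<psi>lip] K' \<psi>supp])
    have s: "\<Phi> s \<in> measurable lborel lborel"
      using continuous_on_flow_time[OF \<Phi>, of s] by (simp add: borel_measurable_continuous_onI)
    define F where "F x = \<psi> (\<Phi> s x)" for x
    have Fint: "integrable lborel F"
      unfolding F_def using \<psi>int by (intro integrable_distr[OF s]) (simp add: distr_lborel_flow[OF \<Phi>])
    have Feq: "(LINT x|lborel. F x) = (LINT X|lborel. \<phi> (t, X))"
    proof -
      have "(LINT x|lborel. F x) = (LINT X|lborel. \<psi> X)"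
        unfolding F_def using integral_distr[OF s, of \<psi>] \<psi>int by (simp add: distr_lborel_flow[OF \<Phi>])
      then show ?thesis by (simp add: \<psi>_def)
    qed
    have E: "\<Phi> s -` K' \<in> sets lborel" "emeasure lborel (\<Phi> s -` K') = emeasure lborel K'"
    proof -
      have K's: "K' \<in> sets lborel" using K' by (simp add: borel_compact)
      then show "\<Phi> s -` K' \<in> sets lborel" using measurable_sets[OF s K's] by simp
      have "emeasure (distr lborel lborel (\<Phi> s)) K' = emeasure lborel (\<Phi> s -` K')"
        using s K's by (simp add: emeasure_distr)
      then show "emeasure lborel (\<Phi> s -` K') = emeasure lborel K'" by (simp add: distr_lborel_flow[OF \<Phi>])
    qed
    have "cmod ((LINT x|lborel. F x *\<^sub>R g ((1 / c) *\<^sub>R x)) - (LINT x|lborel. F x) *\<^sub>R (LINT y|torus_measure. g y))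
          \<le> 2 * B * (2 * L * M) * c * real CARD('d) * measure lborel (\<Phi> s -` K')"
    proof (rule oscillating_integral_bound[OF g B(2) Fint])
      show "\<bar>F x - F y\<bar> \<le> 2 * L * M * norm (x - y)" for x y
        unfolding F_def
        by (rule lipschitz_composition_bound[OF flow_has_derivative[OF \<Phi>] M(2) \<psi>lip compact_imp_closed[OF K'] less_imp_le[OF M(1)] \<psi>supp])
      show "emeasure lborel (\<Phi> s -` K') < \<infinity>"
        using E emeasure_compact_finite[OF K'] by simp
      show "F x = 0" if "x \<notin> \<Phi> s -` K'" for x using that \<psi>supp by (simp add: F_def)
    qed (use L0 M E c in auto)
    moreover have "measure lborel (\<Phi> s -` K') = measure lborel K'" using E by (simp add: measure_def)
    moreover have "F x = \<phi> (flow_shift \<Phi> c (t, x))" for x by (simp add: F_def \<psi>_def s_def flow_shift_def)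
    ultimately show "cmod ((LINT x|lborel. \<phi> (flow_shift \<Phi> c (t, x)) *\<^sub>R g ((1 / c) *\<^sub>R x))
        - (LINT X|lborel. \<phi> (t, X)) *\<^sub>R (LINT y|torus_measure. g y)) \<le> C * c"
      using Feq by (simp add: C_def mult_ac)
  qed
qed

text \<open>
By the slice estimate the space integral may be replaced by \<open>a(t)\<close> times the mean of \<open>g\<close>, where \<open>a(t) = \<integral> \<phi>(t,X) dX\<close>,
uniformly in \<open>t\<close>. The remaining time integral is \<open>f(t/\<epsilon>)\<close> against an integrable function and converges by
the definition of the mean value.
\<close>

lemma oscillating_term_mean:
  fixes \<Phi> :: "real \<Rightarrow> real ^ 'd \<Rightarrow> real ^ 'd"
  assumes \<Phi>: "admissible_flow \<Phi>" and \<phi>: "\<phi> \<in> lipschitz_tests" and f: "f \<in> BUC" and g: "g \<in> torus_continuous"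
    and \<epsilon>: "\<And>n. \<epsilon> n > 0" "\<epsilon> \<longlonglongrightarrow> 0" and m: "has_mean_value \<epsilon> f m" and T: "T > 0"
  shows "(\<lambda>n. LINT p|time_space T. oscillating_term \<Phi> (\<epsilon> n) \<phi> f g p)
           \<longlonglongrightarrow> complex_of_real (LINT p|time_space T. \<phi> p) * (m * (LINT y|torus_measure. g y))"
proof -
  obtain C where C: "C \<ge> 0"
    "\<And>c t. c > 0 \<Longrightarrow> cmod ((LINT x|lborel. \<phi> (flow_shift \<Phi> c (t, x)) *\<^sub>R g ((1 / c) *\<^sub>R x))
        - (LINT X|lborel. \<phi> (t, X)) *\<^sub>R (LINT y|torus_measure. g y)) \<le> C * c"
    using slice_integral_estimate[OF \<Phi> \<phi> g] by blast
  obtain Bf where Bf: "\<And>x. cmod (f x) \<le> Bf" "Bf \<ge> 0" using BUC_bounded[OF f] by blast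
  define mg where "mg = (LINT y|torus_measure. g y)"
  define a where "a t = (LINT X|lborel. \<phi> (t, X))" for t
  define ind where "ind t = (indicator {0<..<T} t :: real)" for t
  have ind: "indicator ({0<..<T} \<times> UNIV) p = ind (fst p)" for p :: "real \<times> (real ^ 'd)"
    by (cases p) (auto simp: ind_def indicator_def)
  have indm [measurable]: "ind \<in> borel_measurable borel" unfolding ind_def by simp
  have fm [measurable]: "f \<in> borel_measurable borel" using BUC_continuous[OF f] by (rule borel_measurable_continuous_onI)
  have \<phi>int: "integrable (lborel \<Otimes>\<^sub>M lborel) \<phi>" using lipschitz_test_integrable(1)[OF \<phi>] by (simp add: lborel_prod)
  have \<phi>b: "\<phi> \<in> borel_measurable borel" using lipschitz_test_continuous[OF \<phi>] by (rule borel_measurable_continuous_onI)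
  have aint: "integrable lborel a"
    unfolding a_def using lborel_pair.integrable_fst'[OF \<phi>int] by simp
  have am [measurable]: "a \<in> borel_measurable borel" using aint by auto
  have bda: "integrable lborel (\<lambda>t. ind t *\<^sub>R a t)"
    using aint unfolding ind_def by (intro integrable_mult_indicator) auto
  have time\<phi>: "(LINT p|time_space T. \<phi> p) = (LINT t|lborel. ind t * a t)"
  proof -
    have "integrable (lborel \<Otimes>\<^sub>M lborel) (\<lambda>p. ind (fst p) *\<^sub>R \<phi> p)"
      using lipschitz_test_integrable(2)[OF \<phi>, of T] integral_time_space(2)[OF \<phi>b, of T] by (simp add: lborel_prod ind)
    from lborel_pair.integral_fst'[OF this] show ?thesis
      using integral_time_space(1)[OF \<phi>b, of T] by (simp add: lborel_prod ind a_def)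
  qed
  define I where "I n t = (LINT x|lborel. \<phi> (flow_shift \<Phi> (\<epsilon> n) (t, x)) *\<^sub>R g ((1 / \<epsilon> n) *\<^sub>R x))" for n t
  have W: "(LINT p|time_space T. oscillating_term \<Phi> (\<epsilon> n) \<phi> f g p) = (LINT t|lborel. ind t *\<^sub>R (f (t / \<epsilon> n) * I n t))"
    and Wint: "integrable lborel (\<lambda>t. ind t *\<^sub>R (f (t / \<epsilon> n) * I n t))" for n
  proof -
    have b: "oscillating_term \<Phi> (\<epsilon> n) \<phi> f g \<in> borel_measurable borel"
      by (rule oscillating_term_borel[OF \<Phi> \<phi> f g])
    have i: "integrable (lborel \<Otimes>\<^sub>M lborel) (\<lambda>p. ind (fst p) *\<^sub>R oscillating_term \<Phi> (\<epsilon> n) \<phi> f g p)"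
      using oscillating_term_integrable[OF \<Phi> \<phi> f g, of T "\<epsilon> n"] integral_time_space(2)[OF b, of T]
      by (simp add: lborel_prod ind)
    have sl: "(LINT x|lborel. ind (fst (t, x)) *\<^sub>R oscillating_term \<Phi> (\<epsilon> n) \<phi> f g (t, x)) = ind t *\<^sub>R (f (t / \<epsilon> n) * I n t)" for t
    proof -
      have "ind (fst (t, x)) *\<^sub>R oscillating_term \<Phi> (\<epsilon> n) \<phi> f g (t, x)
          = (ind t *\<^sub>R f (t / \<epsilon> n)) * (\<phi> (flow_shift \<Phi> (\<epsilon> n) (t, x)) *\<^sub>R g ((1 / \<epsilon> n) *\<^sub>R x))" for x
        by (simp add: oscillating_term_def scaleR_conv_of_real mult_ac)
      then have "(LINT x|lborel. ind (fst (t, x)) *\<^sub>R oscillating_term \<Phi> (\<epsilon> n) \<phi> f g (t, x))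
          = (LINT x|lborel. (ind t *\<^sub>R f (t / \<epsilon> n)) * (\<phi> (flow_shift \<Phi> (\<epsilon> n) (t, x)) *\<^sub>R g ((1 / \<epsilon> n) *\<^sub>R x)))"
        by (simp only:)
      also have "\<dots> = (ind t *\<^sub>R f (t / \<epsilon> n)) * I n t"
        unfolding I_def by (rule integral_mult_right_zero)
      finally show ?thesis by simp
    qed
    show "(LINT p|time_space T. oscillating_term \<Phi> (\<epsilon> n) \<phi> f g p) = (LINT t|lborel. ind t *\<^sub>R (f (t / \<epsilon> n) * I n t))"
      using lborel_pair.integral_fst'[OF i] integral_time_space(1)[OF b, of T] unfolding sl by (simp add: lborel_prod ind)
    show "integrable lborel (\<lambda>t. ind t *\<^sub>R (f (t / \<epsilon> n) * I n t))"
      using lborel_pair.integrable_fst'[OF i] unfolding sl .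
  qed
  define \<theta> where "\<theta> t = complex_of_real (ind t * a t) * mg" for t
  have \<theta>int: "integrable lborel \<theta>" unfolding \<theta>_def
    by (rule integrable_mult_left[OF integrable_of_real[OF bda[unfolded real_scaleR_def]]])
  have \<theta>m [measurable]: "\<theta> \<in> borel_measurable borel" using \<theta>int by auto
  have f\<theta>int: "integrable lborel (\<lambda>t. f (t / \<epsilon> n) * \<theta> t)" for n
  proof (rule Bochner_Integration.integrable_bound[OF integrable_mult_right[OF integrable_norm[OF \<theta>int], of Bf]])
    show "AE t in lborel. norm (f (t / \<epsilon> n) * \<theta> t) \<le> norm (Bf * norm (\<theta> t))"
      using Bf by (intro AE_I2) (simp add: norm_mult mult_right_mono)
  qed measurable
  have \<theta>lim: "(\<lambda>n. LINT t|lborel. f (t / \<epsilon> n) * \<theta> t) \<longlonglongrightarrow> (LINT t|lborel. m * \<theta> t)"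
  proof -
    have "integrable lebesgue \<theta>" using \<theta>int by (simp add: integrable_completion)
    then have "(\<lambda>n. LINT t|lebesgue. f (t / \<epsilon> n) * \<theta> t) \<longlonglongrightarrow> (LINT t|lebesgue. m * \<theta> t)"
      using m unfolding has_mean_value_def by blast
    moreover have "(LINT t|lebesgue. f (t / \<epsilon> n) * \<theta> t) = (LINT t|lborel. f (t / \<epsilon> n) * \<theta> t)" for n
      by (rule integral_completion) measurable
    moreover have "(LINT t|lebesgue. m * \<theta> t) = (LINT t|lborel. m * \<theta> t)"
      by (rule integral_completion) measurable
    ultimately show ?thesis by (simp only:)
  qed
  have diff: "cmod ((LINT t|lborel. ind t *\<^sub>R (f (t / \<epsilon> n) * I n t)) - (LINT t|lborel. f (t / \<epsilon> n) * \<theta> t)) \<le> T * (Bf * C * \<epsilon> n)" for n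
  proof -
    have iint: "integrable lborel ind" unfolding ind_def using T by (simp add: integrable_indicator_iff)
    have "cmod ((LINT t|lborel. ind t *\<^sub>R (f (t / \<epsilon> n) * I n t)) - (LINT t|lborel. f (t / \<epsilon> n) * \<theta> t))
        = cmod (LINT t|lborel. ind t *\<^sub>R (f (t / \<epsilon> n) * I n t) - f (t / \<epsilon> n) * \<theta> t)"
      using Wint f\<theta>int by simp
    also have "\<dots> \<le> (LINT t|lborel. cmod (ind t *\<^sub>R (f (t / \<epsilon> n) * I n t) - f (t / \<epsilon> n) * \<theta> t))"
      by (rule integral_norm_bound)
    also have "\<dots> \<le> (LINT t|lborel. ind t * (Bf * C * \<epsilon> n))"
    proof (rule integral_mono)
      show "integrable lborel (\<lambda>t. cmod (ind t *\<^sub>R (f (t / \<epsilon> n) * I n t) - f (t / \<epsilon> n) * \<theta> t))"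
        by (intro integrable_norm Bochner_Integration.integrable_diff Wint f\<theta>int)
      show "integrable lborel (\<lambda>t. ind t * (Bf * C * \<epsilon> n))" using iint by simp
      fix t
      have eq: "ind t *\<^sub>R (f (t / \<epsilon> n) * I n t) - f (t / \<epsilon> n) * \<theta> t = ind t *\<^sub>R (f (t / \<epsilon> n) * (I n t - a t *\<^sub>R mg))"
        by (simp add: \<theta>_def scaleR_conv_of_real algebra_simps)
      have "cmod (f (t / \<epsilon> n)) * cmod (I n t - a t *\<^sub>R mg) \<le> Bf * (C * \<epsilon> n)"
        using Bf C(2)[OF \<epsilon>(1), of n t] by (intro mult_mono) (auto simp: I_def a_def mg_def)
      moreover have "ind t \<ge> 0" by (simp add: ind_def)
      ultimately show "cmod (ind t *\<^sub>R (f (t / \<epsilon> n) * I n t) - f (t / \<epsilon> n) * \<theta> t) \<le> ind t * (Bf * C * \<epsilon> n)"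
        unfolding eq by (simp add: norm_mult mult_left_mono mult.assoc)
    qed
    also have "\<dots> = T * (Bf * C * \<epsilon> n)" using iint T by (simp add: ind_def)
    finally show ?thesis .
  qed
  have "(\<lambda>n. T * (Bf * C * \<epsilon> n)) \<longlonglongrightarrow> T * (Bf * C * 0)" by (intro tendsto_intros \<epsilon>)
  then have "(\<lambda>n. (LINT t|lborel. ind t *\<^sub>R (f (t / \<epsilon> n) * I n t)) - (LINT t|lborel. f (t / \<epsilon> n) * \<theta> t)) \<longlonglongrightarrow> 0"
    by (intro Lim_null_comparison[OF always_eventually[OF allI[OF diff]]]) simp
  from tendsto_add[OF this \<theta>lim]
  have "(\<lambda>n. LINT p|time_space T. oscillating_term \<Phi> (\<epsilon> n) \<phi> f g p) \<longlonglongrightarrow> (LINT t|lborel. m * \<theta> t)"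
    by (simp add: W)
  also have "(LINT t|lborel. m * \<theta> t) = complex_of_real (LINT t|lborel. ind t * a t) * (m * mg)"
  proof -
    have "(LINT t|lborel. m * \<theta> t) = (LINT t|lborel. (m * mg) * complex_of_real (ind t * a t))"
      by (intro Bochner_Integration.integral_cong refl) (simp add: \<theta>_def)
    also have "\<dots> = (m * mg) * (LINT t|lborel. complex_of_real (ind t * a t))"
      by (rule integral_mult_right_zero)
    finally show ?thesis by (simp only: integral_complex_of_real mult.commute)
  qed
  finally show ?thesis by (simp only: time\<phi> mg_def)
qed

lemma limit_term:
  fixes g :: "real ^ 'd \<Rightarrow> complex"
  assumes A: "algebra_with_mean_value \<epsilon> A" and \<beta>: "mean_value_measure \<epsilon> A \<beta>"
    and \<phi>: "\<phi> \<in> lipschitz_tests" and f: "f \<in> A" and g: "g \<in> torus_continuous"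
  defines "G \<equiv> \<lambda>z. complex_of_real (\<phi> (fst z)) * (fst (snd z) f * g (snd (snd z)))"
  shows limit_term_integrable: "integrable (limit_space T \<beta>) G"
    and limit_term_integral: "(LINT z|limit_space T \<beta>. G z)
       = complex_of_real (LINT p|time_space T. \<phi> p) * ((LINT s|\<beta>. s f) * (LINT y|torus_measure. g y))"
proof -
  interpret time: sigma_finite_measure "time_space T :: (real \<times> (real ^ 'd)) measure" by (rule sigma_finite_time_space)
  interpret \<beta>: prob_space \<beta> by (rule mean_value_measure_space[OF \<beta>])
  interpret torus: prob_space "torus_measure :: (real ^ 'd) measure" by (rule prob_space_torus_measure)
  interpret st: pair_prob_space \<beta> "torus_measure :: (real ^ 'd) measure" ..
  interpret whole: pair_sigma_finite "time_space T :: (real \<times> (real ^ 'd)) measure" "\<beta> \<Otimes>\<^sub>M (torus_measure :: (real ^ 'd) measure)" ..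
  obtain Bf where Bf: "\<And>x. cmod (f x) \<le> Bf" "Bf \<ge> 0" using BUC_bounded[OF algebra_BUC[OF A f]] by blast
  obtain Bg where Bg: "\<And>x. cmod (g x) \<le> Bg" "Bg \<ge> 0" using torus_continuous_bounded[OF g] by blast
  have i1: "integrable \<beta> (\<lambda>s. s f)"
  proof (rule \<beta>.integrable_const_bound[of _ Bf])
    show "AE s in \<beta>. norm (s f) \<le> Bf"
      using spectrum_contractive[OF A _ f Bf(1)] by (intro AE_I2) (simp add: mean_value_measure_space[OF \<beta>])
  qed (rule gelfand_measurable[OF \<beta> f])
  have i2: "integrable torus_measure g"
  proof (rule torus.integrable_const_bound[of _ Bg])
    show "g \<in> borel_measurable torus_measure"
      unfolding torus_measure_def using torus_continuous_borel[OF g]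
      by (intro measurable_restrict_space1) (simp add: measurable_completion)
  qed (use Bg in auto)
  have i3: "integrable (time_space T) (\<lambda>p. complex_of_real (\<phi> p))"
    using lipschitz_test_integrable(2)[OF \<phi>] by simp
  note i12 = st.integrable_tensor[OF i1 i2] st.integral_tensor[OF i1 i2]
  note all = whole.integrable_tensor[OF i3 i12(1)] whole.integral_tensor[OF i3 i12(1)]
  have m: "G \<in> borel_measurable (time_space T \<Otimes>\<^sub>M (\<beta> \<Otimes>\<^sub>M torus_measure))"
    using all(1) unfolding G_def by (rule borel_measurable_integrable)
  show "integrable (limit_space T \<beta>) G"
    unfolding limit_space_def using all(1) m by (simp add: integrable_completion G_def)
  show "(LINT z|limit_space T \<beta>. G z)
       = complex_of_real (LINT p|time_space T. \<phi> p) * ((LINT s|\<beta>. s f) * (LINT y|torus_measure. g y))"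
    unfolding limit_space_def using all(2) i12(2) m by (simp add: integral_completion G_def integral_complex_of_real)
qed

section \<open>Sums of test functions and their density in the Bochner space\<close>

text \<open>
A list of triples \<open>(\<phi>, f, g)\<close> from this set stands for the sum of the products \<open>\<phi>(t,X) f(\<tau>) g(y)\<close>. The same list is
interpreted as a function with values in the product algebra, as an oscillating function of \<open>(t,x)\<close>, and as a
function on the limit space; all three interpretations are linear.
\<close>

definition term_set where
  "term_set A = lipschitz_tests \<times> A \<times> torus_continuous"

definition test_sum :: "((real \<times> (real ^ 'd) \<Rightarrow> real) \<times> (real \<Rightarrow> complex) \<times> (real ^ 'd \<Rightarrow> complex)) list \<Rightarrow>
     real \<times> (real ^ 'd) \<Rightarrow> (real \<times> (real ^ 'd)) \<Rightarrow>\<^sub>C complex" where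
  "test_sum xs p = (\<Sum>(\<phi>, f, g)\<leftarrow>xs. \<phi> p *\<^sub>R Bcontfun (\<lambda>q. f (fst q) * g (snd q)))"

definition scale_terms where
  "scale_terms c xs = map (\<lambda>(\<phi>, f, g). (\<phi>, \<lambda>x. c * f x, g)) xs"

lemma tensor_bcontfun:
  fixes g :: "real ^ 'd \<Rightarrow> complex"
  assumes f: "f \<in> BUC" and g: "g \<in> torus_continuous"
  shows "apply_bcontfun (Bcontfun (\<lambda>q. f (fst q) * g (snd q))) q = f (fst q) * g (snd q)"
proof -
  obtain Bf where Bf: "\<And>x. cmod (f x) \<le> Bf" "Bf \<ge> 0" using BUC_bounded[OF f] by blast
  obtain Bg where Bg: "\<And>x. cmod (g x) \<le> Bg" "Bg \<ge> 0" using torus_continuous_bounded[OF g] by blast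
  have gc: "continuous_on UNIV g" using g by (simp add: torus_continuous_def)
  have "(\<lambda>q. f (fst q) * g (snd q)) \<in> bcontfun"
  proof (rule bcontfun_normI)
    show "continuous_on UNIV (\<lambda>q. f (fst q) * g (snd q))"
      by (intro continuous_on_mult continuous_on_compose2[OF BUC_continuous[OF f]] continuous_on_compose2[OF gc] continuous_intros) auto
    show "norm (f (fst q) * g (snd q)) \<le> Bf * Bg" for q
      using Bf Bg by (simp add: norm_mult mult_mono)
  qed
  then show ?thesis by (simp add: Bcontfun_inverse)
qed

lemma scale_terms_in:
  assumes "algebra_with_mean_value \<epsilon> A" "xs \<in> lists (term_set A)"
  shows "scale_terms c xs \<in> lists (term_set A)"
  using assms(2) by (induction xs) (auto simp: scale_terms_def term_set_def algebra_scale[OF assms(1)])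

lemma test_sum_append: "test_sum (xs @ ys) p = test_sum xs p + test_sum ys p"
  by (simp add: test_sum_def)

lemma test_sum_scale:
  assumes A: "algebra_with_mean_value \<epsilon> A" and xs: "xs \<in> lists (term_set A)"
  shows "test_sum (scale_terms (complex_of_real c) xs) p = c *\<^sub>R test_sum xs p"
  using xs
proof (induction xs)
  case (Cons x xs)
  obtain \<phi> f g where x: "x = (\<phi>, f, g)" by (cases x)
  have fg: "f \<in> A" "g \<in> torus_continuous" using Cons.hyps by (auto simp: x term_set_def)
  have "Bcontfun (\<lambda>q. (complex_of_real c * f (fst q)) * g (snd q)) = c *\<^sub>R Bcontfun (\<lambda>q. f (fst q) * g (snd q))"
    using tensor_bcontfun[OF algebra_BUC[OF A algebra_scale[OF A fg(1), of c]] fg(2)]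
      tensor_bcontfun[OF algebra_BUC[OF A fg(1)] fg(2)]
    by (intro bcontfun_eqI) (simp add: scaleR_bcontfun.rep_eq scaleR_conv_of_real)
  with Cons.IH show ?case by (simp add: x test_sum_def scale_terms_def scaleR_right_distrib)
qed (simp add: test_sum_def scale_terms_def)

lemma test_sum_in_product_algebra:
  assumes A: "algebra_with_mean_value \<epsilon> A" and xs: "xs \<in> lists (term_set A)"
  shows "test_sum xs p \<in> product_algebra A"
proof -
  let ?G = "{h. \<exists>f\<in>A. \<exists>g\<in>torus_continuous. \<forall>\<tau> y. apply_bcontfun h (\<tau>, y) = f \<tau> * g y}"
  have "test_sum xs p \<in> span ?G"
    using xs
  proof (induction xs)
    case (Cons x xs)
    obtain \<phi> f g where x: "x = (\<phi>, f, g)" by (cases x)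
    have fg: "f \<in> A" "g \<in> torus_continuous" using Cons.hyps by (auto simp: x term_set_def)
    have "Bcontfun (\<lambda>q. f (fst q) * g (snd q)) \<in> ?G"
      using tensor_bcontfun[OF algebra_BUC[OF A fg(1)] fg(2)] fg by auto
    then show ?case
      using Cons.IH by (simp add: x test_sum_def span_add span_scale span_base)
  qed (simp add: test_sum_def span_zero)
  then show ?thesis unfolding product_algebra_def using closure_subset by blast
qed

text \<open>
A closed subset from inner regularity, intersected with a ball large enough to lose little measure.
\<close>

lemma compact_inside_lebesgue_set:
  fixes S :: "'a :: euclidean_space set"
  assumes S: "S \<in> sets lebesgue" and e: "e > 0"  and fin: "emeasure lebesgue S < \<infinity>"
  obtains K where "compact K" "K \<subseteq> S" "measure lebesgue (S - K) < e"
proof -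
  obtain T where T: "closed T" "T \<subseteq> S" "S - T \<in> lmeasurable" "emeasure lebesgue (S - T) < ennreal (e/2)"
    using sets_lebesgue_inner_closed[OF S, of "e/2"] e by auto
  have Ts: "T \<in> sets lebesgue" using T(1) by auto
  have Tf: "emeasure lebesgue T < \<infinity>"
    using emeasure_mono[OF T(2) S] fin by simp
  define D where "D n = T - cball 0 (real n)" for n :: nat
  have "(\<lambda>n. measure lebesgue (D n)) \<longlonglongrightarrow> measure lebesgue (\<Inter>n. D n)"
  proof (rule Lim_measure_decseq)
    show "range D \<subseteq> sets lebesgue" unfolding D_def using Ts by auto
    show "decseq D" by (auto simp: D_def decseq_def)
    show "emeasure lebesgue (D n) \<noteq> \<infinity>" for n
      using emeasure_mono[of "D n" T lebesgue] Ts Tf by (auto simp: D_def top_unique)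
  qed
  moreover have "(\<Inter>n. D n) = {}"
    using real_arch_simple[of "norm _"] by (fastforce simp: D_def)
  ultimately have "(\<lambda>n. measure lebesgue (D n)) \<longlonglongrightarrow> 0" by simp
  from order_tendstoD(2)[OF this, of "e/2"] e obtain n where n: "measure lebesgue (D n) < e/2"
    by (auto simp: eventually_sequentially)
  show thesis
  proof (rule that[of "T \<inter> cball 0 (real n)"])
    show "compact (T \<inter> cball 0 (real n))" using T(1) by (simp add: closed_Int_compact)
    have Dm: "D n \<in> lmeasurable"
      using emeasure_mono[of "D n" T lebesgue] Ts Tf by (auto simp: D_def fmeasurable_def)
    have "S - T \<inter> cball 0 (real n) = (S - T) \<union> D n" using T(2) by (auto simp: D_def)
    then have "measure lebesgue (S - T \<inter> cball 0 (real n)) \<le> measure lebesgue (S - T) + measure lebesgue (D n)"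
      using measure_Un_le[of "S - T" lebesgue "D n"] T(3) Dm by (simp add: fmeasurableD)
    also have "measure lebesgue (S - T) < e/2"
      using T(3,4) e by (simp add: emeasure_eq_measure2 ennreal_less_iff)
    finally show "measure lebesgue (S - T \<inter> cball 0 (real n)) < e" using n by simp
  qed (use T in auto)
qed

text \<open>
The cut-offs \<open>max 0 (1 - (m + 1) dist(p, K))\<close> decrease to the indicator of \<open>K\<close> and are dominated by the first one,
which has compact support.
\<close>

lemma lipschitz_approximates_compact:
  fixes K :: "(real \<times> (real ^ 'd)) set"
  assumes K: "compact K" and e: "e > 0"
  obtains \<phi> where "\<phi> \<in> lipschitz_tests" "integrable lborel (\<lambda>p. (indicator K p - \<phi> p)\<^sup>2)"
    "(LINT p|lborel. (indicator K p - \<phi> p)\<^sup>2) < e"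
proof (cases "K = {}")
  case True
  have "(\<lambda>_. 0) \<in> lipschitz_tests"
    by (auto simp: lipschitz_tests_def intro!: exI[of _ "0::real"] exI[of _ "{}"] lipschitz_intros)
  with True e show thesis by (intro that[of "\<lambda>_. 0"]) auto
next
  case False
  define \<phi> where "\<phi> m p = max 0 (1 - real (Suc m) * infdist p K)" for m p
  have test: "\<phi> m \<in> lipschitz_tests" for m
  proof -
    have "(real (Suc m))-lipschitz_on UNIV (\<phi> m)"
    proof (rule lipschitz_onI)
      fix p q
      have "\<bar>\<phi> m p - \<phi> m q\<bar> \<le> \<bar>(1 - real (Suc m) * infdist p K) - (1 - real (Suc m) * infdist q K)\<bar>"
        unfolding \<phi>_def by (auto simp: max_def)
      also have "\<dots> = real (Suc m) * \<bar>infdist p K - infdist q K\<bar>"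
      proof -
        have "(1 - real (Suc m) * infdist p K) - (1 - real (Suc m) * infdist q K) = real (Suc m) * (infdist q K - infdist p K)"
          by (simp only: right_diff_distrib)
        then show ?thesis by (simp only: abs_mult abs_of_nat abs_minus_commute[of "infdist q K"])
      qed
      also have "\<dots> \<le> real (Suc m) * dist p q"
        by (intro mult_left_mono infdist_triangle_abs) simp
      finally show "dist (\<phi> m p) (\<phi> m q) \<le> real (Suc m) * dist p q" by (simp add: dist_real_def)
    qed simp
    moreover have "compact {p. infdist p K \<le> 1 / real (Suc m)}"
      by (rule compact_infdist_le[OF False K]) simp
    moreover have "\<phi> m p = 0" if "p \<notin> {p. infdist p K \<le> 1 / real (Suc m)}" for p
      using that by (simp add: \<phi>_def field_simps)
    ultimately show ?thesis unfolding lipschitz_tests_def by blast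
  qed
  have Km: "K \<in> sets lborel" using K by (simp add: borel_compact)
  have phm [measurable]: "\<phi> m \<in> borel_measurable borel" for m
    using lipschitz_test_continuous[OF test] by (rule borel_measurable_continuous_onI)
  have onK: "\<phi> m p = 1" if "p \<in> K" for m p using that by (simp add: \<phi>_def)
  have range: "0 \<le> \<phi> m p" "\<phi> m p \<le> 1" for m p
    using infdist_nonneg[of p K] by (auto simp: \<phi>_def)
  have dom: "(indicator K p - \<phi> m p)\<^sup>2 \<le> \<phi> 0 p" for m p
  proof (cases "p \<in> K")
    case False
    have "(\<phi> m p)\<^sup>2 \<le> \<phi> m p" using range[of m p] by (simp add: power2_eq_square mult_left_le)
    also have "\<dots> \<le> \<phi> 0 p"
    proof -
      have "real (Suc 0) * infdist p K \<le> real (Suc m) * infdist p K"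
        by (intro mult_right_mono infdist_nonneg) simp
      then show ?thesis unfolding \<phi>_def by linarith
    qed
    finally show ?thesis using False by simp
  qed (simp add: onK)
  have lim: "(\<lambda>m. (indicator K p - \<phi> m p)\<^sup>2) \<longlonglongrightarrow> 0" for p
  proof (cases "p \<in> K")
    case False
    then have "infdist p K > 0"
      using in_closed_iff_infdist_zero[OF compact_imp_closed[OF K] \<open>K \<noteq> {}\<close>, of p] infdist_nonneg[of p K] by linarith
    then obtain N where N: "1 < real N * infdist p K" using reals_Archimedean3 by blast
    have "\<phi> m p = 0" if "m \<ge> N" for m
    proof -
      have "real N * infdist p K \<le> real (Suc m) * infdist p K" using that infdist_nonneg by (intro mult_right_mono) auto
      with N show ?thesis by (simp add: \<phi>_def)
    qed
    then have "\<forall>\<^sub>F m in sequentially. (indicator K p - \<phi> m p)\<^sup>2 = 0"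
      using False by (auto simp: eventually_sequentially)
    then show ?thesis by (rule tendsto_eventually)
  qed (simp add: onK)
  have m: "(\<lambda>p. (indicator K p - \<phi> m p)\<^sup>2) \<in> borel_measurable lborel" for m
    using Km by measurable
  have int0: "integrable lborel (\<phi> 0)" by (rule lipschitz_test_integrable(1)[OF test])
  have "(\<lambda>m. LINT p|lborel. (indicator K p - \<phi> m p)\<^sup>2) \<longlonglongrightarrow> (LINT p::real \<times> (real ^ 'd)|lborel. 0)"
    by (rule integral_dominated_convergence[where w = "\<phi> 0"]) (use m int0 lim dom in auto)
  then have "(\<lambda>m. LINT p|lborel. (indicator K p - \<phi> m p)\<^sup>2) \<longlonglongrightarrow> 0" by simp
  from order_tendstoD(2)[OF this e] obtain N where N: "(LINT p|lborel. (indicator K p - \<phi> N p)\<^sup>2) < e"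
    by (auto simp: eventually_sequentially)
  have "integrable lborel (\<lambda>p. (indicator K p - \<phi> N p)\<^sup>2)"
  proof (rule Bochner_Integration.integrable_bound[OF int0 m])
    have "norm ((indicator K p - \<phi> N p)\<^sup>2) \<le> norm (\<phi> 0 p)" for p
      using dom[of p N] range(1)[of 0 p] by simp
    then show "AE p in lborel. norm ((indicator K p - \<phi> N p)\<^sup>2) \<le> norm (\<phi> 0 p)" by simp
  qed
  with N test show thesis by (intro that)
qed

lemma lipschitz_approximates_indicator:
  fixes B :: "(real \<times> (real ^ 'd)) set"
  assumes B: "B \<in> sets (time_space T)" "emeasure (time_space T) B < \<infinity>" and e: "e > 0"
  obtains \<phi> b where "\<phi> \<in> lipschitz_tests" "integrable (time_space T) b"
    "\<And>p. (indicator B p - \<phi> p)\<^sup>2 \<le> b p" "(LINT p|time_space T. b p) < e"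
proof -
  let ?U = "{0<..<T} \<times> UNIV :: (real \<times> (real ^ 'd)) set"
  have U: "?U \<in> sets lebesgue" by (rule time_strip_lebesgue)
  have B': "B \<in> sets lebesgue" "B \<subseteq> ?U"
    using B(1) sets_restrict_space_iff[of ?U lebesgue B] U by (simp_all add: time_space_def)
  have fin: "emeasure lebesgue B < \<infinity>"
    using B(2) B' by (simp add: time_space_def emeasure_restrict_space time_strip_lebesgue)
  obtain K where K: "compact K" "K \<subseteq> B" "measure lebesgue (B - K) < e / 4"
    using compact_inside_lebesgue_set[OF B'(1) _ fin, of "e/4"] e by auto
  obtain \<phi> where \<phi>: "\<phi> \<in> lipschitz_tests" "integrable lborel (\<lambda>p. (indicator K p - \<phi> p)\<^sup>2)"
    "(LINT p|lborel. (indicator K p - \<phi> p)\<^sup>2) < e / 4"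
    using lipschitz_approximates_compact[OF K(1), of "e/4"] e by auto
  \<comment> \<open>A compact subset carries most of the indicator of \<open>B\<close>; the cut-off
    approximates the indicator of this subset.\<close>
  define b where "b p = 2 * indicator (B - K) p + 2 * (indicator K p - \<phi> p)\<^sup>2" for p
  have BK: "B - K \<in> lmeasurable"
  proof (rule fmeasurableI)
    show "B - K \<in> sets lebesgue" using B'(1) K(1) by (intro sets.Diff) (auto simp: borel_compact)
    show "emeasure lebesgue (B - K) < \<infinity>"
      by (rule le_less_trans[OF emeasure_mono fin]) (use B'(1) in auto)
  qed
  have i1: "integrable lebesgue (indicator (B - K) :: _ \<Rightarrow> real)"
    using BK by (intro integrable_real_indicator) (auto simp: fmeasurable_def simp del: emeasure_completion)
  have i2: "integrable lebesgue (\<lambda>p. (indicator K p - \<phi> p)\<^sup>2)"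
    using \<phi>(2) by (subst integrable_completion) auto
  have bint: "integrable lebesgue b" unfolding b_def using i1 i2 by simp
  have b0: "b p \<ge> 0" for p by (simp add: b_def)
  have "(LINT p|lebesgue. b p) = 2 * measure lebesgue (B - K) + 2 * (LINT p|lebesgue. (indicator K p - \<phi> p)\<^sup>2)"
    unfolding b_def using i1 i2 BK by simp
  also have "(LINT p|lebesgue. (indicator K p - \<phi> p)\<^sup>2) = (LINT p|lborel. (indicator K p - \<phi> p)\<^sup>2)"
    using \<phi>(2) by (intro integral_completion) auto
  finally have bl: "(LINT p|lebesgue. b p) < e" using K(3) \<phi>(3) by simp
  have bU: "integrable lebesgue (\<lambda>p. indicator ?U p *\<^sub>R b p)"
    using bint time_strip_lebesgue by (intro integrable_mult_indicator)
  show thesis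
  proof (rule that[OF \<phi>(1)])
    show "integrable (time_space T) b"
      unfolding time_space_def using bU by (subst integrable_restrict_space) (auto simp: time_strip_lebesgue)
    show "(indicator B p - \<phi> p)\<^sup>2 \<le> b p" for p
    proof -
      have "(indicator B p - \<phi> p)\<^sup>2 = (indicator (B - K) p + (indicator K p - \<phi> p))\<^sup>2"
        using K(2) by (auto simp: indicator_def)
      also have "\<dots> \<le> 2 * (indicator (B - K) p)\<^sup>2 + 2 * (indicator K p - \<phi> p)\<^sup>2"
        using sum_squares_bound[of "indicator (B - K) p" "indicator K p - \<phi> p"] by (simp add: power2_sum)
      also have "\<dots> = b p" by (auto simp: b_def indicator_def)
      finally show ?thesis .
    qed
    have "(LINT p|time_space T. b p) = (LINT p|lebesgue. indicator ?U p *\<^sub>R b p)"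
      unfolding time_space_def by (subst integral_restrict_space) (auto simp: time_strip_lebesgue)
    also have "\<dots> \<le> (LINT p|lebesgue. b p)"
      using b0 by (intro integral_mono bU bint) (auto simp: indicator_def)
    finally show "(LINT p|time_space T. b p) < e" using bl by simp
  qed
qed

text \<open>
The error is measured by an integrable majorant \<open>b\<close> of the squared norm: in a non-separable space the norm of a
difference of two functions need not be measurable, but majorants can be added.
\<close>

definition test_approximable ::
    "real \<Rightarrow> (real \<Rightarrow> complex) set \<Rightarrow> (real \<times> (real ^ 'd) \<Rightarrow> (real \<times> (real ^ 'd)) \<Rightarrow>\<^sub>C complex) \<Rightarrow> bool" where
  "test_approximable T A \<psi> \<longleftrightarrow>
     (\<forall>\<delta>>0. \<exists>xs\<in>lists (term_set A). \<exists>b. integrable (time_space T) b \<and>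
        (AE p in time_space T. (norm (\<psi> p - test_sum xs p))\<^sup>2 \<le> b p) \<and> (LINT p|time_space T. b p) < \<delta>)"

lemma test_approximableE:
  assumes "test_approximable T A \<psi>" "\<delta> > 0"
  obtains xs b where "xs \<in> lists (term_set A)" "integrable (time_space T) b"
    "AE p in time_space T. (norm (\<psi> p - test_sum xs p))\<^sup>2 \<le> b p" "(LINT p|time_space T. b p) < \<delta>"
  using assms unfolding test_approximable_def by blast

lemma test_approximable_limit:
  assumes "\<And>\<delta>. \<delta> > 0 \<Longrightarrow> \<exists>\<xi> b. test_approximable T A \<xi> \<and> integrable (time_space T) b \<and>
        (AE p in time_space T. (norm (\<psi> p - \<xi> p))\<^sup>2 \<le> b p) \<and> (LINT p|time_space T. b p) < \<delta>"
  shows "test_approximable T A \<psi>"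
  unfolding test_approximable_def
proof (intro allI impI)
  fix \<delta> :: real assume "\<delta> > 0"
  then have \<delta>: "\<delta> / 4 > 0" by simp
  from assms[OF \<delta>] obtain \<xi> b where 1: "test_approximable T A \<xi>" "integrable (time_space T) b"
        "AE p in time_space T. (norm (\<psi> p - \<xi> p))\<^sup>2 \<le> b p" "(LINT p|time_space T. b p) < \<delta> / 4"
    by blast
  from test_approximableE[OF 1(1) \<delta>] obtain xs b' where 2: "xs \<in> lists (term_set A)" "integrable (time_space T) b'"
    "AE p in time_space T. (norm (\<xi> p - test_sum xs p))\<^sup>2 \<le> b' p" "(LINT p|time_space T. b' p) < \<delta> / 4" .
  show "\<exists>xs\<in>lists (term_set A). \<exists>b. integrable (time_space T) b \<and>
        (AE p in time_space T. (norm (\<psi> p - test_sum xs p))\<^sup>2 \<le> b p) \<and> (LINT p|time_space T. b p) < \<delta>"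
  proof (intro bexI[OF _ 2(1)] exI[of _ "\<lambda>p. 2 * b p + 2 * b' p"] conjI)
    show "AE p in time_space T. (norm (\<psi> p - test_sum xs p))\<^sup>2 \<le> 2 * b p + 2 * b' p"
      using 1(3) 2(3)
    proof eventually_elim
      case (elim p)
      have "\<psi> p - test_sum xs p = (\<psi> p - \<xi> p) + (\<xi> p - test_sum xs p)" by simp
      then show ?case
        using norm_add_square_le[of "\<psi> p - \<xi> p" "\<xi> p - test_sum xs p"] elim by simp
    qed
  qed (use 1(2,4) 2(2,4) in auto)
qed

lemma test_approximable_test_sum:
  assumes "xs \<in> lists (term_set A)"
  shows "test_approximable T A (test_sum xs)"
  unfolding test_approximable_def
  using assms by (auto intro!: bexI[of _ xs] exI[of _ "\<lambda>_. 0"])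

lemma test_approximable_zero: "test_approximable T A (\<lambda>p. 0)"
  using test_approximable_test_sum[of "[]" A T] by (simp add: test_sum_def[abs_def])

lemma test_approximable_add:
  assumes "test_approximable T A \<psi>" "test_approximable T A \<xi>"
  shows "test_approximable T A (\<lambda>p. \<psi> p + \<xi> p)"
  unfolding test_approximable_def
proof (intro allI impI)
  fix \<delta> :: real assume "\<delta> > 0"
  then have \<delta>: "\<delta> / 4 > 0" by simp
  from test_approximableE[OF assms(1) \<delta>] obtain xs b where 1: "xs \<in> lists (term_set A)" "integrable (time_space T) b"
    "AE p in time_space T. (norm (\<psi> p - test_sum xs p))\<^sup>2 \<le> b p" "(LINT p|time_space T. b p) < \<delta> / 4" .
  from test_approximableE[OF assms(2) \<delta>] obtain ys b' where 2: "ys \<in> lists (term_set A)" "integrable (time_space T) b'"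
    "AE p in time_space T. (norm (\<xi> p - test_sum ys p))\<^sup>2 \<le> b' p" "(LINT p|time_space T. b' p) < \<delta> / 4" .
  show "\<exists>xs\<in>lists (term_set A). \<exists>b. integrable (time_space T) b \<and>
        (AE p in time_space T. (norm (\<psi> p + \<xi> p - test_sum xs p))\<^sup>2 \<le> b p) \<and> (LINT p|time_space T. b p) < \<delta>"
  proof (intro bexI[of _ "xs @ ys"] exI[of _ "\<lambda>p. 2 * b p + 2 * b' p"] conjI)
    show "AE p in time_space T. (norm (\<psi> p + \<xi> p - test_sum (xs @ ys) p))\<^sup>2 \<le> 2 * b p + 2 * b' p"
      using 1(3) 2(3)
    proof eventually_elim
      case (elim p)
      have "\<psi> p + \<xi> p - test_sum (xs @ ys) p = (\<psi> p - test_sum xs p) + (\<xi> p - test_sum ys p)"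
        by (simp add: test_sum_append)
      then show ?case
        using norm_add_square_le[of "\<psi> p - test_sum xs p" "\<xi> p - test_sum ys p"] elim by (simp only:)
    qed
  qed (use 1 2 in auto)
qed

lemma test_approximable_scale:
  assumes A: "algebra_with_mean_value \<epsilon> A" and \<psi>: "test_approximable T A \<psi>"
  shows "test_approximable T A (\<lambda>p. c *\<^sub>R \<psi> p)"
  unfolding test_approximable_def
proof (intro allI impI)
  fix \<delta> :: real assume \<delta>: "\<delta> > 0"
  \<comment> \<open>The summand 1 keeps the factor positive for \<open>c = 0\<close>.\<close>
  have pos: "c\<^sup>2 + 1 > 0" using zero_le_power2[of c] by linarith
  then have \<delta>': "\<delta> / (c\<^sup>2 + 1) > 0" using \<delta> by simp
  from test_approximableE[OF \<psi> \<delta>'] obtain xs b where 1: "xs \<in> lists (term_set A)" "integrable (time_space T) b"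
    "AE p in time_space T. (norm (\<psi> p - test_sum xs p))\<^sup>2 \<le> b p" "(LINT p|time_space T. b p) < \<delta> / (c\<^sup>2 + 1)" .
  show "\<exists>xs\<in>lists (term_set A). \<exists>b. integrable (time_space T) b \<and>
        (AE p in time_space T. (norm (c *\<^sub>R \<psi> p - test_sum xs p))\<^sup>2 \<le> b p) \<and> (LINT p|time_space T. b p) < \<delta>"
  proof (intro bexI[of _ "scale_terms (complex_of_real c) xs"] exI[of _ "\<lambda>p. (c\<^sup>2 + 1) * b p"] conjI)
    show "scale_terms (complex_of_real c) xs \<in> lists (term_set A)" by (rule scale_terms_in[OF A 1(1)])
    show "AE p in time_space T. (norm (c *\<^sub>R \<psi> p - test_sum (scale_terms (complex_of_real c) xs) p))\<^sup>2 \<le> (c\<^sup>2 + 1) * b p"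
      using 1(3)
    proof eventually_elim
      case (elim p)
      have "c *\<^sub>R \<psi> p - test_sum (scale_terms (complex_of_real c) xs) p = c *\<^sub>R (\<psi> p - test_sum xs p)"
        by (simp add: test_sum_scale[OF A 1(1)] scaleR_right_diff_distrib)
      then have "(norm (c *\<^sub>R \<psi> p - test_sum (scale_terms (complex_of_real c) xs) p))\<^sup>2 = c\<^sup>2 * (norm (\<psi> p - test_sum xs p))\<^sup>2"
        by (simp add: power_mult_distrib)
      also have "\<dots> \<le> (c\<^sup>2 + 1) * b p"
        using elim by (intro mult_mono) auto
      finally show ?case .
    qed
    show "(LINT p|time_space T. (c\<^sup>2 + 1) * b p) < \<delta>"
      using 1(4) pos unfolding integral_mult_right_zero by (simp add: field_simps)
  qed (use 1 in auto)
qed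

lemma test_approximable_indicator_generator:
  fixes h :: "(real \<times> (real ^ 'd)) \<Rightarrow>\<^sub>C complex"
  assumes A: "algebra_with_mean_value \<epsilon> A" and B: "B \<in> sets (time_space T)" "emeasure (time_space T) B < \<infinity>"
    and fg: "f \<in> A" "g \<in> torus_continuous" "\<And>\<tau> y. apply_bcontfun h (\<tau>, y) = f \<tau> * g y"
  shows "test_approximable T A (\<lambda>p. indicator B p *\<^sub>R h)"
proof (rule test_approximable_limit)
  fix \<delta> :: real assume \<delta>: "\<delta> > 0"
  have pos: "(norm h)\<^sup>2 + 1 > 0" using zero_le_power2[of "norm h"] by linarith
  have h: "Bcontfun (\<lambda>q. f (fst q) * g (snd q)) = h"
    using tensor_bcontfun[OF algebra_BUC[OF A fg(1)] fg(2)] fg(3) by (intro bcontfun_eqI) auto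
  obtain \<phi> b where \<phi>: "\<phi> \<in> lipschitz_tests" "integrable (time_space T) b"
    "\<And>p. (indicator B p - \<phi> p)\<^sup>2 \<le> b p" "(LINT p|time_space T. b p) < \<delta> / ((norm h)\<^sup>2 + 1)"
    using lipschitz_approximates_indicator[OF B, of "\<delta> / ((norm h)\<^sup>2 + 1)"] \<delta> pos by auto
  show "\<exists>\<xi> b. test_approximable T A \<xi> \<and> integrable (time_space T) b \<and>
        (AE p in time_space T. (norm (indicator B p *\<^sub>R h - \<xi> p))\<^sup>2 \<le> b p) \<and> (LINT p|time_space T. b p) < \<delta>"
  proof (intro exI[of _ "test_sum [(\<phi>, f, g)]"] exI[of _ "\<lambda>p. ((norm h)\<^sup>2 + 1) * b p"] conjI AE_I2)
    show "test_approximable T A (test_sum [(\<phi>, f, g)])"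
      using \<phi>(1) fg by (intro test_approximable_test_sum) (simp add: term_set_def)
    fix p
    have "indicator B p *\<^sub>R h - test_sum [(\<phi>, f, g)] p = (indicator B p - \<phi> p) *\<^sub>R h"
      by (simp add: test_sum_def h scaleR_left_diff_distrib)
    then have "(norm (indicator B p *\<^sub>R h - test_sum [(\<phi>, f, g)] p))\<^sup>2 = (norm h)\<^sup>2 * (indicator B p - \<phi> p)\<^sup>2"
      by (simp add: power_mult_distrib)
    also have "\<dots> \<le> ((norm h)\<^sup>2 + 1) * b p"
      using \<phi>(3)[of p] by (intro mult_mono) auto
    finally show "(norm (indicator B p *\<^sub>R h - test_sum [(\<phi>, f, g)] p))\<^sup>2 \<le> ((norm h)\<^sup>2 + 1) * b p" .
  next
    show "(LINT p|time_space T. ((norm h)\<^sup>2 + 1) * b p) < \<delta>"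
      using \<phi>(4) pos unfolding integral_mult_right_zero by (simp add: field_simps)
  qed (use \<phi> in auto)
qed

text \<open>
The generators of the product algebra give the claim on their span; elements of the closure are reached because
the indicator has finite integral.
\<close>

lemma test_approximable_indicator:
  fixes h :: "(real \<times> (real ^ 'd)) \<Rightarrow>\<^sub>C complex"
  assumes A: "algebra_with_mean_value \<epsilon> A" and B: "B \<in> sets (time_space T)" "emeasure (time_space T) B < \<infinity>"
    and h: "h \<in> product_algebra A"
  shows "test_approximable T A (\<lambda>p. indicator B p *\<^sub>R h)"
proof -
  let ?G = "{h :: (real \<times> (real ^ 'd)) \<Rightarrow>\<^sub>C complex. \<exists>f\<in>A. \<exists>g\<in>torus_continuous. \<forall>\<tau> y. apply_bcontfun h (\<tau>, y) = f \<tau> * g y}"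
  have span: "test_approximable T A (\<lambda>p. indicator B p *\<^sub>R h)" if "h \<in> span ?G" for h
  proof (rule span_induct[OF that, where P = "\<lambda>h. test_approximable T A (\<lambda>p. indicator B p *\<^sub>R h)"])
    show "subspace {h. test_approximable T A (\<lambda>p. indicator B p *\<^sub>R h)}"
      unfolding subspace_def
      using test_approximable_zero[of T A] test_approximable_add[of T A "\<lambda>p. indicator B p *\<^sub>R _" "\<lambda>p. indicator B p *\<^sub>R _"]
        test_approximable_scale[OF A, of T "\<lambda>p. indicator B p *\<^sub>R _"]
      by (auto simp: scaleR_right_distrib mult.commute)
    show "test_approximable T A (\<lambda>p. indicator B p *\<^sub>R h)" if "h \<in> ?G" for h
      using that test_approximable_indicator_generator[OF A B] by blast
  qed
  have iB: "integrable (time_space T) (indicator B :: _ \<Rightarrow> real)"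
    using B by (rule integrable_real_indicator)
  show ?thesis
  proof (rule test_approximable_limit)
    fix \<delta> :: real assume \<delta>: "\<delta> > 0"
    define \<mu> where "\<mu> = measure (time_space T) B"
    have \<mu>: "\<mu> \<ge> 0" by (simp add: \<mu>_def)
    define e where "e = sqrt (\<delta> / (\<mu> + 1))"
    have e: "e > 0" "e\<^sup>2 = \<delta> / (\<mu> + 1)" using \<delta> \<mu> by (auto simp: e_def)
    obtain h' where h': "h' \<in> span ?G" "dist h' h < e"
      using h e(1) unfolding product_algebra_def closure_approachable by blast
    show "\<exists>\<xi> b. test_approximable T A \<xi> \<and> integrable (time_space T) b \<and>
        (AE p in time_space T. (norm (indicator B p *\<^sub>R h - \<xi> p))\<^sup>2 \<le> b p) \<and> (LINT p|time_space T. b p) < \<delta>"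
    proof (intro exI[of _ "\<lambda>p. indicator B p *\<^sub>R h'"] exI[of _ "\<lambda>p. e\<^sup>2 * indicator B p"] conjI AE_I2)
      fix p
      have "norm (h - h') \<le> e" using h'(2) by (simp add: dist_norm norm_minus_commute)
      then have "(norm (h - h'))\<^sup>2 \<le> e\<^sup>2" by (simp add: power_mono)
      then show "(norm (indicator B p *\<^sub>R h - indicator B p *\<^sub>R h'))\<^sup>2 \<le> e\<^sup>2 * indicator B p"
        by (auto simp: indicator_def)
    next
      have "(LINT p|time_space T. e\<^sup>2 * indicator B p) = e\<^sup>2 * \<mu>"
        using B sets.sets_into_space[OF B(1)] by (simp add: \<mu>_def Int_absorb1 Int_absorb2)
      also have "\<dots> < \<delta>" using \<delta> \<mu> by (simp add: e(2) field_simps)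
      finally show "(LINT p|time_space T. e\<^sup>2 * indicator B p) < \<delta>" .
    qed (use span[OF h'(1)] iB in auto)
  qed
qed

lemma test_approximable_sum:
  assumes "finite H" "\<And>h. h \<in> H \<Longrightarrow> test_approximable T A (\<psi> h)"
  shows "test_approximable T A (\<lambda>p. \<Sum>h\<in>H. \<psi> h p)"
  using assms by (induction H) (auto intro: test_approximable_zero test_approximable_add)

lemma borel_measurable_complete_AE:
  fixes f g :: "'a \<Rightarrow> 'b :: {second_countable_topology, t2_space}"
  assumes M: "complete_measure M" and g: "g \<in> borel_measurable M" and ae: "AE x in M. f x = g x"
  shows "f \<in> borel_measurable M"
proof (rule measurableI)
  interpret complete_measure M by (rule M)
  fix U :: "'b set" assume U: "U \<in> sets borel"
  obtain N where N: "{x \<in> space M. f x \<noteq> g x} \<subseteq> N" "emeasure M N = 0" "N \<in> sets M"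
    using AE_E[OF ae] by blast
  have sub: "C \<in> sets M" if "C \<subseteq> {x \<in> space M. f x \<noteq> g x}" for C
    using complete[of C N] that N by (auto simp: null_sets_def)
  have "f -` U \<inter> space M = ((g -` U \<inter> space M) - (g -` U \<inter> {x \<in> space M. f x \<noteq> g x})) \<union> (f -` U \<inter> {x \<in> space M. f x \<noteq> g x})"
    by auto
  also have "\<dots> \<in> sets M"
    by (intro sets.Un sets.Diff measurable_sets[OF g U] sub) auto
  finally show "f -` U \<inter> space M \<in> sets M" .
qed simp

lemma complete_measure_time_space: "complete_measure (time_space T :: (real \<times> (real ^ 'd)) measure)"
proof
  fix C N :: "(real \<times> (real ^ 'd)) set" assume "C \<subseteq> N" "N \<in> null_sets (time_space T)"
  then show "C \<in> sets (time_space T)"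
    unfolding time_space_def null_sets_restrict_space[OF time_strip_lebesgue]
    using completion.complete[of C N lborel] by (auto simp: sets_restrict_space_iff time_strip_lebesgue)
qed

text \<open>
Truncate the approximating simple functions where their norm exceeds twice that of \<open>\<psi>\<close>. The truncations still
converge almost everywhere, are dominated by a multiple of \<open>\<parallel>\<psi>\<parallel>\<close>, and take each nonzero value on a set of finite
measure.
\<close>

lemma bochner_L2_test_approximable:
  fixes \<psi> :: "real \<times> (real ^ 'd) \<Rightarrow> (real \<times> (real ^ 'd)) \<Rightarrow>\<^sub>C complex"
  assumes A: "algebra_with_mean_value \<epsilon> A" and \<psi>: "\<psi> \<in> bochner_L2 (time_space T) (product_algebra A)"
  shows "test_approximable T A \<psi>"
proof (rule test_approximable_limit)
  let ?M = "time_space T :: (real \<times> (real ^ 'd)) measure"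
  fix \<delta> :: real assume \<delta>: "\<delta> > 0"
  define N where "N p = norm (\<psi> p)" for p
  have N2: "integrable ?M (\<lambda>p. (N p)\<^sup>2)" using \<psi> by (simp add: bochner_L2_def N_def)
  then have "(\<lambda>p. sqrt ((N p)\<^sup>2)) \<in> borel_measurable ?M" by measurable
  then have Nm [measurable]: "N \<in> borel_measurable ?M" by (simp add: N_def[abs_def])
  obtain s where s: "\<And>i. simple_function ?M (s i)" "\<And>i p. p \<in> space ?M \<Longrightarrow> s i p \<in> product_algebra A"
    and lim: "AE p in ?M. (\<lambda>i. s i p) \<longlonglongrightarrow> \<psi> p"
    using \<psi> unfolding bochner_L2_def strongly_measurable_def by blast
  have norm_s [measurable]: "(\<lambda>p. norm (s i p)) \<in> borel_measurable ?M" for i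
    using simple_function_compose1[OF s(1), of norm i] by (rule borel_measurable_simple_function)
  define s' where "s' i p = (if norm (s i p) \<le> 2 * N p then s i p else 0)" for i p
  have s': "simple_function ?M (s' i)" for i
    unfolding s'_def by (intro simple_function_If s(1) simple_function_const) measurable
  have s'_le: "norm (s' i p) \<le> 2 * N p" for i p by (simp add: s'_def N_def)
  have lim': "AE p in ?M. (\<lambda>i. s' i p) \<longlonglongrightarrow> \<psi> p"
    using lim
  proof eventually_elim
    case (elim p)
    show ?case
    proof (cases "\<psi> p = 0")
      case True
      then have "s' i p = 0" for i by (auto simp: s'_def N_def)
      then show ?thesis using True by simp
    next
      case False
      then have "norm (\<psi> p) < 2 * N p" by (simp add: N_def)
      from order_tendstoD(2)[OF tendsto_norm[OF elim] this]
      have "\<forall>\<^sub>F i in sequentially. s' i p = s i p" by eventually_elim (simp add: s'_def)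
      then show ?thesis using elim by (simp cong: tendsto_cong)
    qed
  qed
  define b where "b i p = (norm (\<psi> p - s' i p))\<^sup>2" for i p
  \<comment> \<open>Measurable as an almost everywhere limit of the norms of differences of two simple
    functions.\<close>
  have bm [measurable]: "b i \<in> borel_measurable ?M" for i
  proof (rule borel_measurable_complete_AE[OF complete_measure_time_space])
    have m [measurable]: "(\<lambda>p. (norm (s' j p - s' i p))\<^sup>2) \<in> borel_measurable ?M" for j
      using simple_function_compose2[OF s' s', of "\<lambda>x y. (norm (x - y))\<^sup>2" j i] by (rule borel_measurable_simple_function)
    show "(\<lambda>p. lim (\<lambda>j. (norm (s' j p - s' i p))\<^sup>2)) \<in> borel_measurable ?M" by measurable
    show "AE p in ?M. b i p = lim (\<lambda>j. (norm (s' j p - s' i p))\<^sup>2)"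
      using lim'
    proof eventually_elim
      case (elim p)
      have "(\<lambda>j. (norm (s' j p - s' i p))\<^sup>2) \<longlonglongrightarrow> b i p" unfolding b_def by (intro tendsto_intros elim)
      then show ?case by (simp add: limI)
    qed
  qed
  have b_le: "b i p \<le> 9 * (N p)\<^sup>2" for i p
  proof -
    have "norm (\<psi> p - s' i p) \<le> N p + 2 * N p"
      using norm_triangle_ineq4[of "\<psi> p" "s' i p"] s'_le[of i p] by (simp add: N_def)
    then have "(norm (\<psi> p - s' i p))\<^sup>2 \<le> (3 * N p)\<^sup>2" by (intro power_mono) auto
    then show ?thesis by (simp add: b_def power_mult_distrib)
  qed
  have b0: "0 \<le> b i p" for i p by (simp add: b_def)
  have dom: "integrable ?M (\<lambda>p. 9 * (N p)\<^sup>2)" using N2 by simp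
  have bint: "integrable ?M (b i)" for i
    by (rule Bochner_Integration.integrable_bound[OF dom bm]) (use b_le b0 in \<open>auto intro!: AE_I2\<close>)
  have "(\<lambda>i. LINT p|?M. b i p) \<longlonglongrightarrow> (LINT p|?M. 0)"
  proof (rule integral_dominated_convergence[where w = "\<lambda>p. 9 * (N p)\<^sup>2"])
    show "AE p in ?M. (\<lambda>i. b i p) \<longlonglongrightarrow> 0"
      using lim'
    proof eventually_elim
      case (elim p)
      have "(\<lambda>i. (norm (\<psi> p - s' i p))\<^sup>2) \<longlonglongrightarrow> (norm (\<psi> p - \<psi> p))\<^sup>2" by (intro tendsto_intros elim)
      then show ?case by (simp add: b_def)
    qed
    show "AE p in ?M. norm (b i p) \<le> 9 * (N p)\<^sup>2" for i using b_le b0 by (intro AE_I2) simp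
  qed (use dom in auto)
  then have "(\<lambda>i. LINT p|?M. b i p) \<longlonglongrightarrow> 0" by simp
  from order_tendstoD(2)[OF this \<delta>] obtain i where i: "(LINT p|?M. b i p) < \<delta>"
    by (auto simp: eventually_sequentially)
  define H where "H = s' i ` space ?M - {0}"
  define S where "S h = {p \<in> space ?M. s' i p = h}" for h
  have H: "finite H" using s'[of i] by (simp add: H_def simple_function_def)
  have "test_approximable T A (\<lambda>p. \<Sum>h\<in>H. indicator (S h) p *\<^sub>R h)"
  proof (rule test_approximable_sum[OF H])
    fix h assume h: "h \<in> H"
    then obtain p where p: "p \<in> space ?M" "h = s' i p" "h \<noteq> 0" by (auto simp: H_def)
    then have "h = s i p" by (auto simp: s'_def split: if_splits)
    then have hP: "h \<in> product_algebra A" using s(2) p(1) by simp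
    have "S h = s' i -` {h} \<inter> space ?M" by (auto simp: S_def)
    then have Sm: "S h \<in> sets ?M" using simple_functionD(2)[OF s'[of i]] by simp
    have "integrable ?M (indicator (S h) :: _ \<Rightarrow> real)"
    proof (rule Bochner_Integration.integrable_bound)
      show "integrable ?M (\<lambda>p. 4 / (norm h)\<^sup>2 * (N p)\<^sup>2)" using N2 by simp
      show "AE p in ?M. norm (indicator (S h) p :: real) \<le> norm (4 / (norm h)\<^sup>2 * (N p)\<^sup>2)"
      proof (rule AE_I2)
        fix q assume "q \<in> space ?M"
        show "norm (indicator (S h) q :: real) \<le> norm (4 / (norm h)\<^sup>2 * (N q)\<^sup>2)"
        proof (cases "q \<in> S h")
          case True
          then have "norm h \<le> 2 * N q" using s'_le[of i q] by (simp add: S_def)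
          then have "(norm h)\<^sup>2 \<le> (2 * N q)\<^sup>2" by (intro power_mono) auto
          then show ?thesis using True p(3) by (simp add: field_simps power_mult_distrib)
        qed simp
      qed
    qed (use Sm in measurable)
    then have "emeasure ?M (S h) < \<infinity>" using Sm sets.sets_into_space[OF Sm] by (simp add: integrable_indicator_iff Int_absorb2)
    from test_approximable_indicator[OF A Sm this hP] show "test_approximable T A (\<lambda>p. indicator (S h) p *\<^sub>R h)" .
  qed
  moreover have "(\<Sum>h\<in>H. indicator (S h) p *\<^sub>R h) = s' i p" if p: "p \<in> space ?M" for p
  proof -
    have "(\<Sum>h\<in>H. indicator (S h) p *\<^sub>R h) = (\<Sum>h\<in>H. if h = s' i p then s' i p else 0)"
      using p by (intro sum.cong) (auto simp: S_def indicator_def)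
    also have "\<dots> = s' i p" using H p by (simp add: sum.delta H_def)
    finally show ?thesis .
  qed
  ultimately show "\<exists>\<xi> b. test_approximable T A \<xi> \<and> integrable ?M b \<and>
        (AE p in ?M. (norm (\<psi> p - \<xi> p))\<^sup>2 \<le> b p) \<and> (LINT p|?M. b p) < \<delta>"
    using bint[of i] i by (intro exI[of _ "\<lambda>p. \<Sum>h\<in>H. indicator (S h) p *\<^sub>R h"] exI[of _ "b i"])
      (auto simp: b_def intro!: AE_I2)
qed

lemma AE_tendsto_zero_of_fast_integrals:
  fixes b :: "nat \<Rightarrow> 'a \<Rightarrow> real"
  assumes int: "\<And>k. integrable M (b k)" and nonneg: "\<And>k. AE x in M. 0 \<le> b k x"
    and fast: "\<And>k. (LINT x|M. b k x) \<le> (1/2) ^ k"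
  shows "AE x in M. (\<lambda>k. b k x) \<longlonglongrightarrow> 0"
proof -
  have [measurable]: "b k \<in> borel_measurable M" for k using int by auto
  have "(\<integral>\<^sup>+x. (\<Sum>k. ennreal (b k x)) \<partial>M) = (\<Sum>k. \<integral>\<^sup>+x. ennreal (b k x) \<partial>M)"
    by (intro nn_integral_suminf) auto
  also have "\<dots> \<le> (\<Sum>k. ennreal ((1/2) ^ k))"
    by (intro suminf_le) (auto simp: nn_integral_eq_integral[OF int nonneg] intro!: ennreal_leI fast)
  also have "\<dots> = ennreal (\<Sum>k. (1/2) ^ k)"
    by (intro suminf_ennreal2) (auto intro!: summable_geometric)
  also have "\<dots> < \<infinity>" by simp
  finally have "AE x in M. (\<Sum>k. ennreal (b k x)) \<noteq> \<infinity>"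
    by (intro nn_integral_noteq_infinite) auto
  moreover have "AE x in M. \<forall>k. 0 \<le> b k x" using nonneg by (simp add: AE_all_countable)
  ultimately show ?thesis
  proof eventually_elim
    case (elim x)
    then have "summable (\<lambda>k. b k x)" by (intro summable_suminf_not_top) auto
    then show ?case by (rule summable_LIMSEQ_zero)
  qed
qed

text \<open>
The majorants tend to zero almost everywhere, so \<open>F\<close> is an almost everywhere limit of measurable functions and
therefore measurable on a complete measure space. This yields measurability for compositions such as
\<open>w\<^sub>n(\<psi>)\<close> and for Gelfand transforms without treating them separately.
\<close>

lemma square_integrable_approximation:
  fixes F :: "'a \<Rightarrow> complex"
  assumes M: "complete_measure M" and sq: "\<And>k. square_integrable M (G k)" and int: "\<And>k. integrable M (b k)"
    and le: "\<And>k. AE x in M. (cmod (F x - G k x))\<^sup>2 \<le> b k x" and fast: "\<And>k. (LINT x|M. b k x) \<le> (1/2) ^ k"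
  shows "square_integrable M F" "\<And>k. (LINT x|M. (cmod (F x - G k x))\<^sup>2) \<le> (1/2) ^ k"
proof -
  have [measurable]: "G k \<in> borel_measurable M" for k using sq by (simp add: square_integrable_def)
  have "AE x in M. 0 \<le> b k x" for k
    using le[of k] by eventually_elim (meson order_trans zero_le_power2)
  note tend = AE_tendsto_zero_of_fast_integrals[OF int this fast]
  have "AE x in M. \<forall>k. (cmod (F x - G k x))\<^sup>2 \<le> b k x" using le by (simp add: AE_all_countable)
  with tend have lim: "AE x in M. (\<lambda>k. G k x) \<longlonglongrightarrow> F x"
  proof eventually_elim
    case (elim x)
    have "(\<lambda>k. (cmod (F x - G k x))\<^sup>2) \<longlonglongrightarrow> 0"
      by (rule tendsto_sandwich[OF _ _ tendsto_const elim(1)]) (use elim(2) in auto)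
    then have "(\<lambda>k. sqrt ((cmod (F x - G k x))\<^sup>2)) \<longlonglongrightarrow> sqrt 0" by (rule tendsto_real_sqrt)
    then have "(\<lambda>k. F x - G k x) \<longlonglongrightarrow> 0" by (simp add: tendsto_norm_zero_iff)
    then have "(\<lambda>k. F x - (F x - G k x)) \<longlonglongrightarrow> F x - 0" by (intro tendsto_diff tendsto_const)
    then show ?case by simp
  qed
  have Fm [measurable]: "F \<in> borel_measurable M"
  proof (rule borel_measurable_complete_AE[OF M])
    show "(\<lambda>x. lim (\<lambda>k. G k x)) \<in> borel_measurable M" by measurable
    show "AE x in M. F x = lim (\<lambda>k. G k x)" using lim by eventually_elim (simp add: limI)
  qed
  have dint: "integrable M (\<lambda>x. (cmod (F x - G k x))\<^sup>2)" for k
  proof (rule Bochner_Integration.integrable_bound[OF int])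
    show "AE x in M. norm ((cmod (F x - G k x))\<^sup>2) \<le> norm (b k x)"
      using le[of k] by eventually_elim auto
  qed measurable
  have "square_integrable M (\<lambda>x. F x - G 0 x)" using dint[of 0] by (simp add: square_integrable_def)
  from square_integrable_add[OF this sq[of 0]] show "square_integrable M F" by simp
  show "(LINT x|M. (cmod (F x - G k x))\<^sup>2) \<le> (1/2) ^ k" for k
    using integral_mono_AE[OF dint int le, of k] fast[of k] by simp
qed

lemma tendsto_integral_of_approximation:
  fixes L :: "nat \<Rightarrow> complex"
  assumes conv: "\<And>k. (\<lambda>n. LL k n) \<longlonglongrightarrow> l k"
    and d: "\<And>k n. cmod (L n - LL k n) \<le> d k" "\<And>k. cmod (l' - l k) \<le> d k" "d \<longlonglongrightarrow> 0"
  shows "L \<longlonglongrightarrow> l'"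
proof (rule tendstoI)
  fix e :: real assume "e > 0"
  then have e: "e / 3 > 0" by simp
  from order_tendstoD(2)[OF d(3) e] obtain k where k: "d k < e / 3" by (auto simp: eventually_sequentially)
  from tendstoD[OF conv[of k] e] show "\<forall>\<^sub>F n in sequentially. dist (L n) l' < e"
  proof eventually_elim
    case (elim n)
    have "dist (L n) l' \<le> dist (L n) (LL k n) + dist (LL k n) (l k) + dist (l k) l'"
      using dist_triangle[of "L n" l' "LL k n"] dist_triangle[of "LL k n" l' "l k"] by simp
    then show ?case using elim k d(1)[of n k] d(2)[of k] by (simp add: dist_norm norm_minus_commute)
  qed
qed

section \<open>Squared norms of test sums\<close>

definition oscillating_sum where
  "oscillating_sum \<Phi> c xs p = (\<Sum>(\<phi>, f, g)\<leftarrow>xs. oscillating_term \<Phi> c \<phi> f g p)"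

definition limit_sum ::
    "((real \<times> (real ^ 'd) \<Rightarrow> real) \<times> (real \<Rightarrow> complex) \<times> (real ^ 'd \<Rightarrow> complex)) list \<Rightarrow>
     (real \<times> (real ^ 'd)) \<times> (((real \<Rightarrow> complex) \<Rightarrow> complex) \<times> (real ^ 'd)) \<Rightarrow> complex" where
  "limit_sum xs z = (\<Sum>(\<phi>, f, g)\<leftarrow>xs. complex_of_real (\<phi> (fst z)) * (fst (snd z) f * g (snd (snd z))))"

text \<open>
The list of the product of one sum with the conjugate of another. It turns the squared modulus of a sum into a sum
to which the mean value theorem for test functions applies.
\<close>

primrec conj_product where
  "conj_product [] ys = []"
| "conj_product (x # xs) ys =
     map (\<lambda>y. (\<lambda>p. fst x p * fst y p, \<lambda>\<tau>. fst (snd x) \<tau> * cnj (fst (snd y) \<tau>), \<lambda>w. snd (snd x) w * cnj (snd (snd y) w))) ys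
     @ conj_product xs ys"

lemma torus_continuous_conj_mult:
  fixes g h :: "real ^ 'd \<Rightarrow> complex"
  assumes "g \<in> torus_continuous" "h \<in> torus_continuous"
  shows "(\<lambda>w. g w * cnj (h w)) \<in> torus_continuous"
  using assms by (auto simp: torus_continuous_def intro!: continuous_intros)

lemma conj_product_in:
  assumes A: "algebra_with_mean_value \<epsilon> A" and xs: "xs \<in> lists (term_set A)" and ys: "ys \<in> lists (term_set A)"
  shows "conj_product xs ys \<in> lists (term_set A)"
  using xs
proof (induction xs)
  case (Cons x xs)
  have "set (map (\<lambda>y. (\<lambda>p. fst x p * fst y p, \<lambda>\<tau>. fst (snd x) \<tau> * cnj (fst (snd y) \<tau>), \<lambda>w. snd (snd x) w * cnj (snd (snd y) w))) ys) \<subseteq> term_set A"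
    using Cons.hyps ys
    by (auto simp: term_set_def lipschitz_test_mult torus_continuous_conj_mult algebra_mult[OF A] algebra_cnj[OF A])
  then show ?case using Cons.IH by (auto simp: in_lists_conv_set)
qed simp

lemma oscillating_sum_conj_product:
  "oscillating_sum \<Phi> c (conj_product xs ys) p = oscillating_sum \<Phi> c xs p * cnj (oscillating_sum \<Phi> c ys p)"
proof (induction xs)
  case (Cons x xs)
  obtain \<phi> f g where x: "x = (\<phi>, f, g)" by (cases x)
  have "oscillating_sum \<Phi> c (map (\<lambda>y. (\<lambda>p. fst x p * fst y p, \<lambda>\<tau>. fst (snd x) \<tau> * cnj (fst (snd y) \<tau>), \<lambda>w. snd (snd x) w * cnj (snd (snd y) w))) ys) p
      = oscillating_term \<Phi> c \<phi> f g p * cnj (oscillating_sum \<Phi> c ys p)"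
    by (induction ys) (auto simp: oscillating_sum_def oscillating_term_def x algebra_simps)
  with Cons.IH show ?case by (simp add: oscillating_sum_def x distrib_right)
qed (simp add: oscillating_sum_def)

text \<open>
Here multiplicativity of characters and their compatibility with conjugation are used.
\<close>

lemma limit_sum_conj_product:
  assumes A: "algebra_with_mean_value \<epsilon> A" and xs: "xs \<in> lists (term_set A)" and ys: "ys \<in> lists (term_set A)"
    and s: "s \<in> spectrum A"
  shows "limit_sum (conj_product xs ys) (p, (s, y)) = limit_sum xs (p, (s, y)) * cnj (limit_sum ys (p, (s, y)))"
  using xs
proof (induction xs)
  case (Cons x xs)
  obtain \<phi> f g where x: "x = (\<phi>, f, g)" by (cases x)
  have f: "f \<in> A" using Cons.hyps by (simp add: x term_set_def)
  have "limit_sum (map (\<lambda>y. (\<lambda>p. fst x p * fst y p, \<lambda>\<tau>. fst (snd x) \<tau> * cnj (fst (snd y) \<tau>), \<lambda>w. snd (snd x) w * cnj (snd (snd y) w))) ys) (p, (s, y))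
      = (complex_of_real (\<phi> p) * (s f * g y)) * cnj (limit_sum ys (p, (s, y)))"
    using ys
  proof (induction ys)
    case (Cons z ys)
    obtain \<phi>' f' g' where z: "z = (\<phi>', f', g')" by (cases z)
    have f': "f' \<in> A" using Cons.hyps by (simp add: z term_set_def)
    have "s (\<lambda>\<tau>. f \<tau> * cnj (f' \<tau>)) = s f * cnj (s f')"
      using spectrum_mult[OF s f algebra_cnj[OF A f']] spectrum_cnj[OF A s f'] by simp
    with Cons.IH show ?case by (simp add: limit_sum_def x z algebra_simps)
  qed (simp add: limit_sum_def)
  with Cons.IH show ?case by (simp add: limit_sum_def x distrib_right)
qed (simp add: limit_sum_def)

lemma oscillating_sum_append: "oscillating_sum \<Phi> c (xs @ ys) p = oscillating_sum \<Phi> c xs p + oscillating_sum \<Phi> c ys p"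
  by (simp add: oscillating_sum_def)

lemma oscillating_sum_scale: "oscillating_sum \<Phi> c (scale_terms a xs) p = a * oscillating_sum \<Phi> c xs p"
  by (induction xs) (auto simp: oscillating_sum_def scale_terms_def oscillating_term_def algebra_simps)

lemma limit_sum_append: "limit_sum (xs @ ys) z = limit_sum xs z + limit_sum ys z"
  by (simp add: limit_sum_def)

lemma limit_sum_scale:
  assumes s: "s \<in> spectrum A" and xs: "xs \<in> lists (term_set A)"
  shows "limit_sum (scale_terms a xs) (p, (s, y)) = a * limit_sum xs (p, (s, y))"
  using xs
proof (induction xs)
  case (Cons x xs)
  obtain \<phi> f g where x: "x = (\<phi>, f, g)" by (cases x)
  have "s (\<lambda>x. a * f x) = a * s f" using Cons.hyps by (intro spectrum_scale[OF s]) (simp add: x term_set_def)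
  with Cons.IH show ?case by (simp add: limit_sum_def scale_terms_def x algebra_simps)
qed (simp add: limit_sum_def scale_terms_def)

lemma oscillating_sum_test_sum:
  assumes A: "algebra_with_mean_value \<epsilon> A" and xs: "xs \<in> lists (term_set A)"
  shows "oscillating_sum \<Phi> c xs p = apply_bcontfun (test_sum xs (flow_shift \<Phi> c p)) (fst p / c, (1 / c) *\<^sub>R snd p)"
  using xs
proof (induction xs)
  case (Cons x xs)
  obtain \<phi> f g where x: "x = (\<phi>, f, g)" by (cases x)
  have fg: "f \<in> BUC" "g \<in> torus_continuous" using Cons.hyps algebra_BUC[OF A] by (auto simp: x term_set_def)
  show ?case using Cons.IH tensor_bcontfun[OF fg]
    by (simp add: x oscillating_sum_def test_sum_def oscillating_term_def plus_bcontfun.rep_eq scaleR_bcontfun.rep_eq scaleR_conv_of_real)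
qed (simp add: oscillating_sum_def test_sum_def)

lemma limit_sum_test_sum:
  assumes A: "algebra_with_mean_value \<epsilon> A" and xs: "xs \<in> lists (term_set A)" and s: "s \<in> spectrum A"
  shows "limit_sum xs (p, (s, y)) = gelfand (\<lambda>\<tau>. apply_bcontfun (test_sum xs p) (\<tau>, y)) s"
  using xs
proof (induction xs)
  case Nil
  then show ?case using spectrum_const[OF A s, of 0] by (simp add: limit_sum_def test_sum_def gelfand_def)
next
  case (Cons x xs)
  obtain \<phi> f g where x: "x = (\<phi>, f, g)" by (cases x)
  have fg: "f \<in> A" "g \<in> torus_continuous" using Cons.hyps by (auto simp: x term_set_def)
  have slice: "(\<lambda>\<tau>. apply_bcontfun (test_sum xs p) (\<tau>, y)) \<in> A"
    using Cons.hyps(2) by (intro product_algebra_slice[OF A] test_sum_in_product_algebra[OF A])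
  define c where "c = complex_of_real (\<phi> p) * g y"
  have "(\<lambda>\<tau>. apply_bcontfun (test_sum (x # xs) p) (\<tau>, y)) = (\<lambda>\<tau>. c * f \<tau> + apply_bcontfun (test_sum xs p) (\<tau>, y))"
    using tensor_bcontfun[OF algebra_BUC[OF A fg(1)] fg(2)]
    by (simp add: x test_sum_def plus_bcontfun.rep_eq scaleR_bcontfun.rep_eq scaleR_conv_of_real c_def mult_ac)
  then have "gelfand (\<lambda>\<tau>. apply_bcontfun (test_sum (x # xs) p) (\<tau>, y)) s = c * s f + gelfand (\<lambda>\<tau>. apply_bcontfun (test_sum xs p) (\<tau>, y)) s"
    using spectrum_add[OF s algebra_scale[OF A fg(1), of c] slice] spectrum_scale[OF s fg(1), of c] by (simp add: gelfand_def)
  with Cons.IH show ?case by (simp add: limit_sum_def x c_def mult_ac)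
qed

lemma space_limit_space:
  assumes "mean_value_measure \<epsilon> A \<beta>"
  shows "space (limit_space T \<beta> :: ((real \<times> (real ^ 'd)) \<times> (((real \<Rightarrow> complex) \<Rightarrow> complex) \<times> (real ^ 'd))) measure)
     = ({0<..<T} \<times> UNIV) \<times> (spectrum A \<times> unit_cell)"
  using mean_value_measure_space(1)[OF assms]
  by (simp add: limit_space_def space_pair_measure torus_measure_def unit_cell_def)

lemma oscillating_sum_integrable:
  assumes A: "algebra_with_mean_value \<epsilon> A" and \<Phi>: "admissible_flow \<Phi>" and xs: "xs \<in> lists (term_set A)"
  shows "integrable (time_space T) (oscillating_sum \<Phi> c xs)"
  using xs
proof (induction xs)
  case (Cons x xs)
  obtain \<phi> f g where x: "x = (\<phi>, f, g)" by (cases x)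
  have "integrable (time_space T) (oscillating_term \<Phi> c \<phi> f g)"
    using Cons.hyps algebra_BUC[OF A] by (intro oscillating_term_integrable[OF \<Phi>]) (auto simp: x term_set_def)
  with Cons.IH show ?case by (simp add: x oscillating_sum_def[abs_def])
qed (simp add: oscillating_sum_def[abs_def])

lemma limit_sum_integrable:
  assumes A: "algebra_with_mean_value \<epsilon> A" and \<beta>: "mean_value_measure \<epsilon> A \<beta>" and xs: "xs \<in> lists (term_set A)"
  shows "integrable (limit_space T \<beta>) (limit_sum xs)"
  using xs
proof (induction xs)
  case (Cons x xs)
  obtain \<phi> f g where x: "x = (\<phi>, f, g)" by (cases x)
  have "integrable (limit_space T \<beta>) (\<lambda>z. complex_of_real (\<phi> (fst z)) * (fst (snd z) f * g (snd (snd z))))"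
    using Cons.hyps by (intro limit_term_integrable[OF A \<beta>]) (auto simp: x term_set_def)
  with Cons.IH show ?case by (simp add: x limit_sum_def[abs_def])
qed (simp add: limit_sum_def[abs_def])

lemma oscillating_sum_mean:
  assumes A: "algebra_with_mean_value \<epsilon> A" and \<beta>: "mean_value_measure \<epsilon> A \<beta>" and \<Phi>: "admissible_flow \<Phi>"
    and \<epsilon>: "\<And>n. \<epsilon> n > 0" "\<epsilon> \<longlonglongrightarrow> 0" and T: "T > 0" and xs: "xs \<in> lists (term_set A)"
  shows "(\<lambda>n. LINT p|time_space T. oscillating_sum \<Phi> (\<epsilon> n) xs p) \<longlonglongrightarrow> (LINT z|limit_space T \<beta>. limit_sum xs z)"
  using xs
proof (induction xs)
  case (Cons x xs)
  obtain \<phi> f g where x: "x = (\<phi>, f, g)" by (cases x)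
  have t: "\<phi> \<in> lipschitz_tests" "f \<in> A" "g \<in> torus_continuous" "f \<in> BUC"
    using Cons.hyps algebra_BUC[OF A] by (auto simp: x term_set_def)
  obtain m where m: "has_mean_value \<epsilon> f m" using algebra_mean[OF A t(2)] by blast
  have "m = (LINT s|\<beta>. s f)"
    using has_mean_value_mean_value[OF m] \<beta> t(2) by (simp add: mean_value_measure_def gelfand_def)
  then have "(\<lambda>n. LINT p|time_space T. oscillating_term \<Phi> (\<epsilon> n) \<phi> f g p)
      \<longlonglongrightarrow> (LINT z|limit_space T \<beta>. complex_of_real (\<phi> (fst z)) * (fst (snd z) f * g (snd (snd z))))"
    using oscillating_term_mean[OF \<Phi> t(1,4,3) \<epsilon> m T] limit_term_integral[OF A \<beta> t(1,2,3), of T] by simp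
  from tendsto_add[OF this Cons.IH]
  show ?case
    using oscillating_term_integrable[OF \<Phi> t(1,4,3)] oscillating_sum_integrable[OF A \<Phi>, of xs]
      limit_term_integrable[OF A \<beta> t(1,2,3)] limit_sum_integrable[OF A \<beta>, of xs] Cons.hyps
    by (simp add: x oscillating_sum_def[abs_def] limit_sum_def[abs_def] in_lists_conv_set)
qed (simp add: oscillating_sum_def[abs_def] limit_sum_def[abs_def])

lemma oscillating_sum_square:
  assumes A: "algebra_with_mean_value \<epsilon> A" and \<Phi>: "admissible_flow \<Phi>" and xs: "xs \<in> lists (term_set A)"
  shows "square_integrable (time_space T) (oscillating_sum \<Phi> c xs)"
    and "complex_of_real (LINT p|time_space T. (cmod (oscillating_sum \<Phi> c xs p))\<^sup>2)
         = (LINT p|time_space T. oscillating_sum \<Phi> c (conj_product xs xs) p)"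
proof -
  have eq: "oscillating_sum \<Phi> c (conj_product xs xs) p = complex_of_real ((cmod (oscillating_sum \<Phi> c xs p))\<^sup>2)" for p
    by (simp only: oscillating_sum_conj_product complex_norm_square)
  have int: "integrable (time_space T) (oscillating_sum \<Phi> c (conj_product xs xs))"
    by (rule oscillating_sum_integrable[OF A \<Phi> conj_product_in[OF A xs xs]])
  have "integrable (time_space T) (\<lambda>p. Re (oscillating_sum \<Phi> c (conj_product xs xs) p))"
    using int by (rule integrable_Re)
  then show "square_integrable (time_space T) (oscillating_sum \<Phi> c xs)"
    using oscillating_sum_integrable[OF A \<Phi> xs] unfolding square_integrable_def eq by auto
  show "complex_of_real (LINT p|time_space T. (cmod (oscillating_sum \<Phi> c xs p))\<^sup>2)
         = (LINT p|time_space T. oscillating_sum \<Phi> c (conj_product xs xs) p)"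
    unfolding eq by (rule integral_complex_of_real[symmetric])
qed

lemma limit_sum_square:
  assumes A: "algebra_with_mean_value \<epsilon> A" and \<beta>: "mean_value_measure \<epsilon> A \<beta>" and xs: "xs \<in> lists (term_set A)"
  shows "square_integrable (limit_space T \<beta>) (limit_sum xs)"
    and "complex_of_real (LINT z|limit_space T \<beta>. (cmod (limit_sum xs z))\<^sup>2)
         = (LINT z|limit_space T \<beta>. limit_sum (conj_product xs xs) z)"
proof -
  have eq: "limit_sum (conj_product xs xs) z = complex_of_real ((cmod (limit_sum xs z))\<^sup>2)"
    if "z \<in> space (limit_space T \<beta>)" for z
  proof -
    obtain p s y where z: "z = (p, (s, y))" by (cases z) auto
    then have "s \<in> spectrum A" using that by (simp add: space_limit_space[OF \<beta>])
    then show ?thesis unfolding z by (simp only: limit_sum_conj_product[OF A xs xs] complex_norm_square)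
  qed
  have int: "integrable (limit_space T \<beta>) (limit_sum (conj_product xs xs))"
    by (rule limit_sum_integrable[OF A \<beta> conj_product_in[OF A xs xs]])
  have "integrable (limit_space T \<beta>) (\<lambda>z. Re (limit_sum (conj_product xs xs) z))"
    using int by (rule integrable_Re)
  then have "integrable (limit_space T \<beta>) (\<lambda>z. (cmod (limit_sum xs z))\<^sup>2)"
    by (rule Bochner_Integration.integrable_cong[THEN iffD1, OF refl, rotated]) (simp add: eq)
  then show "square_integrable (limit_space T \<beta>) (limit_sum xs)"
    using limit_sum_integrable[OF A \<beta> xs] unfolding square_integrable_def by auto
  show "complex_of_real (LINT z|limit_space T \<beta>. (cmod (limit_sum xs z))\<^sup>2)
         = (LINT z|limit_space T \<beta>. limit_sum (conj_product xs xs) z)"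
    unfolding integral_complex_of_real[symmetric]
    by (rule Bochner_Integration.integral_cong[OF refl]) (simp only: eq)
qed

text \<open>
The asymptotic isometry behind the whole argument.
\<close>

lemma square_norm_mean:
  assumes A: "algebra_with_mean_value \<epsilon> A" and \<beta>: "mean_value_measure \<epsilon> A \<beta>" and \<Phi>: "admissible_flow \<Phi>"
    and \<epsilon>: "\<And>n. \<epsilon> n > 0" "\<epsilon> \<longlonglongrightarrow> 0" and T: "T > 0" and xs: "xs \<in> lists (term_set A)"
  shows "(\<lambda>n. LINT p|time_space T. (cmod (oscillating_sum \<Phi> (\<epsilon> n) xs p))\<^sup>2)
          \<longlonglongrightarrow> (LINT z|limit_space T \<beta>. (cmod (limit_sum xs z))\<^sup>2)"
proof -
  have "(\<lambda>n. complex_of_real (LINT p|time_space T. (cmod (oscillating_sum \<Phi> (\<epsilon> n) xs p))\<^sup>2))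
          \<longlonglongrightarrow> complex_of_real (LINT z|limit_space T \<beta>. (cmod (limit_sum xs z))\<^sup>2)"
    unfolding oscillating_sum_square(2)[OF A \<Phi> xs] limit_sum_square(2)[OF A \<beta> xs]
    by (rule oscillating_sum_mean[OF A \<beta> \<Phi> \<epsilon> T conj_product_in[OF A xs xs]])
  then show ?thesis by (simp only: tendsto_of_real_iff)
qed

text \<open>
The remaining factors of the limit space carry probability measures, so the projection preserves measure.
\<close>

lemma limit_space_fst:
  fixes \<beta> :: "((real \<Rightarrow> complex) \<Rightarrow> complex) measure" and T :: real
  assumes \<beta>: "mean_value_measure \<epsilon> A \<beta>"
  defines "L \<equiv> limit_space T \<beta> :: ((real \<times> (real ^ 'd)) \<times> (((real \<Rightarrow> complex) \<Rightarrow> complex) \<times> (real ^ 'd))) measure"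
  shows limit_space_fst_measurable: "fst \<in> measurable L (time_space T)"
    and distr_limit_space_fst: "distr L (time_space T) fst = time_space T"
proof -
  interpret \<beta>: prob_space \<beta> by (rule mean_value_measure_space[OF \<beta>])
  interpret torus: prob_space "torus_measure :: (real ^ 'd) measure" by (rule prob_space_torus_measure)
  interpret st: pair_prob_space \<beta> "torus_measure :: (real ^ 'd) measure" ..
  show "fst \<in> measurable L (time_space T)"
    unfolding L_def limit_space_def by (intro measurable_completion measurable_fst)
  show "distr L (time_space T) fst = time_space T"
    unfolding L_def limit_space_def using st.distr_pair_fst by (subst distr_completion) auto
qed

section \<open>Weak Sigma-compactness along the flow\<close>

lemma test_approximation_sequence:
  assumes "test_approximable T A \<psi>"
  obtains xs b where "\<And>k. xs k \<in> lists (term_set A)" "\<And>k. integrable (time_space T) (b k)"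
    "\<And>k. AE p in time_space T. (norm (\<psi> p - test_sum (xs k) p))\<^sup>2 \<le> b k p"
    "\<And>k::nat. (LINT p|time_space T. b k p) \<le> (1/2) ^ k"
proof -
  have "\<forall>k::nat. \<exists>xs b. xs \<in> lists (term_set A) \<and> integrable (time_space T) b \<and>
      (AE p in time_space T. (norm (\<psi> p - test_sum xs p))\<^sup>2 \<le> b p) \<and> (LINT p|time_space T. b p) \<le> (1/2) ^ k"
  proof
    fix k :: nat
    have "(1/2::real) ^ k > 0" by simp
    from test_approximableE[OF assms this] obtain xs b where "xs \<in> lists (term_set A)" "integrable (time_space T) b"
      "AE p in time_space T. (norm (\<psi> p - test_sum xs p))\<^sup>2 \<le> b p" "(LINT p|time_space T. b p) < (1/2) ^ k" .
    then show "\<exists>xs b. xs \<in> lists (term_set A) \<and> integrable (time_space T) b \<and>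
      (AE p in time_space T. (norm (\<psi> p - test_sum xs p))\<^sup>2 \<le> b p) \<and> (LINT p|time_space T. b p) \<le> (1/2) ^ k"
      by (intro exI[of _ xs] exI[of _ b]) simp
  qed
  then obtain xs where "\<forall>k::nat. \<exists>b. xs k \<in> lists (term_set A) \<and> integrable (time_space T) b \<and>
      (AE p in time_space T. (norm (\<psi> p - test_sum (xs k) p))\<^sup>2 \<le> b p) \<and> (LINT p|time_space T. b p) \<le> (1/2) ^ k"
    by (rule choice[THEN exE])
  then obtain b where "\<forall>k::nat. xs k \<in> lists (term_set A) \<and> integrable (time_space T) (b k) \<and>
      (AE p in time_space T. (norm (\<psi> p - test_sum (xs k) p))\<^sup>2 \<le> b k p) \<and> (LINT p|time_space T. b k p) \<le> (1/2) ^ k"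
    by (rule choice[THEN exE])
  then show thesis by (intro that[of xs b]) auto
qed

lemma complete_measure_limit_space: "complete_measure (limit_space T \<beta>)"
  unfolding limit_space_def by (rule completion.complete_measure_axioms)

text \<open>
Evaluation at \<open>(t/c, x/c)\<close> is a contraction from the supremum norm and the substitution preserves the measure, so the
approximation of \<open>\<psi>\<close> is inherited with the same rate, uniformly in \<open>c\<close>.
\<close>

lemma oscillating_test_approximation:
  fixes \<Phi> :: "real \<Rightarrow> real ^ 'd \<Rightarrow> real ^ 'd"
  assumes A: "algebra_with_mean_value \<epsilon> A" and \<Phi>: "admissible_flow \<Phi>"
    and xs: "\<And>k. xs k \<in> lists (term_set A)" and b: "\<And>k. integrable (time_space T) (b k)"
    and le: "\<And>k. AE p in time_space T. (norm (\<psi> p - test_sum (xs k) p))\<^sup>2 \<le> b k p"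
    and fast: "\<And>k::nat. (LINT p|time_space T. b k p) \<le> (1/2) ^ k"
  defines "W \<equiv> \<lambda>c p. apply_bcontfun (\<psi> (flow_shift \<Phi> c p)) (fst p / c, (1 / c) *\<^sub>R snd p)"
  shows "square_integrable (time_space T) (W c)"
    and "(LINT p|time_space T. (cmod (W c p - oscillating_sum \<Phi> c (xs k) p))\<^sup>2) \<le> (1/2) ^ k"
proof -
  have S: "flow_shift \<Phi> c \<in> measurable (time_space T) (time_space T)" "distr (time_space T) (time_space T) (flow_shift \<Phi> c) = time_space T"
    using flow_shift_time_space[OF \<Phi>] .
  have bm: "b k \<in> borel_measurable (time_space T)" for k using b by auto
  have int: "integrable (time_space T) (\<lambda>p. b k (flow_shift \<Phi> c p))" for k
    using b[of k] by (intro integrable_distr[OF S(1)]) (simp add: S(2))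
  have le': "AE p in time_space T. (cmod (W c p - oscillating_sum \<Phi> c (xs k) p))\<^sup>2 \<le> b k (flow_shift \<Phi> c p)" for k
  proof -
    have "AE p in distr (time_space T) (time_space T) (flow_shift \<Phi> c). (norm (\<psi> p - test_sum (xs k) p))\<^sup>2 \<le> b k p"
      unfolding S(2) by (rule le)
    from AE_distrD[OF S(1) this] show ?thesis
    proof eventually_elim
      case (elim p)
      have "W c p - oscillating_sum \<Phi> c (xs k) p
          = apply_bcontfun (\<psi> (flow_shift \<Phi> c p) - test_sum (xs k) (flow_shift \<Phi> c p)) (fst p / c, (1 / c) *\<^sub>R snd p)"
        by (simp add: W_def oscillating_sum_test_sum[OF A xs] minus_bcontfun.rep_eq)
      then have "cmod (W c p - oscillating_sum \<Phi> c (xs k) p) \<le> norm (\<psi> (flow_shift \<Phi> c p) - test_sum (xs k) (flow_shift \<Phi> c p))"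
        using norm_bounded[of "\<psi> (flow_shift \<Phi> c p) - test_sum (xs k) (flow_shift \<Phi> c p)" "(fst p / c, (1 / c) *\<^sub>R snd p)"]
        by (simp only:)
      then have "(cmod (W c p - oscillating_sum \<Phi> c (xs k) p))\<^sup>2 \<le> (norm (\<psi> (flow_shift \<Phi> c p) - test_sum (xs k) (flow_shift \<Phi> c p)))\<^sup>2"
        by (intro power_mono) auto
      with elim show ?case by linarith
    qed
  qed
  have fast': "(LINT p|time_space T. b k (flow_shift \<Phi> c p)) \<le> (1/2) ^ k" for k
    using integral_distr[OF S(1) bm[of k]] fast[of k] by (simp add: S(2))
  note * = square_integrable_approximation[OF complete_measure_time_space oscillating_sum_square(1)[OF A \<Phi> xs] int le' fast']
  show "square_integrable (time_space T) (W c)" by (rule *(1))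
  show "(LINT p|time_space T. (cmod (W c p - oscillating_sum \<Phi> c (xs k) p))\<^sup>2) \<le> (1/2) ^ k" by (rule *(2))
qed

text \<open>
Characters are contractive, so the Gelfand transform inherits the approximation of \<open>\<psi>\<close> with the same rate.
\<close>

lemma limit_test_approximation:
  fixes \<psi> :: "real \<times> (real ^ 'd) \<Rightarrow> (real \<times> (real ^ 'd)) \<Rightarrow>\<^sub>C complex"
  assumes A: "algebra_with_mean_value \<epsilon> A" and \<beta>: "mean_value_measure \<epsilon> A \<beta>" and \<psi>: "\<psi> \<in> bochner_L2 (time_space T) (product_algebra A)"
    and xs: "\<And>k. xs k \<in> lists (term_set A)" and b: "\<And>k. integrable (time_space T) (b k)"
    and le: "\<And>k. AE p in time_space T. (norm (\<psi> p - test_sum (xs k) p))\<^sup>2 \<le> b k p"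
    and fast: "\<And>k::nat. (LINT p|time_space T. b k p) \<le> (1/2) ^ k"
  defines "\<Psi> \<equiv> \<lambda>z. gelfand (\<lambda>\<tau>. apply_bcontfun (\<psi> (fst z)) (\<tau>, snd (snd z))) (fst (snd z))"
  shows "square_integrable (limit_space T \<beta>) \<Psi>"
    and "(LINT z|limit_space T \<beta>. (cmod (\<Psi> z - limit_sum (xs k) z))\<^sup>2) \<le> (1/2) ^ k"
proof -
  let ?L = "limit_space T \<beta> :: ((real \<times> (real ^ 'd)) \<times> (((real \<Rightarrow> complex) \<Rightarrow> complex) \<times> (real ^ 'd))) measure"
  have S: "fst \<in> measurable ?L (time_space T)" "distr ?L (time_space T) fst = time_space T"
    using limit_space_fst[OF \<beta>] .
  have bm: "b k \<in> borel_measurable (time_space T)" for k using b by auto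
  have int: "integrable ?L (\<lambda>z. b k (fst z))" for k
    using b[of k] by (intro integrable_distr[OF S(1)]) (simp add: S(2))
  have le': "AE z in ?L. (cmod (\<Psi> z - limit_sum (xs k) z))\<^sup>2 \<le> b k (fst z)" for k
  proof -
    have "AE p in distr ?L (time_space T) fst. (norm (\<psi> p - test_sum (xs k) p))\<^sup>2 \<le> b k p"
      unfolding S(2) by (rule le)
    from AE_distrD[OF S(1) this] AE_space show ?thesis
    proof eventually_elim
      case (elim z)
      obtain p s y where z: "z = (p, (s, y))" by (cases z) auto
      have s: "s \<in> spectrum A" and p: "p \<in> space (time_space T)"
        using elim(2) by (auto simp: z space_limit_space[OF \<beta>])
      have \<psi>p: "\<psi> p \<in> product_algebra A" using \<psi> p by (auto simp: bochner_L2_def)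
      have tp: "test_sum (xs k) p \<in> product_algebra A" by (rule test_sum_in_product_algebra[OF A xs])
      note sl = product_algebra_slice[OF A \<psi>p, of y] product_algebra_slice[OF A tp, of y]
      have "\<Psi> z - limit_sum (xs k) z
          = s (\<lambda>\<tau>. apply_bcontfun (\<psi> p) (\<tau>, y) - apply_bcontfun (test_sum (xs k) p) (\<tau>, y))"
        unfolding z limit_sum_test_sum[OF A xs s] \<Psi>_def gelfand_def
        by (simp add: spectrum_diff[OF A s sl])
      moreover have "cmod (s (\<lambda>\<tau>. apply_bcontfun (\<psi> p) (\<tau>, y) - apply_bcontfun (test_sum (xs k) p) (\<tau>, y)))
          \<le> norm (\<psi> p - test_sum (xs k) p)"
      proof (rule spectrum_contractive[OF A s algebra_diff[OF A sl]])
        show "cmod (apply_bcontfun (\<psi> p) (\<tau>, y) - apply_bcontfun (test_sum (xs k) p) (\<tau>, y)) \<le> norm (\<psi> p - test_sum (xs k) p)" for \<tau>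
          using norm_bounded[of "\<psi> p - test_sum (xs k) p" "(\<tau>, y)"] by (simp add: minus_bcontfun.rep_eq)
      qed
      ultimately have "cmod (\<Psi> z - limit_sum (xs k) z) \<le> norm (\<psi> p - test_sum (xs k) p)" by simp
      then have "(cmod (\<Psi> z - limit_sum (xs k) z))\<^sup>2 \<le> (norm (\<psi> p - test_sum (xs k) p))\<^sup>2"
        by (intro power_mono) auto
      also have "\<dots> \<le> b k (fst z)" using elim(1) by (simp add: z)
      finally show ?case .
    qed
  qed
  have fast': "(LINT z|?L. b k (fst z)) \<le> (1/2) ^ k" for k
    using integral_distr[OF S(1) bm[of k]] fast[of k] by (simp add: S(2))
  note * = square_integrable_approximation[OF complete_measure_limit_space limit_sum_square(1)[OF A \<beta> xs] int le' fast']
  show "square_integrable ?L \<Psi>" by (rule *(1))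
  show "(LINT z|?L. (cmod (\<Psi> z - limit_sum (xs k) z))\<^sup>2) \<le> (1/2) ^ k" by (rule *(2))
qed

text \<open>
Young's inequality with weight \<open>2^-k\<close> balances the rate \<open>4^-k\<close> of the approximation.
\<close>

lemma norm_integral_mult_approximation:
  assumes f: "square_integrable M f" and F: "square_integrable M F" and G: "square_integrable M G"
    and C: "(LINT x|M. (cmod (f x))\<^sup>2) \<le> C" and d: "(LINT x|M. (cmod (F x - G x))\<^sup>2) \<le> (1/4) ^ k"
  shows "cmod ((LINT x|M. f x * F x) - (LINT x|M. f x * G x)) \<le> (C + 1) * (1/2) ^ k"
proof -
  have "(LINT x|M. f x * F x) - (LINT x|M. f x * G x) = (LINT x|M. f x * (F x - G x))"
    by (simp add: right_diff_distrib square_integrable_mult f F G)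
  also have "cmod \<dots> \<le> (1/2) ^ k * (LINT x|M. (cmod (f x))\<^sup>2) + (LINT x|M. (cmod (F x - G x))\<^sup>2) / (1/2) ^ k"
    by (intro norm_integral_mult_le f square_integrable_diff F G) simp
  also have "\<dots> \<le> (1/2) ^ k * C + (1/4) ^ k / (1/2) ^ k"
    using C d by (intro add_mono mult_left_mono divide_right_mono) auto
  also have "(1/4::real) ^ k / (1/2) ^ k = (1/2) ^ k"
    by (simp flip: power_divide)
  finally show ?thesis by (simp add: algebra_simps)
qed

theorem theorem5:
  fixes T :: real
    and \<epsilon> :: "nat \<Rightarrow> real"
    and A :: "(real \<Rightarrow> complex) set"
    and \<beta> :: "((real \<Rightarrow> complex) \<Rightarrow> complex) measure"
    and \<Phi> :: "real \<Rightarrow> real ^ 'd \<Rightarrow> real ^ 'd"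
    and u :: "nat \<Rightarrow> real \<times> (real ^ 'd) \<Rightarrow> complex"
  assumes "T > 0"
    and "\<And>n. \<epsilon> n > 0" and "\<epsilon> \<longlonglongrightarrow> 0"
    and "algebra_with_mean_value \<epsilon> A"
    and "mean_value_measure \<epsilon> A \<beta>"
    and "admissible_flow \<Phi>"
    and "\<And>n. square_integrable (time_space T) (u n)"
    and "\<exists>C. \<forall>n. (LINT p|time_space T. (cmod (u n p))\<^sup>2) \<le> C"
  shows "\<exists>r :: nat \<Rightarrow> nat. strict_mono r \<and>
           (\<exists>u0. square_integrable (limit_space T \<beta>) u0 \<and>
              weakly_Sigma_converges T A \<beta> \<Phi> (\<epsilon> \<circ> r) (u \<circ> r) u0)"
proof -
  note T = assms(1) and \<epsilon> = assms(2,3) and A = assms(4) and \<beta> = assms(5) and \<Phi> = assms(6) and u = assms(7)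
  obtain C where C: "\<And>n. (LINT p|time_space T. (cmod (u n p))\<^sup>2) \<le> C" using assms(8) by blast
  let ?L = "limit_space T \<beta> :: ((real \<times> (real ^ 'd)) \<times> (((real \<Rightarrow> complex) \<Rightarrow> complex) \<times> (real ^ 'd))) measure"
  define l where "l n xs = (LINT p|time_space T. u n p * oscillating_sum \<Phi> (\<epsilon> n) xs p)" for n xs
  have comb: "\<exists>\<omega>\<in>lists (term_set A). (\<forall>n. l n \<omega> = l n \<psi> + c * l n \<xi>) \<and>
      (\<forall>z\<in>space ?L. limit_sum \<omega> z = limit_sum \<psi> z + c * limit_sum \<xi> z)"
    if \<psi>: "\<psi> \<in> lists (term_set A)" and \<xi>: "\<xi> \<in> lists (term_set A)" for \<psi> \<xi> c
  proof (intro bexI[of _ "\<psi> @ scale_terms c \<xi>"] conjI allI ballI)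
    show "\<psi> @ scale_terms c \<xi> \<in> lists (term_set A)" using \<psi> scale_terms_in[OF A \<xi>] by simp
    show "l n (\<psi> @ scale_terms c \<xi>) = l n \<psi> + c * l n \<xi>" for n
    proof -
      have "l n (\<psi> @ scale_terms c \<xi>) = (LINT p|time_space T. u n p * oscillating_sum \<Phi> (\<epsilon> n) \<psi> p + c * (u n p * oscillating_sum \<Phi> (\<epsilon> n) \<xi> p))"
        unfolding l_def by (intro Bochner_Integration.integral_cong refl) (simp add: oscillating_sum_append oscillating_sum_scale algebra_simps)
      also have "\<dots> = l n \<psi> + c * l n \<xi>"
        unfolding l_def
        using square_integrable_mult[OF u[of n] oscillating_sum_square(1)[OF A \<Phi> \<psi>, of T "\<epsilon> n"]]
          square_integrable_mult[OF u[of n] oscillating_sum_square(1)[OF A \<Phi> \<xi>, of T "\<epsilon> n"]] by simp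
      finally show ?thesis .
    qed
    fix z assume "z \<in> space ?L"
    then obtain p s y where z: "z = (p, (s, y))" and s: "s \<in> spectrum A"
      by (cases z) (auto simp: space_limit_space[OF \<beta>])
    show "limit_sum (\<psi> @ scale_terms c \<xi>) z = limit_sum \<psi> z + c * limit_sum \<xi> z"
      unfolding z by (simp add: limit_sum_append limit_sum_scale[OF s \<xi>])
  qed
  \<comment> \<open>The 1 absorbs the error in the convergence of the squared norms.\<close>
  have bound: "\<forall>\<^sub>F n in sequentially. 2 * Re (l n \<psi>) \<le> (C + 1) + (LINT z|?L. (cmod (limit_sum \<psi> z))\<^sup>2)"
    if \<psi>: "\<psi> \<in> lists (term_set A)" for \<psi>
  proof -
    have "(LINT z|?L. (cmod (limit_sum \<psi> z))\<^sup>2) < (LINT z|?L. (cmod (limit_sum \<psi> z))\<^sup>2) + 1" by simp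
    from order_tendstoD(2)[OF square_norm_mean[OF A \<beta> \<Phi> \<epsilon> T \<psi>] this]
    show ?thesis
    proof eventually_elim
      case (elim n)
      have "2 * Re (l n \<psi>) \<le> 2 * cmod (l n \<psi>)" using complex_Re_le_cmod[of "l n \<psi>"] by simp
      also have "\<dots> \<le> 1 * (LINT p|time_space T. (cmod (u n p))\<^sup>2) + (LINT p|time_space T. (cmod (oscillating_sum \<Phi> (\<epsilon> n) \<psi> p))\<^sup>2) / 1"
        unfolding l_def by (intro two_norm_integral_mult_le u oscillating_sum_square(1)[OF A \<Phi> \<psi>]) simp
      finally show ?case using elim C[of n] by simp
    qed
  qed
  obtain r u0 where r: "strict_mono r" and u0: "square_integrable ?L u0"
    and conv: "\<And>\<psi>. \<psi> \<in> lists (term_set A) \<Longrightarrow> (\<lambda>n. l (r n) \<psi>) \<longlonglongrightarrow> (LINT z|?L. u0 z * limit_sum \<psi> z)"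
  proof (rule weakly_convergent_subsequence_of_functionals)
    show "lists (term_set A) \<noteq> {}" by auto
    show "square_integrable ?L (limit_sum xs)" if "xs \<in> lists (term_set A)" for xs
      using that by (rule limit_sum_square(1)[OF A \<beta>])
    fix r :: "nat \<Rightarrow> nat" and u0
    assume "strict_mono r" "square_integrable ?L u0"
      "\<And>\<psi>. \<psi> \<in> lists (term_set A) \<Longrightarrow> (\<lambda>n. l (r n) \<psi>) \<longlonglongrightarrow> (LINT z|?L. u0 z * limit_sum \<psi> z)"
    then show thesis by (rule that)
  qed (rule comb bound; assumption)+
  have "weakly_Sigma_converges T A \<beta> \<Phi> (\<epsilon> \<circ> r) (u \<circ> r) u0"
    unfolding weakly_Sigma_converges_def
  proof
    fix \<psi> :: "real \<times> (real ^ 'd) \<Rightarrow> (real \<times> (real ^ 'd)) \<Rightarrow>\<^sub>C complex"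
    assume \<psi>: "\<psi> \<in> bochner_L2 (time_space T) (product_algebra A)"
    obtain xs0 b0 where 0: "\<And>k. xs0 k \<in> lists (term_set A)" "\<And>k. integrable (time_space T) (b0 k)"
      "\<And>k. AE p in time_space T. (norm (\<psi> p - test_sum (xs0 k) p))\<^sup>2 \<le> b0 k p"
      "\<And>k::nat. (LINT p|time_space T. b0 k p) \<le> (1/2) ^ k"
      using test_approximation_sequence[OF bochner_L2_test_approximable[OF A \<psi>]] by blast
    define W where "W c p = apply_bcontfun (\<psi> (flow_shift \<Phi> c p)) (fst p / c, (1 / c) *\<^sub>R snd p)" for c p
    define \<Psi> where "\<Psi> z = gelfand (\<lambda>\<tau>. apply_bcontfun (\<psi> (fst z)) (\<tau>, snd (snd z))) (fst (snd z))"
      for z :: "(real \<times> (real ^ 'd)) \<times> (((real \<Rightarrow> complex) \<Rightarrow> complex) \<times> (real ^ 'd))"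
    note W = oscillating_test_approximation[OF A \<Phi> 0, folded W_def]
    note \<Psi> = limit_test_approximation[OF A \<beta> \<psi> 0, folded \<Psi>_def]
    \<comment> \<open>The approximating sum number \<open>2 k\<close> is used so that its squared error is at
      most \<open>(1/4) ^ k\<close>.\<close>
    have quarter: "(1/2::real) ^ (2 * k) = (1/4) ^ k" for k
      by (simp add: power_mult power2_eq_square)
    define D where "D = max C (LINT z|?L. (cmod (u0 z))\<^sup>2)"
    have "(\<lambda>n. LINT p|time_space T. u (r n) p * W (\<epsilon> (r n)) p) \<longlonglongrightarrow> (LINT z|?L. u0 z * \<Psi> z)"
    proof (rule tendsto_integral_of_approximation)
      show "(\<lambda>n. l (r n) (xs0 (2 * k))) \<longlonglongrightarrow> (LINT z|?L. u0 z * limit_sum (xs0 (2 * k)) z)" for k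
        by (rule conv[OF 0(1)])
      show "cmod ((LINT p|time_space T. u (r n) p * W (\<epsilon> (r n)) p) - l (r n) (xs0 (2 * k))) \<le> (D + 1) * (1/2) ^ k" for k n
        unfolding l_def
      proof (rule norm_integral_mult_approximation[OF u W(1) oscillating_sum_square(1)[OF A \<Phi> 0(1)]])
        show "(LINT p|time_space T. (cmod (u (r n) p))\<^sup>2) \<le> D" using C[of "r n"] by (simp add: D_def)
        show "(LINT p|time_space T. (cmod (W (\<epsilon> (r n)) p - oscillating_sum \<Phi> (\<epsilon> (r n)) (xs0 (2 * k)) p))\<^sup>2) \<le> (1/4) ^ k"
          using W(2)[of "\<epsilon> (r n)" "2 * k"] by (simp only: quarter)
      qed
      show "cmod ((LINT z|?L. u0 z * \<Psi> z) - (LINT z|?L. u0 z * limit_sum (xs0 (2 * k)) z)) \<le> (D + 1) * (1/2) ^ k" for k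
      proof (rule norm_integral_mult_approximation[OF u0 \<Psi>(1) limit_sum_square(1)[OF A \<beta> 0(1)]])
        show "(LINT z|?L. (cmod (u0 z))\<^sup>2) \<le> D" by (simp add: D_def)
        show "(LINT z|?L. (cmod (\<Psi> z - limit_sum (xs0 (2 * k)) z))\<^sup>2) \<le> (1/4) ^ k"
          using \<Psi>(2)[of "2 * k"] by (simp only: quarter)
      qed
      have "(\<lambda>k. (D + 1) * (1/2::real) ^ k) \<longlonglongrightarrow> (D + 1) * 0"
        by (intro tendsto_intros) auto
      then show "(\<lambda>k. (D + 1) * (1/2::real) ^ k) \<longlonglongrightarrow> 0" by simp
    qed
    then show "(\<lambda>n. LINT (t, x)|time_space T.
               (u \<circ> r) n (t, x) *
               apply_bcontfun (\<psi> (t, \<Phi> (- (t / (\<epsilon> \<circ> r) n)) x)) (t / (\<epsilon> \<circ> r) n, (1 / (\<epsilon> \<circ> r) n) *\<^sub>R x))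
        \<longlonglongrightarrow>
        (LINT ((t, X), (s, y))|?L.
               u0 ((t, X), (s, y)) * gelfand (\<lambda>\<tau>. apply_bcontfun (\<psi> (t, X)) (\<tau>, y)) s)"
      by (simp add: W_def \<Psi>_def flow_shift_def split_beta')
  qed
  with r u0 show ?thesis by blast
qed

end
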